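(* Let $(\mathcal{C},\times,1)$ be a small cartesian monoidal category. Then the final fixpoint of the equation $$Q(\mathbf{X},\mathbf{Y})\cong\int^{M\in\mathcal{C}}\mathcal{C}(X_0,M\times Y_0)\times Q(M\cdot\mathbf{X}^+,\mathbf{Y}^+)$$ is given by the sets of causal functions, $$\mathrm{STREAM}(\mathbf{X},\mathbf{Y})\cong\prod_{n\in\mathbb{N}}\mathcal{C}(X_0\times\dots\times X_n,\ Y_n).$$ Moreover, under these bijections, the symmetric monoidal category $\mathrm{STREAM}$ of monoidal streams over $\mathcal{C}$ coincides with the cokleisli monoidal category of the non-empty list comonad $\mathrm{List}^+\colon\mathcal{C}^{\mathbb{N}}\to\mathcal{C}^{\mathbb{N}}$.
   Context: $\mathcal{C}^{\mathbb{N}}$: sequences $\mathbf{X}=(X_0,X_1,\dots)$ of objects with componentwise morphisms; $\mathbf{X}^+=(X_1,X_2,\dots)$; $M\cdot\mathbf{X}=(M\times X_0,X_1,\dots)$. Composition in diagrammatic order $;$. $\mathrm{STREAM}(\mathbf{X},\mathbf{Y})$ denotes the final fixpoint above (monoidal streams); a stream has a memory $M(f)$, a first action $\mathrm{now}(f)\colon X_0\to M(f)\times Y_0$ and a rest $\mathrm{later}(f)\in\mathrm{STREAM}(M(f)\cdot\mathbf{X}^+,\mathbf{Y}^+)$, quotiented coinductively by: $f\sim g$ if there is $r\colon M(g)\to M(f)$ with $\mathrm{now}(f)=\mathrm{now}(g);(r\times1)$ and $r\cdot\mathrm{later}(f)\sim\mathrm{later}(g)$ ($r\cdot h$ precomposes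 the first action of $h$ with $r\times1$). Its category structure: composition has memory $M(f)\times M(g)$, first action $\mathrm{now}(f)$ followed by $\mathrm{now}(g)$, rest the composite of the rests (with memories carried along); identities have memory $1$; tensor has memory $M(f)\times M(g)$, first action $\mathrm{now}(f)\times\mathrm{now}(g)$ up to symmetries, rest the tensor of the rests. $\mathrm{List}^+(\mathbf{X})_n=X_0\times\dots\times X_n$; it is a comonad with counit the projections $X_0\times\dots\times X_n\to X_n$ and comultiplication $X_0\times\dots\times X_n\to\prod_{i=0}^n(X_0\times\dots\times X_i)$ built from copying and projections. Its cokleisli category has morphisms $\mathbf{X}\to\mathbf{Y}$ the families $f_n\colon X_0\times\dots\times X_n\to Y_n$, composition $(f;g)_n=\langle f_0\circ\pi_{\le0},\dots,f_n\circ\pi_{\le n}\rangle;g_n$ (where $\pi_{\le i}$ projects onto the first $i+1$ factors), and monoidal structure componentwise. *)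

theory Defs
  imports Main
begin

section \<open>Cartesian monoidal categories\<close>

text \<open>Composition is written in diagrammatic order. Smallness is automatic, objects and arrows
  being sets; the products are chosen, and are neither strictly associative nor strictly unital.\<close>

record ('o, 'm) cart_cat =
  Obj :: "'o set"
  Arr :: "'m set"
  Dom :: "'m \<Rightarrow> 'o"
  Cod :: "'m \<Rightarrow> 'o"
  Id :: "'o \<Rightarrow> 'm"
  Cmp :: "'m \<Rightarrow> 'm \<Rightarrow> 'm" (infixl "\<Zsemi>\<index>" 55)
  One :: "'o" ("\<one>\<index>")
  Prd :: "'o \<Rightarrow> 'o \<Rightarrow> 'o" (infixr "\<otimes>\<index>" 70)
  Pr1 :: "'o \<Rightarrow> 'o \<Rightarrow> 'm"
  Pr2 :: "'o \<Rightarrow> 'o \<Rightarrow> 'm"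

definition Hom :: "('o, 'm) cart_cat \<Rightarrow> 'o \<Rightarrow> 'o \<Rightarrow> 'm set" where
  "Hom C A B = {f \<in> Arr C. Dom C f = A \<and> Cod C f = B}"

locale cartesian_category =
  fixes C :: "('o, 'm) cart_cat" (structure)
  assumes dom_obj: "f \<in> Arr C \<Longrightarrow> Dom C f \<in> Obj C"
    and cod_obj: "f \<in> Arr C \<Longrightarrow> Cod C f \<in> Obj C"
    and id_hom: "A \<in> Obj C \<Longrightarrow> Id C A \<in> Hom C A A"
    and cmp_hom: "\<lbrakk>f \<in> Hom C A B; g \<in> Hom C B D\<rbrakk> \<Longrightarrow> f \<Zsemi> g \<in> Hom C A D"
    and id_cmp: "f \<in> Hom C A B \<Longrightarrow> Id C A \<Zsemi> f = f"
    and cmp_id: "f \<in> Hom C A B \<Longrightarrow> f \<Zsemi> Id C B = f"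
    and cmp_assoc:
      "\<lbrakk>f \<in> Hom C A B; g \<in> Hom C B D; h \<in> Hom C D E\<rbrakk> \<Longrightarrow> f \<Zsemi> g \<Zsemi> h = f \<Zsemi> (g \<Zsemi> h)"
    and one_obj: "\<one> \<in> Obj C"
    and one_terminal: "A \<in> Obj C \<Longrightarrow> \<exists>!f. f \<in> Hom C A \<one>"
    and prd_obj: "\<lbrakk>A \<in> Obj C; B \<in> Obj C\<rbrakk> \<Longrightarrow> A \<otimes> B \<in> Obj C"
    and pr1_hom: "\<lbrakk>A \<in> Obj C; B \<in> Obj C\<rbrakk> \<Longrightarrow> Pr1 C A B \<in> Hom C (A \<otimes> B) A"
    and pr2_hom: "\<lbrakk>A \<in> Obj C; B \<in> Obj C\<rbrakk> \<Longrightarrow> Pr2 C A B \<in> Hom C (A \<otimes> B) B"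
    and prd_universal: "\<lbrakk>f \<in> Hom C Z A; g \<in> Hom C Z B\<rbrakk> \<Longrightarrow>
      \<exists>!h. h \<in> Hom C Z (A \<otimes> B) \<and> h \<Zsemi> Pr1 C A B = f \<and> h \<Zsemi> Pr2 C A B = g"

definition bang :: "('o, 'm) cart_cat \<Rightarrow> 'o \<Rightarrow> 'm" where
  "bang C A = (THE f. f \<in> Hom C A \<one>\<^bsub>C\<^esub>)"

definition tuple :: "('o, 'm) cart_cat \<Rightarrow> 'm \<Rightarrow> 'm \<Rightarrow> 'm" where
  "tuple C f g = (THE h. h \<in> Hom C (Dom C f) (Cod C f \<otimes>\<^bsub>C\<^esub> Cod C g) \<and>
     h \<Zsemi>\<^bsub>C\<^esub> Pr1 C (Cod C f) (Cod C g) = f \<and> h \<Zsemi>\<^bsub>C\<^esub> Pr2 C (Cod C f) (Cod C g) = g)"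

definition cross :: "('o, 'm) cart_cat \<Rightarrow> 'm \<Rightarrow> 'm \<Rightarrow> 'm" (infixr "\<boxtimes>\<index>" 70) where
  "f \<boxtimes>\<^bsub>C\<^esub> g = tuple C (Pr1 C (Dom C f) (Dom C g) \<Zsemi>\<^bsub>C\<^esub> f) (Pr2 C (Dom C f) (Dom C g) \<Zsemi>\<^bsub>C\<^esub> g)"

context
  fixes C :: "('o, 'm) cart_cat" (structure)
begin

definition asc :: "'o \<Rightarrow> 'o \<Rightarrow> 'o \<Rightarrow> 'm" where
  "asc A B D = tuple C (Pr1 C (A \<otimes> B) D \<Zsemi> Pr1 C A B) (Pr2 C A B \<boxtimes> Id C D)"

definition asc' :: "'o \<Rightarrow> 'o \<Rightarrow> 'o \<Rightarrow> 'm" where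
  "asc' A B D = tuple C (Id C A \<boxtimes> Pr1 C B D) (Pr2 C A (B \<otimes> D) \<Zsemi> Pr2 C B D)"

definition lun :: "'o \<Rightarrow> 'm" where "lun A = Pr2 C \<one> A"

definition lun' :: "'o \<Rightarrow> 'm" where "lun' A = tuple C (bang C A) (Id C A)"

definition run :: "'o \<Rightarrow> 'm" where "run A = Pr1 C A \<one>"

definition swp :: "'o \<Rightarrow> 'o \<Rightarrow> 'm" where "swp A B = tuple C (Pr2 C A B) (Pr1 C A B)"

text \<open>\<open>(A \<otimes> B) \<otimes> D \<longrightarrow> (A \<otimes> D) \<otimes> B\<close>\<close>
definition swp_right :: "'o \<Rightarrow> 'o \<Rightarrow> 'o \<Rightarrow> 'm" where
  "swp_right A B D = asc A B D \<Zsemi> Id C A \<boxtimes> swp B D \<Zsemi> asc' A D B"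

text \<open>\<open>(A \<otimes> B) \<otimes> (D \<otimes> E) \<longrightarrow> (A \<otimes> D) \<otimes> (B \<otimes> E)\<close>\<close>
definition swp_mid :: "'o \<Rightarrow> 'o \<Rightarrow> 'o \<Rightarrow> 'o \<Rightarrow> 'm" where
  "swp_mid A B D E =
     asc' (A \<otimes> B) D E \<Zsemi> swp_right A B D \<boxtimes> Id C E \<Zsemi> asc (A \<otimes> D) B E"

end


section \<open>Sequences of objects and morphisms\<close>

definition seq_obj :: "('o, 'm) cart_cat \<Rightarrow> (nat \<Rightarrow> 'o) set" where
  "seq_obj C = {X. \<forall>n. X n \<in> Obj C}"

definition seq_hom :: "('o, 'm) cart_cat \<Rightarrow> (nat \<Rightarrow> 'o) \<Rightarrow> (nat \<Rightarrow> 'o) \<Rightarrow> (nat \<Rightarrow> 'm) set" where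
  "seq_hom C X Y = {u. \<forall>n. u n \<in> Hom C (X n) (Y n)}"

definition seq_id :: "('o, 'm) cart_cat \<Rightarrow> (nat \<Rightarrow> 'o) \<Rightarrow> nat \<Rightarrow> 'm" where
  "seq_id C X = (\<lambda>n. Id C (X n))"

definition seq_cmp :: "('o, 'm) cart_cat \<Rightarrow> (nat \<Rightarrow> 'm) \<Rightarrow> (nat \<Rightarrow> 'm) \<Rightarrow> nat \<Rightarrow> 'm" where
  "seq_cmp C u v = (\<lambda>n. u n \<Zsemi>\<^bsub>C\<^esub> v n)"

definition shift :: "(nat \<Rightarrow> 'x) \<Rightarrow> nat \<Rightarrow> 'x" where
  "shift X = (\<lambda>n. X (Suc n))"

text \<open>The action \<open>M \<cdot> X\<close> of objects on sequences, and the corresponding action of morphisms.\<close>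

definition dot :: "('o, 'm) cart_cat \<Rightarrow> 'o \<Rightarrow> (nat \<Rightarrow> 'o) \<Rightarrow> nat \<Rightarrow> 'o" (infixr "\<bullet>\<index>" 72) where
  "M \<bullet>\<^bsub>C\<^esub> X = X(0 := M \<otimes>\<^bsub>C\<^esub> X 0)"

definition dot_hom :: "('o, 'm) cart_cat \<Rightarrow> 'm \<Rightarrow> (nat \<Rightarrow> 'm) \<Rightarrow> nat \<Rightarrow> 'm" (infixr "\<odot>\<index>" 72) where
  "r \<odot>\<^bsub>C\<^esub> u = u(0 := r \<boxtimes>\<^bsub>C\<^esub> u 0)"


section \<open>The fixpoint equation\<close>

text \<open>Functors \<open>(C\<^sup>\<nat>)\<^sup>o\<^sup>p \<times> C\<^sup>\<nat> \<longrightarrow> Set\<close>, with values in sets over a type \<open>'q\<close>. For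
  \<open>u : X' \<longrightarrow> X\<close> and \<open>v : Y \<longrightarrow> Y'\<close>, the action \<open>Act Q u v\<close> maps \<open>El Q X Y\<close> to \<open>El Q X' Y'\<close>.\<close>

record ('o, 'm, 'q) prof =
  El :: "(nat \<Rightarrow> 'o) \<Rightarrow> (nat \<Rightarrow> 'o) \<Rightarrow> 'q set"
  Act :: "(nat \<Rightarrow> 'm) \<Rightarrow> (nat \<Rightarrow> 'm) \<Rightarrow> 'q \<Rightarrow> 'q"

definition profunctor :: "('o, 'm) cart_cat \<Rightarrow> ('o, 'm, 'q) prof \<Rightarrow> bool" where
  "profunctor C Q \<longleftrightarrow>
     (\<forall>X X' Y Y'. \<forall>u \<in> seq_hom C X' X. \<forall>v \<in> seq_hom C Y Y'. \<forall>q \<in> El Q X Y.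
        Act Q u v q \<in> El Q X' Y') \<and>
     (\<forall>X \<in> seq_obj C. \<forall>Y \<in> seq_obj C. \<forall>q \<in> El Q X Y.
        Act Q (seq_id C X) (seq_id C Y) q = q) \<and>
     (\<forall>X X' X'' Y Y' Y''. \<forall>u \<in> seq_hom C X' X. \<forall>u' \<in> seq_hom C X'' X'.
        \<forall>v \<in> seq_hom C Y Y'. \<forall>v' \<in> seq_hom C Y' Y''. \<forall>q \<in> El Q X Y.
        Act Q (seq_cmp C u' u) (seq_cmp C v v') q = Act Q u' v' (Act Q u v q))"

definition natural_transformation ::
  "('o, 'm) cart_cat \<Rightarrow> ('o, 'm, 'q) prof \<Rightarrow> ('o, 'm, 'p) prof \<Rightarrow>
   ((nat \<Rightarrow> 'o) \<Rightarrow> (nat \<Rightarrow> 'o) \<Rightarrow> 'q \<Rightarrow> 'p) \<Rightarrow> bool" where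
  "natural_transformation C Q P h \<longleftrightarrow>
     (\<forall>X \<in> seq_obj C. \<forall>Y \<in> seq_obj C. \<forall>q \<in> El Q X Y. h X Y q \<in> El P X Y) \<and>
     (\<forall>X X' Y Y'. \<forall>u \<in> seq_hom C X' X. \<forall>v \<in> seq_hom C Y Y'. \<forall>q \<in> El Q X Y.
        h X' Y' (Act Q u v q) = Act P u v (h X Y q))"

text \<open>The class, with respect to the equivalence \<open>r\<close>, of the image under \<open>f\<close> of any
  representative of \<open>c\<close>.\<close>

definition class_map :: "('b \<times> 'b) set \<Rightarrow> ('a \<Rightarrow> 'b) \<Rightarrow> 'a set \<Rightarrow> 'b set" where
  "class_map r f c = (\<Union>x \<in> c. r `` {f x})"

text \<open>The coend over \<open>M\<close> of \<open>C(X\<^sub>0, M \<otimes> Y\<^sub>0) \<times> Q(M \<cdot> X\<^sup>+, Y\<^sup>+)\<close> is the quotient of the disjoint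
  union over \<open>M\<close> by the equivalence relation generated by dinaturality in \<open>M\<close>.\<close>

definition coend_pre ::
  "('o, 'm) cart_cat \<Rightarrow> ('o, 'm, 'q) prof \<Rightarrow> (nat \<Rightarrow> 'o) \<Rightarrow> (nat \<Rightarrow> 'o) \<Rightarrow> ('o \<times> 'm \<times> 'q) set" where
  "coend_pre C Q X Y =
     {(M, f, q). M \<in> Obj C \<and> f \<in> Hom C (X 0) (M \<otimes>\<^bsub>C\<^esub> Y 0) \<and>
        q \<in> El Q (M \<bullet>\<^bsub>C\<^esub> shift X) (shift Y)}"

definition dinat ::
  "('o, 'm) cart_cat \<Rightarrow> ('o, 'm, 'q) prof \<Rightarrow> (nat \<Rightarrow> 'o) \<Rightarrow> (nat \<Rightarrow> 'o) \<Rightarrow> ('o \<times> 'm \<times> 'q) rel" where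
  "dinat C Q X Y =
     {((M, f, Act Q (r \<odot>\<^bsub>C\<^esub> seq_id C (shift X)) (seq_id C (shift Y)) q),
       (N, f \<Zsemi>\<^bsub>C\<^esub> r \<boxtimes>\<^bsub>C\<^esub> Id C (Y 0), q)) | M N r f q.
        r \<in> Hom C M N \<and> f \<in> Hom C (X 0) (M \<otimes>\<^bsub>C\<^esub> Y 0) \<and>
        q \<in> El Q (N \<bullet>\<^bsub>C\<^esub> shift X) (shift Y)}"

definition coend_rel ::
  "('o, 'm) cart_cat \<Rightarrow> ('o, 'm, 'q) prof \<Rightarrow> (nat \<Rightarrow> 'o) \<Rightarrow> (nat \<Rightarrow> 'o) \<Rightarrow> ('o \<times> 'm \<times> 'q) rel" where
  "coend_rel C Q X Y =
     (dinat C Q X Y \<union> (dinat C Q X Y)\<inverse>)\<^sup>* \<inter> coend_pre C Q X Y \<times> coend_pre C Q X Y"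

definition phi ::
  "('o, 'm) cart_cat \<Rightarrow> ('o, 'm, 'q) prof \<Rightarrow> ('o, 'm, ('o \<times> 'm \<times> 'q) set) prof" where
  "phi C Q =
     \<lparr>El = (\<lambda>X Y. coend_pre C Q X Y // coend_rel C Q X Y),
      Act = (\<lambda>u v. class_map (coend_rel C Q (\<lambda>n. Dom C (u n)) (\<lambda>n. Cod C (v n)))
        (\<lambda>(M, f, q). (M, u 0 \<Zsemi>\<^bsub>C\<^esub> f \<Zsemi>\<^bsub>C\<^esub> Id C M \<boxtimes>\<^bsub>C\<^esub> v 0,
           Act Q (Id C M \<odot>\<^bsub>C\<^esub> shift u) (shift v) q)))\<rparr>"

definition phi_map ::
  "('o, 'm) cart_cat \<Rightarrow> ('o, 'm, 'p) prof \<Rightarrow> ((nat \<Rightarrow> 'o) \<Rightarrow> (nat \<Rightarrow> 'o) \<Rightarrow> 'q \<Rightarrow> 'p) \<Rightarrow>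
   (nat \<Rightarrow> 'o) \<Rightarrow> (nat \<Rightarrow> 'o) \<Rightarrow> ('o \<times> 'm \<times> 'q) set \<Rightarrow> ('o \<times> 'm \<times> 'p) set" where
  "phi_map C P h X Y =
     class_map (coend_rel C P X Y) (\<lambda>(M, f, q). (M, f, h (M \<bullet>\<^bsub>C\<^esub> shift X) (shift Y) q))"

definition coalgebra ::
  "('o, 'm) cart_cat \<Rightarrow> ('o, 'm, 'q) prof \<Rightarrow>
   ((nat \<Rightarrow> 'o) \<Rightarrow> (nat \<Rightarrow> 'o) \<Rightarrow> 'q \<Rightarrow> ('o \<times> 'm \<times> 'q) set) \<Rightarrow> bool" where
  "coalgebra C Q c \<longleftrightarrow> profunctor C Q \<and> natural_transformation C Q (phi C Q) c"

definition coalgebra_hom ::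
  "('o, 'm) cart_cat \<Rightarrow>
   ('o, 'm, 'q) prof \<Rightarrow> ((nat \<Rightarrow> 'o) \<Rightarrow> (nat \<Rightarrow> 'o) \<Rightarrow> 'q \<Rightarrow> ('o \<times> 'm \<times> 'q) set) \<Rightarrow>
   ('o, 'm, 'p) prof \<Rightarrow> ((nat \<Rightarrow> 'o) \<Rightarrow> (nat \<Rightarrow> 'o) \<Rightarrow> 'p \<Rightarrow> ('o \<times> 'm \<times> 'p) set) \<Rightarrow>
   ((nat \<Rightarrow> 'o) \<Rightarrow> (nat \<Rightarrow> 'o) \<Rightarrow> 'q \<Rightarrow> 'p) \<Rightarrow> bool" where
  "coalgebra_hom C Q c P d h \<longleftrightarrow>
     natural_transformation C Q P h \<and>
     (\<forall>X \<in> seq_obj C. \<forall>Y \<in> seq_obj C. \<forall>q \<in> El Q X Y.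
        d X Y (h X Y q) = phi_map C P h X Y (c X Y q))"

text \<open>The type argument is the type over which the competing coalgebras range. Morphisms are
  unique as families of functions on the sets \<open>El Q X Y\<close>; their values elsewhere are irrelevant.\<close>

definition final_fixpoint ::
  "'q itself \<Rightarrow> ('o, 'm) cart_cat \<Rightarrow> ('o, 'm, 'p) prof \<Rightarrow>
   ((nat \<Rightarrow> 'o) \<Rightarrow> (nat \<Rightarrow> 'o) \<Rightarrow> 'p \<Rightarrow> ('o \<times> 'm \<times> 'p) set) \<Rightarrow> bool" where
  "final_fixpoint (_ :: 'q itself) C P d \<longleftrightarrow>
     coalgebra C P d \<and>
     (\<forall>X \<in> seq_obj C. \<forall>Y \<in> seq_obj C. bij_betw (d X Y) (El P X Y) (El (phi C P) X Y)) \<and>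
     (\<forall>(Q :: ('o, 'm, 'q) prof) c. coalgebra C Q c \<longrightarrow>
        (\<exists>h. coalgebra_hom C Q c P d h) \<and>
        (\<forall>h h'. coalgebra_hom C Q c P d h \<longrightarrow> coalgebra_hom C Q c P d h' \<longrightarrow>
           (\<forall>X \<in> seq_obj C. \<forall>Y \<in> seq_obj C. \<forall>q \<in> El Q X Y. h X Y q = h' X Y q)))"


section \<open>Symmetric monoidal categories given by families of hom-sets\<close>

text \<open>The hom-sets need not be disjoint, so composition and tensor of morphisms take the objects
  involved as arguments: \<open>SCmp S X Y Z f g\<close> composes \<open>f : X \<longrightarrow> Y\<close> with \<open>g : Y \<longrightarrow> Z\<close>, and
  \<open>Ten S X Y X' Y' f g\<close> is the tensor of \<open>f : X \<longrightarrow> Y\<close> with \<open>g : X' \<longrightarrow> Y'\<close>.\<close>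

record ('o, 'h) smc =
  SObj :: "'o set"
  SHom :: "'o \<Rightarrow> 'o \<Rightarrow> 'h set"
  SId :: "'o \<Rightarrow> 'h"
  SCmp :: "'o \<Rightarrow> 'o \<Rightarrow> 'o \<Rightarrow> 'h \<Rightarrow> 'h \<Rightarrow> 'h"
  Ten0 :: "'o \<Rightarrow> 'o \<Rightarrow> 'o" (infixr "\<^bold>\<otimes>\<index>" 70)
  Ten :: "'o \<Rightarrow> 'o \<Rightarrow> 'o \<Rightarrow> 'o \<Rightarrow> 'h \<Rightarrow> 'h \<Rightarrow> 'h"
  Unit :: "'o" ("\<^bold>1\<index>")
  Assoc :: "'o \<Rightarrow> 'o \<Rightarrow> 'o \<Rightarrow> 'h"
  LUnit :: "'o \<Rightarrow> 'h"
  RUnit :: "'o \<Rightarrow> 'h"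
  Sym :: "'o \<Rightarrow> 'o \<Rightarrow> 'h"

definition smc_isos :: "('o, 'h) smc \<Rightarrow> 'o \<Rightarrow> 'o \<Rightarrow> 'h set" where
  "smc_isos S X Y = {f \<in> SHom S X Y. \<exists>g \<in> SHom S Y X.
     SCmp S X Y X f g = SId S X \<and> SCmp S Y X Y g f = SId S Y}"

locale hom_category =
  fixes S :: "('o, 'h) smc"
  assumes id_hom: "X \<in> SObj S \<Longrightarrow> SId S X \<in> SHom S X X"
    and cmp_hom:
      "\<lbrakk>X \<in> SObj S; Y \<in> SObj S; Z \<in> SObj S; f \<in> SHom S X Y; g \<in> SHom S Y Z\<rbrakk> \<Longrightarrow>
         SCmp S X Y Z f g \<in> SHom S X Z"
    and id_cmp:
      "\<lbrakk>X \<in> SObj S; Y \<in> SObj S; f \<in> SHom S X Y\<rbrakk> \<Longrightarrow> SCmp S X X Y (SId S X) f = f"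
    and cmp_id:
      "\<lbrakk>X \<in> SObj S; Y \<in> SObj S; f \<in> SHom S X Y\<rbrakk> \<Longrightarrow> SCmp S X Y Y f (SId S Y) = f"
    and cmp_assoc:
      "\<lbrakk>W \<in> SObj S; X \<in> SObj S; Y \<in> SObj S; Z \<in> SObj S;
        f \<in> SHom S W X; g \<in> SHom S X Y; h \<in> SHom S Y Z\<rbrakk> \<Longrightarrow>
         SCmp S W Y Z (SCmp S W X Y f g) h = SCmp S W X Z f (SCmp S X Y Z g h)"

locale symmetric_monoidal_category = hom_category S
  for S :: "('o, 'h) smc" (structure) +
  assumes unit_obj: "\<^bold>1 \<in> SObj S"
    and ten0_obj: "\<lbrakk>X \<in> SObj S; Y \<in> SObj S\<rbrakk> \<Longrightarrow> X \<^bold>\<otimes> Y \<in> SObj S"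
    and ten_hom:
      "\<lbrakk>X \<in> SObj S; Y \<in> SObj S; X' \<in> SObj S; Y' \<in> SObj S; f \<in> SHom S X Y; f' \<in> SHom S X' Y'\<rbrakk> \<Longrightarrow>
         Ten S X Y X' Y' f f' \<in> SHom S (X \<^bold>\<otimes> X') (Y \<^bold>\<otimes> Y')"
    and ten_id:
      "\<lbrakk>X \<in> SObj S; X' \<in> SObj S\<rbrakk> \<Longrightarrow> Ten S X X X' X' (SId S X) (SId S X') = SId S (X \<^bold>\<otimes> X')"
    and ten_cmp:
      "\<lbrakk>X \<in> SObj S; Y \<in> SObj S; Z \<in> SObj S; X' \<in> SObj S; Y' \<in> SObj S; Z' \<in> SObj S;
        f \<in> SHom S X Y; g \<in> SHom S Y Z; f' \<in> SHom S X' Y'; g' \<in> SHom S Y' Z'\<rbrakk> \<Longrightarrow>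
         Ten S X Z X' Z' (SCmp S X Y Z f g) (SCmp S X' Y' Z' f' g') =
         SCmp S (X \<^bold>\<otimes> X') (Y \<^bold>\<otimes> Y') (Z \<^bold>\<otimes> Z') (Ten S X Y X' Y' f f') (Ten S Y Z Y' Z' g g')"
    and assoc_iso:
      "\<lbrakk>X \<in> SObj S; Y \<in> SObj S; Z \<in> SObj S\<rbrakk> \<Longrightarrow>
         Assoc S X Y Z \<in> smc_isos S ((X \<^bold>\<otimes> Y) \<^bold>\<otimes> Z) (X \<^bold>\<otimes> Y \<^bold>\<otimes> Z)"
    and lunit_iso: "X \<in> SObj S \<Longrightarrow> LUnit S X \<in> smc_isos S (\<^bold>1 \<^bold>\<otimes> X) X"
    and runit_iso: "X \<in> SObj S \<Longrightarrow> RUnit S X \<in> smc_isos S (X \<^bold>\<otimes> \<^bold>1) X"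
    and sym_hom: "\<lbrakk>X \<in> SObj S; Y \<in> SObj S\<rbrakk> \<Longrightarrow> Sym S X Y \<in> SHom S (X \<^bold>\<otimes> Y) (Y \<^bold>\<otimes> X)"
    and assoc_natural:
      "\<lbrakk>X \<in> SObj S; Y \<in> SObj S; Z \<in> SObj S; X' \<in> SObj S; Y' \<in> SObj S; Z' \<in> SObj S;
        f \<in> SHom S X X'; g \<in> SHom S Y Y'; h \<in> SHom S Z Z'\<rbrakk> \<Longrightarrow>
         SCmp S ((X \<^bold>\<otimes> Y) \<^bold>\<otimes> Z) ((X' \<^bold>\<otimes> Y') \<^bold>\<otimes> Z') (X' \<^bold>\<otimes> Y' \<^bold>\<otimes> Z')
           (Ten S (X \<^bold>\<otimes> Y) (X' \<^bold>\<otimes> Y') Z Z' (Ten S X X' Y Y' f g) h) (Assoc S X' Y' Z') =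
         SCmp S ((X \<^bold>\<otimes> Y) \<^bold>\<otimes> Z) (X \<^bold>\<otimes> Y \<^bold>\<otimes> Z) (X' \<^bold>\<otimes> Y' \<^bold>\<otimes> Z')
           (Assoc S X Y Z) (Ten S X X' (Y \<^bold>\<otimes> Z) (Y' \<^bold>\<otimes> Z') f (Ten S Y Y' Z Z' g h))"
    and lunit_natural:
      "\<lbrakk>X \<in> SObj S; Y \<in> SObj S; f \<in> SHom S X Y\<rbrakk> \<Longrightarrow>
         SCmp S (\<^bold>1 \<^bold>\<otimes> X) (\<^bold>1 \<^bold>\<otimes> Y) Y (Ten S \<^bold>1 \<^bold>1 X Y (SId S \<^bold>1) f) (LUnit S Y) =
         SCmp S (\<^bold>1 \<^bold>\<otimes> X) X Y (LUnit S X) f"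
    and runit_natural:
      "\<lbrakk>X \<in> SObj S; Y \<in> SObj S; f \<in> SHom S X Y\<rbrakk> \<Longrightarrow>
         SCmp S (X \<^bold>\<otimes> \<^bold>1) (Y \<^bold>\<otimes> \<^bold>1) Y (Ten S X Y \<^bold>1 \<^bold>1 f (SId S \<^bold>1)) (RUnit S Y) =
         SCmp S (X \<^bold>\<otimes> \<^bold>1) X Y (RUnit S X) f"
    and sym_natural:
      "\<lbrakk>X \<in> SObj S; Y \<in> SObj S; X' \<in> SObj S; Y' \<in> SObj S; f \<in> SHom S X X'; g \<in> SHom S Y Y'\<rbrakk> \<Longrightarrow>
         SCmp S (X \<^bold>\<otimes> Y) (X' \<^bold>\<otimes> Y') (Y' \<^bold>\<otimes> X') (Ten S X X' Y Y' f g) (Sym S X' Y') =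
         SCmp S (X \<^bold>\<otimes> Y) (Y \<^bold>\<otimes> X) (Y' \<^bold>\<otimes> X') (Sym S X Y) (Ten S Y Y' X X' g f)"
    and pentagon:
      "\<lbrakk>W \<in> SObj S; X \<in> SObj S; Y \<in> SObj S; Z \<in> SObj S\<rbrakk> \<Longrightarrow>
         SCmp S (((W \<^bold>\<otimes> X) \<^bold>\<otimes> Y) \<^bold>\<otimes> Z) ((W \<^bold>\<otimes> X) \<^bold>\<otimes> Y \<^bold>\<otimes> Z) (W \<^bold>\<otimes> X \<^bold>\<otimes> Y \<^bold>\<otimes> Z)
           (Assoc S (W \<^bold>\<otimes> X) Y Z) (Assoc S W X (Y \<^bold>\<otimes> Z)) =
         SCmp S (((W \<^bold>\<otimes> X) \<^bold>\<otimes> Y) \<^bold>\<otimes> Z) ((W \<^bold>\<otimes> X \<^bold>\<otimes> Y) \<^bold>\<otimes> Z) (W \<^bold>\<otimes> X \<^bold>\<otimes> Y \<^bold>\<otimes> Z)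
           (Ten S ((W \<^bold>\<otimes> X) \<^bold>\<otimes> Y) (W \<^bold>\<otimes> X \<^bold>\<otimes> Y) Z Z (Assoc S W X Y) (SId S Z))
           (SCmp S ((W \<^bold>\<otimes> X \<^bold>\<otimes> Y) \<^bold>\<otimes> Z) (W \<^bold>\<otimes> (X \<^bold>\<otimes> Y) \<^bold>\<otimes> Z) (W \<^bold>\<otimes> X \<^bold>\<otimes> Y \<^bold>\<otimes> Z)
              (Assoc S W (X \<^bold>\<otimes> Y) Z)
              (Ten S W W ((X \<^bold>\<otimes> Y) \<^bold>\<otimes> Z) (X \<^bold>\<otimes> Y \<^bold>\<otimes> Z) (SId S W) (Assoc S X Y Z)))"
    and triangle:
      "\<lbrakk>X \<in> SObj S; Y \<in> SObj S\<rbrakk> \<Longrightarrow>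
         SCmp S ((X \<^bold>\<otimes> \<^bold>1) \<^bold>\<otimes> Y) (X \<^bold>\<otimes> \<^bold>1 \<^bold>\<otimes> Y) (X \<^bold>\<otimes> Y)
           (Assoc S X \<^bold>1 Y) (Ten S X X (\<^bold>1 \<^bold>\<otimes> Y) Y (SId S X) (LUnit S Y)) =
         Ten S (X \<^bold>\<otimes> \<^bold>1) X Y Y (RUnit S X) (SId S Y)"
    and hexagon:
      "\<lbrakk>X \<in> SObj S; Y \<in> SObj S; Z \<in> SObj S\<rbrakk> \<Longrightarrow>
         SCmp S ((X \<^bold>\<otimes> Y) \<^bold>\<otimes> Z) (X \<^bold>\<otimes> Y \<^bold>\<otimes> Z) (Y \<^bold>\<otimes> Z \<^bold>\<otimes> X)
           (Assoc S X Y Z)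
           (SCmp S (X \<^bold>\<otimes> Y \<^bold>\<otimes> Z) ((Y \<^bold>\<otimes> Z) \<^bold>\<otimes> X) (Y \<^bold>\<otimes> Z \<^bold>\<otimes> X) (Sym S X (Y \<^bold>\<otimes> Z)) (Assoc S Y Z X)) =
         SCmp S ((X \<^bold>\<otimes> Y) \<^bold>\<otimes> Z) ((Y \<^bold>\<otimes> X) \<^bold>\<otimes> Z) (Y \<^bold>\<otimes> Z \<^bold>\<otimes> X)
           (Ten S (X \<^bold>\<otimes> Y) (Y \<^bold>\<otimes> X) Z Z (Sym S X Y) (SId S Z))
           (SCmp S ((Y \<^bold>\<otimes> X) \<^bold>\<otimes> Z) (Y \<^bold>\<otimes> X \<^bold>\<otimes> Z) (Y \<^bold>\<otimes> Z \<^bold>\<otimes> X)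
              (Assoc S Y X Z) (Ten S Y Y (X \<^bold>\<otimes> Z) (Z \<^bold>\<otimes> X) (SId S Y) (Sym S X Z)))"
    and sym_sym:
      "\<lbrakk>X \<in> SObj S; Y \<in> SObj S\<rbrakk> \<Longrightarrow>
         SCmp S (X \<^bold>\<otimes> Y) (Y \<^bold>\<otimes> X) (X \<^bold>\<otimes> Y) (Sym S X Y) (Sym S Y X) = SId S (X \<^bold>\<otimes> Y)"

text \<open>Isomorphisms of symmetric monoidal categories that are the identity on objects and strictly
  preserve all of the structure.\<close>

locale smc_identity_on_objects_iso =
  fixes S :: "('o, 'h) smc" and T :: "('o, 'k) smc" and F :: "'o \<Rightarrow> 'o \<Rightarrow> 'h \<Rightarrow> 'k"
  assumes obj_eq: "SObj S = SObj T"
    and ten0_eq: "\<lbrakk>X \<in> SObj S; Y \<in> SObj S\<rbrakk> \<Longrightarrow> Ten0 S X Y = Ten0 T X Y"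
    and unit_eq: "Unit S = Unit T"
    and bij: "\<lbrakk>X \<in> SObj S; Y \<in> SObj S\<rbrakk> \<Longrightarrow> bij_betw (F X Y) (SHom S X Y) (SHom T X Y)"
    and map_id: "X \<in> SObj S \<Longrightarrow> F X X (SId S X) = SId T X"
    and map_cmp:
      "\<lbrakk>X \<in> SObj S; Y \<in> SObj S; Z \<in> SObj S; f \<in> SHom S X Y; g \<in> SHom S Y Z\<rbrakk> \<Longrightarrow>
         F X Z (SCmp S X Y Z f g) = SCmp T X Y Z (F X Y f) (F Y Z g)"
    and map_ten:
      "\<lbrakk>X \<in> SObj S; Y \<in> SObj S; X' \<in> SObj S; Y' \<in> SObj S; f \<in> SHom S X Y; f' \<in> SHom S X' Y'\<rbrakk> \<Longrightarrow>
         F (Ten0 S X X') (Ten0 S Y Y') (Ten S X Y X' Y' f f') =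
         Ten T X Y X' Y' (F X Y f) (F X' Y' f')"
    and map_assoc:
      "\<lbrakk>X \<in> SObj S; Y \<in> SObj S; Z \<in> SObj S\<rbrakk> \<Longrightarrow>
         F (Ten0 S (Ten0 S X Y) Z) (Ten0 S X (Ten0 S Y Z)) (Assoc S X Y Z) = Assoc T X Y Z"
    and map_lunit: "X \<in> SObj S \<Longrightarrow> F (Ten0 S (Unit S) X) X (LUnit S X) = LUnit T X"
    and map_runit: "X \<in> SObj S \<Longrightarrow> F (Ten0 S X (Unit S)) X (RUnit S X) = RUnit T X"
    and map_sym:
      "\<lbrakk>X \<in> SObj S; Y \<in> SObj S\<rbrakk> \<Longrightarrow> F (Ten0 S X Y) (Ten0 S Y X) (Sym S X Y) = Sym T X Y"


section \<open>Monoidal streams\<close>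

text \<open>A raw stream is a stream before quotienting; its intended source and target sequences are
  imposed by \<open>wt\<close>.\<close>

codatatype ('o, 'm) raw = Raw (mem: 'o) (now: 'm) (later: "('o, 'm) raw")

lemma equivclp_mono [mono]:
  assumes "\<And>x y. r x y \<longrightarrow> s x y"
  shows "equivclp r x y \<longrightarrow> equivclp s x y"
proof -
  have "symclp r \<le> symclp s"
    using assms by (auto simp: symclp_def)
  then have "(symclp r)\<^sup>*\<^sup>* \<le> (symclp s)\<^sup>*\<^sup>*"
    by (rule rtranclp_mono)
  then show ?thesis
    by (auto simp: equivclp_def)
qed

context
  fixes C :: "('o, 'm) cart_cat" (structure)
begin

coinductive wt :: "(nat \<Rightarrow> 'o) \<Rightarrow> (nat \<Rightarrow> 'o) \<Rightarrow> ('o, 'm) raw \<Rightarrow> bool" where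
  "\<lbrakk>mem s \<in> Obj C; now s \<in> Hom C (X 0) (mem s \<otimes> Y 0);
    wt (mem s \<bullet> shift X) (shift Y) (later s)\<rbrakk> \<Longrightarrow> wt X Y s"

definition precomp :: "'m \<Rightarrow> ('o, 'm) raw \<Rightarrow> ('o, 'm) raw" where
  "precomp u s = Raw (mem s) (u \<Zsemi> now s) (later s)"

text \<open>The greatest relation that, at each level, is contained in the equivalence relation generated
  by sliding a morphism \<open>r\<close> between the memories, the rests being compared by the relation itself.\<close>

coinductive streq ::
  "(nat \<Rightarrow> 'o) \<Rightarrow> (nat \<Rightarrow> 'o) \<Rightarrow> ('o, 'm) raw \<Rightarrow> ('o, 'm) raw \<Rightarrow> bool" where
  "\<lbrakk>wt X Y s; wt X Y t;
    equivclp (\<lambda>f g. wt X Y f \<and> wt X Y g \<and>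
      (\<exists>r \<in> Hom C (mem g) (mem f).
         now f = now g \<Zsemi> r \<boxtimes> Id C (Y 0) \<and>
         streq (mem g \<bullet> shift X) (shift Y) (precomp (r \<boxtimes> Id C (X 1)) (later f)) (later g))) s t\<rbrakk>
   \<Longrightarrow> streq X Y s t"

definition streq_rel :: "(nat \<Rightarrow> 'o) \<Rightarrow> (nat \<Rightarrow> 'o) \<Rightarrow> ('o, 'm) raw rel" where
  "streq_rel X Y = {(s, t). streq X Y s t}"

definition stream_class :: "(nat \<Rightarrow> 'o) \<Rightarrow> (nat \<Rightarrow> 'o) \<Rightarrow> ('o, 'm) raw \<Rightarrow> ('o, 'm) raw set" where
  "stream_class X Y s = streq_rel X Y `` {s}"

definition streams :: "(nat \<Rightarrow> 'o) \<Rightarrow> (nat \<Rightarrow> 'o) \<Rightarrow> ('o, 'm) raw set set" where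
  "streams X Y = {s. wt X Y s} // streq_rel X Y"

primcorec raw_act :: "(nat \<Rightarrow> 'm) \<Rightarrow> (nat \<Rightarrow> 'm) \<Rightarrow> ('o, 'm) raw \<Rightarrow> ('o, 'm) raw" where
  "mem (raw_act u v s) = mem s"
| "now (raw_act u v s) = u 0 \<Zsemi> now s \<Zsemi> Id C (mem s) \<boxtimes> v 0"
| "later (raw_act u v s) = raw_act (Id C (mem s) \<odot> shift u) (shift v) (later s)"

definition stream_prof :: "('o, 'm, ('o, 'm) raw set) prof" where
  "stream_prof =
     \<lparr>El = streams,
      Act = (\<lambda>u v. class_map (streq_rel (\<lambda>n. Dom C (u n)) (\<lambda>n. Cod C (v n))) (raw_act u v))\<rparr>"

definition stream_coalg ::
  "(nat \<Rightarrow> 'o) \<Rightarrow> (nat \<Rightarrow> 'o) \<Rightarrow> ('o, 'm) raw set \<Rightarrow> ('o \<times> 'm \<times> ('o, 'm) raw set) set" where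
  "stream_coalg X Y = class_map (coend_rel C stream_prof X Y)
     (\<lambda>s. (mem s, now s, stream_class (mem s \<bullet> shift X) (shift Y) (later s)))"

text \<open>The stream of a morphism \<open>u\<close> of sequences, with memory \<open>\<one>\<close> throughout; \<open>raw_lift_mem\<close> is its
  rest, with source \<open>\<one> \<cdot> X\<close> when \<open>u\<close> has source \<open>X\<close>.\<close>

primcorec raw_lift_mem :: "(nat \<Rightarrow> 'm) \<Rightarrow> ('o, 'm) raw" where
  "mem (raw_lift_mem u) = \<one>"
| "now (raw_lift_mem u) = Id C \<one> \<boxtimes> u 0"
| "later (raw_lift_mem u) = raw_lift_mem (shift u)"

definition raw_lift :: "(nat \<Rightarrow> 'm) \<Rightarrow> ('o, 'm) raw" where
  "raw_lift u = Raw \<one> (u 0 \<Zsemi> lun' C (Cod C (u 0))) (raw_lift_mem (shift u))"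

text \<open>Composition with memories carried along: for \<open>s\<close> from \<open>A \<cdot> X\<close> to \<open>Y\<close> and \<open>t\<close> from
  \<open>B \<cdot> Y\<close> to \<open>Z\<close>, the composite goes from \<open>(A \<otimes> B) \<cdot> X\<close> to \<open>Z\<close>.\<close>

primcorec raw_cmp_mem ::
  "'o \<Rightarrow> 'o \<Rightarrow> (nat \<Rightarrow> 'o) \<Rightarrow> (nat \<Rightarrow> 'o) \<Rightarrow> (nat \<Rightarrow> 'o) \<Rightarrow>
   ('o, 'm) raw \<Rightarrow> ('o, 'm) raw \<Rightarrow> ('o, 'm) raw" where
  "mem (raw_cmp_mem A B X Y Z s t) = mem s \<otimes> mem t"
| "now (raw_cmp_mem A B X Y Z s t) =
     swp_right C A B (X 0) \<Zsemi>
     now s \<boxtimes> Id C B \<Zsemi>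
     asc C (mem s) (Y 0) B \<Zsemi>
     Id C (mem s) \<boxtimes> swp C (Y 0) B \<Zsemi>
     Id C (mem s) \<boxtimes> now t \<Zsemi>
     asc' C (mem s) (mem t) (Z 0)"
| "later (raw_cmp_mem A B X Y Z s t) =
     raw_cmp_mem (mem s) (mem t) (shift X) (shift Y) (shift Z) (later s) (later t)"

definition raw_cmp ::
  "(nat \<Rightarrow> 'o) \<Rightarrow> (nat \<Rightarrow> 'o) \<Rightarrow> (nat \<Rightarrow> 'o) \<Rightarrow> ('o, 'm) raw \<Rightarrow> ('o, 'm) raw \<Rightarrow> ('o, 'm) raw" where
  "raw_cmp X Y Z s t =
     Raw (mem s \<otimes> mem t)
       (now s \<Zsemi> Id C (mem s) \<boxtimes> now t \<Zsemi> asc' C (mem s) (mem t) (Z 0))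
       (raw_cmp_mem (mem s) (mem t) (shift X) (shift Y) (shift Z) (later s) (later t))"

text \<open>Likewise for the tensor: for \<open>s\<close> from \<open>A \<cdot> X\<close> to \<open>Y\<close> and \<open>t\<close> from \<open>B \<cdot> X'\<close> to \<open>Y'\<close>, the
  result has source \<open>(A \<otimes> B) \<cdot> (X \<otimes> X')\<close>.\<close>

primcorec raw_ten_mem ::
  "'o \<Rightarrow> 'o \<Rightarrow> (nat \<Rightarrow> 'o) \<Rightarrow> (nat \<Rightarrow> 'o) \<Rightarrow> (nat \<Rightarrow> 'o) \<Rightarrow> (nat \<Rightarrow> 'o) \<Rightarrow>
   ('o, 'm) raw \<Rightarrow> ('o, 'm) raw \<Rightarrow> ('o, 'm) raw" where
  "mem (raw_ten_mem A B X Y X' Y' s t) = mem s \<otimes> mem t"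
| "now (raw_ten_mem A B X Y X' Y' s t) =
     swp_mid C A B (X 0) (X' 0) \<Zsemi>
     now s \<boxtimes> now t \<Zsemi>
     swp_mid C (mem s) (Y 0) (mem t) (Y' 0)"
| "later (raw_ten_mem A B X Y X' Y' s t) =
     raw_ten_mem (mem s) (mem t) (shift X) (shift Y) (shift X') (shift Y') (later s) (later t)"

definition raw_ten ::
  "(nat \<Rightarrow> 'o) \<Rightarrow> (nat \<Rightarrow> 'o) \<Rightarrow> (nat \<Rightarrow> 'o) \<Rightarrow> (nat \<Rightarrow> 'o) \<Rightarrow>
   ('o, 'm) raw \<Rightarrow> ('o, 'm) raw \<Rightarrow> ('o, 'm) raw" where
  "raw_ten X Y X' Y' s t =
     Raw (mem s \<otimes> mem t)
       (now s \<boxtimes> now t \<Zsemi> swp_mid C (mem s) (Y 0) (mem t) (Y' 0))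
       (raw_ten_mem (mem s) (mem t) (shift X) (shift Y) (shift X') (shift Y') (later s) (later t))"

definition seq_ten0 :: "(nat \<Rightarrow> 'o) \<Rightarrow> (nat \<Rightarrow> 'o) \<Rightarrow> nat \<Rightarrow> 'o" where
  "seq_ten0 X Y = (\<lambda>n. X n \<otimes> Y n)"

definition STREAM :: "(nat \<Rightarrow> 'o, ('o, 'm) raw set) smc" where
  "STREAM =
     \<lparr>SObj = seq_obj C,
      SHom = streams,
      SId = (\<lambda>X. stream_class X X (raw_lift (seq_id C X))),
      SCmp = (\<lambda>X Y Z c d. \<Union>s \<in> c. class_map (streq_rel X Z) (raw_cmp X Y Z s) d),
      Ten0 = seq_ten0,
      Ten = (\<lambda>X Y X' Y' c d.
        \<Union>s \<in> c. class_map (streq_rel (seq_ten0 X X') (seq_ten0 Y Y')) (raw_ten X Y X' Y' s) d),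
      Unit = (\<lambda>n. \<one>),
      Assoc = (\<lambda>X Y Z. stream_class (seq_ten0 (seq_ten0 X Y) Z) (seq_ten0 X (seq_ten0 Y Z))
        (raw_lift (\<lambda>n. asc C (X n) (Y n) (Z n)))),
      LUnit = (\<lambda>X. stream_class (seq_ten0 (\<lambda>n. \<one>) X) X (raw_lift (\<lambda>n. lun C (X n)))),
      RUnit = (\<lambda>X. stream_class (seq_ten0 X (\<lambda>n. \<one>)) X (raw_lift (\<lambda>n. run C (X n)))),
      Sym = (\<lambda>X Y. stream_class (seq_ten0 X Y) (seq_ten0 Y X)
        (raw_lift (\<lambda>n. swp C (X n) (Y n))))\<rparr>"

end


section \<open>Comonads and their cokleisli monoidal categories\<close>

text \<open>\<open>cm_split X Y\<close> is the comparison morphism \<open>G (X \<otimes> Y) \<longrightarrow> G X \<otimes> G Y\<close>, through which the tensor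
  of cokleisli morphisms is defined.\<close>

record ('o, 'h) comonad_data =
  cm_obj :: "'o \<Rightarrow> 'o"
  cm_map :: "'o \<Rightarrow> 'o \<Rightarrow> 'h \<Rightarrow> 'h"
  cm_counit :: "'o \<Rightarrow> 'h"
  cm_comult :: "'o \<Rightarrow> 'h"
  cm_split :: "'o \<Rightarrow> 'o \<Rightarrow> 'h"

locale comonad = hom_category S
  for S :: "('o, 'h) smc" and G :: "('o, 'h) comonad_data" +
  assumes obj: "X \<in> SObj S \<Longrightarrow> cm_obj G X \<in> SObj S"
    and map_hom:
      "\<lbrakk>X \<in> SObj S; Y \<in> SObj S; f \<in> SHom S X Y\<rbrakk> \<Longrightarrow> cm_map G X Y f \<in> SHom S (cm_obj G X) (cm_obj G Y)"
    and map_id: "X \<in> SObj S \<Longrightarrow> cm_map G X X (SId S X) = SId S (cm_obj G X)"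
    and map_cmp:
      "\<lbrakk>X \<in> SObj S; Y \<in> SObj S; Z \<in> SObj S; f \<in> SHom S X Y; g \<in> SHom S Y Z\<rbrakk> \<Longrightarrow>
         cm_map G X Z (SCmp S X Y Z f g) =
         SCmp S (cm_obj G X) (cm_obj G Y) (cm_obj G Z) (cm_map G X Y f) (cm_map G Y Z g)"
    and counit_hom: "X \<in> SObj S \<Longrightarrow> cm_counit G X \<in> SHom S (cm_obj G X) X"
    and counit_natural:
      "\<lbrakk>X \<in> SObj S; Y \<in> SObj S; f \<in> SHom S X Y\<rbrakk> \<Longrightarrow>
         SCmp S (cm_obj G X) (cm_obj G Y) Y (cm_map G X Y f) (cm_counit G Y) =
         SCmp S (cm_obj G X) X Y (cm_counit G X) f"
    and comult_hom: "X \<in> SObj S \<Longrightarrow> cm_comult G X \<in> SHom S (cm_obj G X) (cm_obj G (cm_obj G X))"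
    and comult_natural:
      "\<lbrakk>X \<in> SObj S; Y \<in> SObj S; f \<in> SHom S X Y\<rbrakk> \<Longrightarrow>
         SCmp S (cm_obj G X) (cm_obj G Y) (cm_obj G (cm_obj G Y)) (cm_map G X Y f) (cm_comult G Y) =
         SCmp S (cm_obj G X) (cm_obj G (cm_obj G X)) (cm_obj G (cm_obj G Y)) (cm_comult G X) (cm_map G (cm_obj G X) (cm_obj G Y) (cm_map G X Y f))"
    and comult_counit:
      "X \<in> SObj S \<Longrightarrow>
         SCmp S (cm_obj G X) (cm_obj G (cm_obj G X)) (cm_obj G X) (cm_comult G X) (cm_counit G (cm_obj G X)) = SId S (cm_obj G X)"
    and comult_map_counit:
      "X \<in> SObj S \<Longrightarrow>
         SCmp S (cm_obj G X) (cm_obj G (cm_obj G X)) (cm_obj G X) (cm_comult G X) (cm_map G (cm_obj G X) X (cm_counit G X)) = SId S (cm_obj G X)"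
    and comult_comult:
      "X \<in> SObj S \<Longrightarrow>
         SCmp S (cm_obj G X) (cm_obj G (cm_obj G X)) (cm_obj G (cm_obj G (cm_obj G X))) (cm_comult G X) (cm_comult G (cm_obj G X)) =
         SCmp S (cm_obj G X) (cm_obj G (cm_obj G X)) (cm_obj G (cm_obj G (cm_obj G X))) (cm_comult G X) (cm_map G (cm_obj G X) (cm_obj G (cm_obj G X)) (cm_comult G X))"

definition cokleisli :: "('o, 'h) smc \<Rightarrow> ('o, 'h) comonad_data \<Rightarrow> ('o, 'h) smc" where
  "cokleisli S G =
     (let T = cm_obj G; I = Unit S; ten = Ten0 S;
          lift = (\<lambda>X Y. SCmp S (T X) X Y (cm_counit G X))
      in
     \<lparr>SObj = SObj S,
      SHom = (\<lambda>X Y. SHom S (T X) Y),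
      SId = cm_counit G,
      SCmp = (\<lambda>X Y Z f g.
        SCmp S (T X) (T (T X)) Z (cm_comult G X) (SCmp S (T (T X)) (T Y) Z (cm_map G (T X) Y f) g)),
      Ten0 = ten,
      Ten = (\<lambda>X Y X' Y' f f'.
        SCmp S (T (ten X X')) (ten (T X) (T X')) (ten Y Y')
          (cm_split G X X') (Ten S (T X) Y (T X') Y' f f')),
      Unit = I,
      Assoc = (\<lambda>X Y Z. lift (ten (ten X Y) Z) (ten X (ten Y Z)) (Assoc S X Y Z)),
      LUnit = (\<lambda>X. lift (ten I X) X (LUnit S X)),
      RUnit = (\<lambda>X. lift (ten X I) X (RUnit S X)),
      Sym = (\<lambda>X Y. lift (ten X Y) (ten Y X) (Sym S X Y))\<rparr>)"


section \<open>Causal functions and the non-empty list comonad\<close>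

context
  fixes C :: "('o, 'm) cart_cat" (structure)
begin

definition SEQ :: "(nat \<Rightarrow> 'o, nat \<Rightarrow> 'm) smc" where
  "SEQ =
     \<lparr>SObj = seq_obj C,
      SHom = seq_hom C,
      SId = seq_id C,
      SCmp = (\<lambda>X Y Z. seq_cmp C),
      Ten0 = seq_ten0 C,
      Ten = (\<lambda>X Y X' Y' f g n. f n \<boxtimes> g n),
      Unit = (\<lambda>n. \<one>),
      Assoc = (\<lambda>X Y Z n. asc C (X n) (Y n) (Z n)),
      LUnit = (\<lambda>X n. lun C (X n)),
      RUnit = (\<lambda>X n. run C (X n)),
      Sym = (\<lambda>X Y n. swp C (X n) (Y n))\<rparr>"

text \<open>\<open>X\<^sub>0 \<times> \<dots> \<times> X\<^sub>n\<close>, associated to the left.\<close>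

primrec lst :: "(nat \<Rightarrow> 'o) \<Rightarrow> nat \<Rightarrow> 'o" where
  "lst X 0 = X 0"
| "lst X (Suc n) = lst X n \<otimes> X (Suc n)"

primrec lst_map :: "(nat \<Rightarrow> 'm) \<Rightarrow> nat \<Rightarrow> 'm" where
  "lst_map u 0 = u 0"
| "lst_map u (Suc n) = lst_map u n \<boxtimes> u (Suc n)"

primrec lst_counit :: "(nat \<Rightarrow> 'o) \<Rightarrow> nat \<Rightarrow> 'm" where
  "lst_counit X 0 = Id C (X 0)"
| "lst_counit X (Suc n) = Pr2 C (lst X n) (X (Suc n))"

primrec lst_comult :: "(nat \<Rightarrow> 'o) \<Rightarrow> nat \<Rightarrow> 'm" where
  "lst_comult X 0 = Id C (X 0)"
| "lst_comult X (Suc n) =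
     tuple C (Pr1 C (lst X n) (X (Suc n)) \<Zsemi> lst_comult X n) (Id C (lst X (Suc n)))"

definition List_plus :: "(nat \<Rightarrow> 'o, nat \<Rightarrow> 'm) comonad_data" where
  "List_plus =
     \<lparr>cm_obj = lst,
      cm_map = (\<lambda>X Y. lst_map),
      cm_counit = lst_counit,
      cm_comult = lst_comult,
      cm_split = (\<lambda>X Y n. tuple C (lst_map (\<lambda>k. Pr1 C (X k) (Y k)) n)
                                  (lst_map (\<lambda>k. Pr2 C (X k) (Y k)) n))\<rparr>"

definition causal :: "(nat \<Rightarrow> 'o) \<Rightarrow> (nat \<Rightarrow> 'o) \<Rightarrow> (nat \<Rightarrow> 'm) set" where
  "causal X Y = {f. \<forall>n. f n \<in> Hom C (lst X n) (Y n)}"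

definition causal_prof :: "('o, 'm, nat \<Rightarrow> 'm) prof" where
  "causal_prof = \<lparr>El = causal, Act = (\<lambda>u v f n. lst_map u n \<Zsemi> f n \<Zsemi> v n)\<rparr>"

text \<open>The input is stored in memory. The rest has the correct type because
  \<open>lst (X 0 \<bullet> shift X) n = lst X (Suc n)\<close>.\<close>

definition causal_coalg ::
  "(nat \<Rightarrow> 'o) \<Rightarrow> (nat \<Rightarrow> 'o) \<Rightarrow> (nat \<Rightarrow> 'm) \<Rightarrow> ('o \<times> 'm \<times> (nat \<Rightarrow> 'm)) set" where
  "causal_coalg X Y f =
     coend_rel C causal_prof X Y `` {(X 0, tuple C (Id C (X 0)) (f 0), shift f)}"

end

end

(* A stream acts on its inputs by running through its memories: after n + 1 steps it yields an output
   in Y n that depends on X 0, ..., X n only. This causal function is unchanged by sliding, and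
   conversely every stream can be slid to a normal form whose memory is the input itself, so that
   two streams are equivalent if and only if they have the same causal function. For the coend of
   causal functions the same sliding picks one representative in each class, which makes causal
   functions a fixpoint; a coalgebra is mapped to it by running it, and by induction on n there is
   no other way. The finality of streams follows by transport along the bijection.
   For the monoidal structure, the cokleisli category of List_plus has finite products, so it is
   symmetric monoidal, and the operations on raw streams compute the composition and the tensor of
   causal functions. *)
theory Submission
  imports Defs
begin

section \<open>Calculus in a cartesian category\<close>

text \<open>Normal forms exist because a first action splits in a cartesian category:
  \<open>f\<close> is the pairing of the identity with \<open>f \<Zsemi> Pr2\<close>, followed by
  \<open>r \<boxtimes> Id\<close> for \<open>r = f \<Zsemi> Pr1\<close>. So \<open>r\<close> can
  slide into the rest, and only a copy of the input stays behind as memory. As \<open>lst\<close>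
  associates to the left, taking the input as memory merely shifts the index, and no associators
  enter. The obstacle to finality is that a coalgebra returns classes, so running it means choosing
  representatives. Independence of the choice at index \<open>n + 1\<close> needs naturality of the
  behaviour at index \<open>n\<close>, while naturality itself needs independence of the choice.
  Both are proved together, one output index at a time. For streams, equivalence turns out to be
  equality of causal functions; well-definedness of each operation on classes thereby reduces to a
  formula for the causal function of its result. For composition and tensor such a formula has to
  allow arbitrary initial memories, because the rest of a composite is not a composite of streams
  without memory but starts from a joint one.\<close>

context cartesian_category
begin

lemma HomD:
  assumes "f \<in> Hom C A B"
  shows "f \<in> Arr C" "Dom C f = A" "Cod C f = B" "A \<in> Obj C" "B \<in> Obj C"
  using assms dom_obj cod_obj by (auto simp: Hom_def)

lemma Hom_iff: "f \<in> Hom C A B \<longleftrightarrow> f \<in> Arr C \<and> Dom C f = A \<and> Cod C f = B"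
  by (simp add: Hom_def)

declare dom_obj [simp] cod_obj [simp] one_obj [simp] prd_obj [simp]

lemma Id_simps [simp]:
  assumes "A \<in> Obj C"
  shows "Id C A \<in> Arr C" "Dom C (Id C A) = A" "Cod C (Id C A) = A"
  using HomD[OF id_hom[OF assms]] by auto

lemma Pr1_simps [simp]:
  assumes "A \<in> Obj C" "B \<in> Obj C"
  shows "Pr1 C A B \<in> Arr C" "Dom C (Pr1 C A B) = A \<otimes> B" "Cod C (Pr1 C A B) = A"
  using HomD[OF pr1_hom[OF assms]] by auto

lemma Pr2_simps [simp]:
  assumes "A \<in> Obj C" "B \<in> Obj C"
  shows "Pr2 C A B \<in> Arr C" "Dom C (Pr2 C A B) = A \<otimes> B" "Cod C (Pr2 C A B) = B"
  using HomD[OF pr2_hom[OF assms]] by auto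

lemma Cmp_simps [simp]:
  assumes "f \<in> Arr C" "g \<in> Arr C" "Cod C f = Dom C g"
  shows "f \<Zsemi> g \<in> Arr C" "Dom C (f \<Zsemi> g) = Dom C f" "Cod C (f \<Zsemi> g) = Cod C g"
  using HomD[OF cmp_hom[of f "Dom C f" "Dom C g" g "Cod C g"]] assms by (auto simp: Hom_def)

lemma Id_Cmp [simp]: "\<lbrakk>f \<in> Arr C; Dom C f = A\<rbrakk> \<Longrightarrow> Id C A \<Zsemi> f = f"
  by (rule id_cmp) (auto simp: Hom_def)

lemma Cmp_Id [simp]: "\<lbrakk>f \<in> Arr C; Cod C f = A\<rbrakk> \<Longrightarrow> f \<Zsemi> Id C A = f"
  by (rule cmp_id) (auto simp: Hom_def)

text \<open>Composites are normalised to left-nested form. Since \<open>Cmp_tuple\<close>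
  distributes composition into tuples, a composite of structural maps is then evaluated from its
  left end, where a tuple meets the next projection. Unfolding \<open>cross_def\<close> brings a
  product map in the middle of a composite under this regime.\<close>

lemma Cmp_assoc [simp]:
  "\<lbrakk>f \<in> Arr C; g \<in> Arr C; h \<in> Arr C; Cod C f = Dom C g; Cod C g = Dom C h\<rbrakk> \<Longrightarrow>
     f \<Zsemi> (g \<Zsemi> h) = f \<Zsemi> g \<Zsemi> h"
  by (rule cmp_assoc [symmetric]) (auto simp: Hom_def)

text \<open>In left-nested form \<open>f \<Zsemi> g\<close> is not a subterm of
  \<open>h \<Zsemi> f \<Zsemi> g\<close>, so an equation for it cannot rewrite there; this is its
  usable form.\<close>

lemma Cmp_eq_left:
  assumes "f \<Zsemi> g = k" "f \<in> Arr C" "g \<in> Arr C" "Cod C f = Dom C g"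
    and "h \<in> Arr C" "Cod C h = Dom C f"
  shows "h \<Zsemi> f \<Zsemi> g = h \<Zsemi> k"
  using assms Cmp_assoc[of h f g] by simp

lemma bang_simps [simp]:
  assumes "A \<in> Obj C"
  shows "bang C A \<in> Arr C" "Dom C (bang C A) = A" "Cod C (bang C A) = \<one>"
  using HomD[OF theI'[OF one_terminal[OF assms]]] by (auto simp: bang_def)

lemma terminal_unique:
  assumes "f \<in> Arr C" "g \<in> Arr C" "Dom C f = Dom C g" "Cod C f = \<one>" "Cod C g = \<one>"
  shows "f = g"
  using one_terminal[of "Dom C g"] assms by (auto simp: Hom_def)

lemma Cmp_bang [simp]: "\<lbrakk>f \<in> Arr C; Cod C f = A\<rbrakk> \<Longrightarrow> f \<Zsemi> bang C A = bang C (Dom C f)"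
  by (rule terminal_unique) auto

lemma tuple_properties:
  assumes "f \<in> Arr C" "g \<in> Arr C" "Dom C f = Dom C g"
  shows "tuple C f g \<in> Hom C (Dom C f) (Cod C f \<otimes> Cod C g) \<and>
    tuple C f g \<Zsemi> Pr1 C (Cod C f) (Cod C g) = f \<and> tuple C f g \<Zsemi> Pr2 C (Cod C f) (Cod C g) = g"
  unfolding tuple_def
  by (rule theI', rule prd_universal) (use assms in \<open>auto simp: Hom_def\<close>)

lemma tuple_simps [simp]:
  assumes "f \<in> Arr C" "g \<in> Arr C" "Dom C f = Dom C g"
  shows "tuple C f g \<in> Arr C" "Dom C (tuple C f g) = Dom C g"
    "Cod C (tuple C f g) = Cod C f \<otimes> Cod C g"
  using tuple_properties[OF assms] assms by (auto simp: Hom_def)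

lemma tuple_Pr1 [simp]:
  assumes "f \<in> Arr C" "g \<in> Arr C" "Dom C f = Dom C g" "Cod C f = A" "Cod C g = B"
  shows "tuple C f g \<Zsemi> Pr1 C A B = f"
  using tuple_properties[OF assms(1-3)] assms by auto

lemma tuple_Pr2 [simp]:
  assumes "f \<in> Arr C" "g \<in> Arr C" "Dom C f = Dom C g" "Cod C f = A" "Cod C g = B"
  shows "tuple C f g \<Zsemi> Pr2 C A B = g"
  using tuple_properties[OF assms(1-3)] assms by auto

text \<open>The projections are jointly monic: the uniqueness half of the universal property, in the
  form used for all later rules on tuples.\<close>

lemma Prd_ext:
  assumes "h \<in> Arr C" "k \<in> Arr C" "Dom C h = Dom C k" "Cod C h = A \<otimes> B" "Cod C k = A \<otimes> B"
    and "A \<in> Obj C" "B \<in> Obj C"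
    and "h \<Zsemi> Pr1 C A B = k \<Zsemi> Pr1 C A B" "h \<Zsemi> Pr2 C A B = k \<Zsemi> Pr2 C A B"
  shows "h = k"
  using prd_universal[of "k \<Zsemi> Pr1 C A B" "Dom C k" A "k \<Zsemi> Pr2 C A B" B] assms
  by (auto simp: Hom_def)

lemma tuple_eta [simp]:
  "\<lbrakk>h \<in> Arr C; Cod C h = A \<otimes> B; A \<in> Obj C; B \<in> Obj C\<rbrakk> \<Longrightarrow>
     tuple C (h \<Zsemi> Pr1 C A B) (h \<Zsemi> Pr2 C A B) = h"
  by (rule Prd_ext[of _ _ A B]) auto

lemma tuple_Pr1_Pr2 [simp]:
  "\<lbrakk>A \<in> Obj C; B \<in> Obj C\<rbrakk> \<Longrightarrow> tuple C (Pr1 C A B) (Pr2 C A B) = Id C (A \<otimes> B)"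
  by (rule Prd_ext[of _ _ A B]) auto

lemma Cmp_tuple [simp]:
  assumes "h \<in> Arr C" "f \<in> Arr C" "g \<in> Arr C" "Cod C h = Dom C f" "Dom C f = Dom C g"
  shows "h \<Zsemi> tuple C f g = tuple C (h \<Zsemi> f) (h \<Zsemi> g)"
proof (rule Prd_ext[of _ _ "Cod C f" "Cod C g"])
  show "h \<Zsemi> tuple C f g \<Zsemi> Pr1 C (Cod C f) (Cod C g)
    = tuple C (h \<Zsemi> f) (h \<Zsemi> g) \<Zsemi> Pr1 C (Cod C f) (Cod C g)"
    using assms by (simp del: Cmp_assoc add: Cmp_assoc [symmetric])
  show "h \<Zsemi> tuple C f g \<Zsemi> Pr2 C (Cod C f) (Cod C g)
    = tuple C (h \<Zsemi> f) (h \<Zsemi> g) \<Zsemi> Pr2 C (Cod C f) (Cod C g)"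
    using assms by (simp del: Cmp_assoc add: Cmp_assoc [symmetric])
qed (use assms in auto)

lemma cross_simps [simp]:
  assumes "f \<in> Arr C" "g \<in> Arr C"
  shows "f \<boxtimes> g \<in> Arr C" "Dom C (f \<boxtimes> g) = Dom C f \<otimes> Dom C g"
    "Cod C (f \<boxtimes> g) = Cod C f \<otimes> Cod C g"
  using assms by (auto simp: cross_def)

lemma cross_Pr1 [simp]:
  "\<lbrakk>f \<in> Arr C; g \<in> Arr C; Cod C f = A; Cod C g = B\<rbrakk> \<Longrightarrow>
     (f \<boxtimes> g) \<Zsemi> Pr1 C A B = Pr1 C (Dom C f) (Dom C g) \<Zsemi> f"
  by (simp add: cross_def)

lemma cross_Pr2 [simp]:
  "\<lbrakk>f \<in> Arr C; g \<in> Arr C; Cod C f = A; Cod C g = B\<rbrakk> \<Longrightarrow>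
     (f \<boxtimes> g) \<Zsemi> Pr2 C A B = Pr2 C (Dom C f) (Dom C g) \<Zsemi> g"
  by (simp add: cross_def)

lemma tuple_cross [simp]:
  "\<lbrakk>f \<in> Arr C; g \<in> Arr C; f' \<in> Arr C; g' \<in> Arr C; Dom C f = Dom C g;
    Cod C f = Dom C f'; Cod C g = Dom C g'\<rbrakk> \<Longrightarrow>
     tuple C f g \<Zsemi> f' \<boxtimes> g' = tuple C (f \<Zsemi> f') (g \<Zsemi> g')"
  by (simp add: cross_def)

lemma cross_cross [simp]:
  "\<lbrakk>f \<in> Arr C; g \<in> Arr C; f' \<in> Arr C; g' \<in> Arr C; Cod C f = Dom C f'; Cod C g = Dom C g'\<rbrakk> \<Longrightarrow>
     f \<boxtimes> g \<Zsemi> f' \<boxtimes> g' = (f \<Zsemi> f') \<boxtimes> (g \<Zsemi> g')"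
  by (simp add: cross_def)

lemma cross_Id [simp]: "\<lbrakk>A \<in> Obj C; B \<in> Obj C\<rbrakk> \<Longrightarrow> Id C A \<boxtimes> Id C B = Id C (A \<otimes> B)"
  by (simp add: cross_def)

lemma Pr1_one: "A \<in> Obj C \<Longrightarrow> Pr1 C \<one> A = bang C (\<one> \<otimes> A)"
  by (rule terminal_unique) auto

lemma Pr2_one: "A \<in> Obj C \<Longrightarrow> Pr2 C A \<one> = bang C (A \<otimes> \<one>)"
  by (rule terminal_unique) auto

section \<open>Associators, unitors and symmetries\<close>

lemmas coherence_defs = asc_def asc'_def lun_def lun'_def run_def swp_def swp_right_def swp_mid_def

lemma asc_simps [simp]:
  assumes [simp]: "A \<in> Obj C" "B \<in> Obj C" "D \<in> Obj C"
  shows "asc C A B D \<in> Arr C" "Dom C (asc C A B D) = (A \<otimes> B) \<otimes> D" "Cod C (asc C A B D) = A \<otimes> B \<otimes> D"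
    "asc' C A B D \<in> Arr C" "Dom C (asc' C A B D) = A \<otimes> B \<otimes> D" "Cod C (asc' C A B D) = (A \<otimes> B) \<otimes> D"
  by (simp_all add: coherence_defs)

lemma unitor_simps [simp]:
  assumes [simp]: "A \<in> Obj C"
  shows "lun C A \<in> Arr C" "Dom C (lun C A) = \<one> \<otimes> A" "Cod C (lun C A) = A"
    "lun' C A \<in> Arr C" "Dom C (lun' C A) = A" "Cod C (lun' C A) = \<one> \<otimes> A"
    "run C A \<in> Arr C" "Dom C (run C A) = A \<otimes> \<one>" "Cod C (run C A) = A"
  by (simp_all add: coherence_defs)

lemma swp_simps [simp]:
  assumes [simp]: "A \<in> Obj C" "B \<in> Obj C"
  shows "swp C A B \<in> Arr C" "Dom C (swp C A B) = A \<otimes> B" "Cod C (swp C A B) = B \<otimes> A"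
  by (simp_all add: coherence_defs)

lemma tuple_asc:
  "\<lbrakk>f \<in> Arr C; g \<in> Arr C; Dom C f = Dom C g; Cod C f = A \<otimes> B; Cod C g = D; A \<in> Obj C; B \<in> Obj C\<rbrakk> \<Longrightarrow>
     tuple C f g \<Zsemi> asc C A B D = tuple C (f \<Zsemi> Pr1 C A B) (tuple C (f \<Zsemi> Pr2 C A B) g)"
  by (auto simp: asc_def)

lemma tuple_asc':
  "\<lbrakk>f \<in> Arr C; g \<in> Arr C; Dom C f = Dom C g; Cod C f = A; Cod C g = B \<otimes> D; B \<in> Obj C; D \<in> Obj C\<rbrakk> \<Longrightarrow>
     tuple C f g \<Zsemi> asc' C A B D = tuple C (tuple C f (g \<Zsemi> Pr1 C B D)) (g \<Zsemi> Pr2 C B D)"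
  by (auto simp: asc'_def)

lemma tuple_swp:
  "\<lbrakk>f \<in> Arr C; g \<in> Arr C; Dom C f = Dom C g; Cod C f = A; Cod C g = B\<rbrakk> \<Longrightarrow>
     tuple C f g \<Zsemi> swp C A B = tuple C g f"
  by (auto simp: swp_def)

lemma swp_right_eq:
  "\<lbrakk>A \<in> Obj C; B \<in> Obj C; D \<in> Obj C\<rbrakk> \<Longrightarrow>
     swp_right C A B D = tuple C (Pr1 C A B \<boxtimes> Id C D) (Pr1 C (A \<otimes> B) D \<Zsemi> Pr2 C A B)"
  by (simp add: coherence_defs cross_def)

end

section \<open>The symmetric monoidal structure given by finite products\<close>

definition cartesian_smc :: "('o, 'm) cart_cat \<Rightarrow> ('o, 'm) smc" where
  "cartesian_smc C =
     \<lparr>SObj = Obj C, SHom = Hom C, SId = Id C, SCmp = (\<lambda>X Y Z. Cmp C), Ten0 = Prd C,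
      Ten = (\<lambda>X Y X' Y'. cross C), Unit = One C, Assoc = asc C, LUnit = lun C, RUnit = run C,
      Sym = swp C\<rparr>"

lemma cartesian_smc_simps [simp]:
  "SObj (cartesian_smc C) = Obj C" "SHom (cartesian_smc C) = Hom C" "SId (cartesian_smc C) = Id C"
  "SCmp (cartesian_smc C) X Y Z = Cmp C" "Ten0 (cartesian_smc C) = Prd C"
  "Ten (cartesian_smc C) X Y X' Y' = cross C" "Unit (cartesian_smc C) = One C"
  "Assoc (cartesian_smc C) = asc C" "LUnit (cartesian_smc C) = lun C"
  "RUnit (cartesian_smc C) = run C" "Sym (cartesian_smc C) = swp C"
  by (simp_all add: cartesian_smc_def)

context cartesian_category
begin

lemma asc_iso:
  assumes [simp]: "A \<in> Obj C" "B \<in> Obj C" "D \<in> Obj C"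
  shows "asc C A B D \<Zsemi> asc' C A B D = Id C ((A \<otimes> B) \<otimes> D)"
    "asc' C A B D \<Zsemi> asc C A B D = Id C (A \<otimes> B \<otimes> D)"
  by (simp_all add: coherence_defs cross_def)

lemma lun_iso:
  assumes [simp]: "A \<in> Obj C"
  shows "lun C A \<Zsemi> lun' C A = Id C (\<one> \<otimes> A)" "lun' C A \<Zsemi> lun C A = Id C A"
  using tuple_Pr1_Pr2[of \<one> A] by (simp_all add: coherence_defs Pr1_one del: tuple_Pr1_Pr2)

lemma run_iso:
  assumes [simp]: "A \<in> Obj C"
  shows "run C A \<Zsemi> tuple C (Id C A) (bang C A) = Id C (A \<otimes> \<one>)"
    "tuple C (Id C A) (bang C A) \<Zsemi> run C A = Id C A"
  using tuple_Pr1_Pr2[of A \<one>] by (simp_all add: coherence_defs Pr2_one del: tuple_Pr1_Pr2)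

text \<open>Once the coherence maps are unfolded into tuples of projections, both sides of each
  equation normalise to the same term. Only the isomorphisms ask for witnesses, namely their
  inverses.\<close>

lemma symmetric_monoidal_cartesian_smc: "symmetric_monoidal_category (cartesian_smc C)"
proof (unfold_locales; unfold cartesian_smc_simps)
  fix A B D assume obj: "A \<in> Obj C" "B \<in> Obj C" "D \<in> Obj C"
  then have "asc' C A B D \<in> Hom C (A \<otimes> B \<otimes> D) ((A \<otimes> B) \<otimes> D)"
    by (simp add: Hom_iff)
  then show "asc C A B D \<in> smc_isos (cartesian_smc C) ((A \<otimes> B) \<otimes> D) (A \<otimes> B \<otimes> D)"
    unfolding smc_isos_def cartesian_smc_simps
    using obj asc_iso by (auto simp: Hom_iff intro!: bexI[of _ "asc' C A B D"])
next
  fix A assume obj: "A \<in> Obj C"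
  then have "lun' C A \<in> Hom C A (\<one> \<otimes> A)"
    by (simp add: Hom_iff)
  then show "lun C A \<in> smc_isos (cartesian_smc C) (\<one> \<otimes> A) A"
    unfolding smc_isos_def cartesian_smc_simps
    using obj lun_iso by (auto simp: Hom_iff intro!: bexI[of _ "lun' C A"])
next
  fix A assume obj: "A \<in> Obj C"
  then have "tuple C (Id C A) (bang C A) \<in> Hom C A (A \<otimes> \<one>)"
    by (simp add: Hom_iff)
  then show "run C A \<in> smc_isos (cartesian_smc C) (A \<otimes> \<one>) A"
    unfolding smc_isos_def cartesian_smc_simps
    using obj run_iso by (auto simp: Hom_iff intro!: bexI[of _ "tuple C (Id C A) (bang C A)"])
qed (simp_all add: Hom_iff, simp_all add: coherence_defs cross_def)

end

section \<open>Transport of symmetric monoidal structure\<close>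

text \<open>\<open>F\<close> preserves the structure and is injective on hom-sets, so the laws of
  \<open>T\<close> pull back to \<open>S\<close>. Closure of the operations of \<open>S\<close> is a
  separate hypothesis: that \<open>F\<close> sends \<open>SId S X\<close> to an identity of
  \<open>T\<close> does not place \<open>SId S X\<close> in its hom-set. The lemma serves twice, for
  the cokleisli category over the products of causal functions and for streams over the cokleisli
  category.\<close>

lemma symmetric_monoidal_category_transfer:
  assumes "symmetric_monoidal_category T" and "smc_identity_on_objects_iso S T F"
    and id_hom: "\<And>X. X \<in> SObj S \<Longrightarrow> SId S X \<in> SHom S X X"
    and cmp_hom: "\<And>X Y Z f g. \<lbrakk>X \<in> SObj S; Y \<in> SObj S; Z \<in> SObj S; f \<in> SHom S X Y; g \<in> SHom S Y Z\<rbrakk> \<Longrightarrow>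
      SCmp S X Y Z f g \<in> SHom S X Z"
    and ten_hom: "\<And>X Y X' Y' f f'. \<lbrakk>X \<in> SObj S; Y \<in> SObj S; X' \<in> SObj S; Y' \<in> SObj S;
      f \<in> SHom S X Y; f' \<in> SHom S X' Y'\<rbrakk> \<Longrightarrow> Ten S X Y X' Y' f f' \<in> SHom S (Ten0 S X X') (Ten0 S Y Y')"
    and assoc_hom: "\<And>X Y Z. \<lbrakk>X \<in> SObj S; Y \<in> SObj S; Z \<in> SObj S\<rbrakk> \<Longrightarrow>
      Assoc S X Y Z \<in> SHom S (Ten0 S (Ten0 S X Y) Z) (Ten0 S X (Ten0 S Y Z))"
    and lunit_hom: "\<And>X. X \<in> SObj S \<Longrightarrow> LUnit S X \<in> SHom S (Ten0 S (Unit S) X) X"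
    and runit_hom: "\<And>X. X \<in> SObj S \<Longrightarrow> RUnit S X \<in> SHom S (Ten0 S X (Unit S)) X"
    and sym_hom: "\<And>X Y. \<lbrakk>X \<in> SObj S; Y \<in> SObj S\<rbrakk> \<Longrightarrow> Sym S X Y \<in> SHom S (Ten0 S X Y) (Ten0 S Y X)"
  shows "symmetric_monoidal_category S"
proof -
  interpret T: symmetric_monoidal_category T by fact
  interpret F: smc_identity_on_objects_iso S T F by fact
  have ten0: "Ten0 S X Y = Ten0 T X Y" if "X \<in> SObj T" "Y \<in> SObj T" for X Y
    using F.ten0_eq that by (simp add: F.obj_eq)
  have obj [simp]: "Unit S \<in> SObj S"
    "\<And>X Y. \<lbrakk>X \<in> SObj S; Y \<in> SObj S\<rbrakk> \<Longrightarrow> Ten0 S X Y \<in> SObj S"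
    using T.unit_obj T.ten0_obj by (simp_all add: F.obj_eq F.unit_eq ten0)
  note [simp] = id_hom cmp_hom ten_hom assoc_hom lunit_hom runit_hom sym_hom
    F.map_id F.map_cmp F.map_ten F.map_assoc F.map_lunit F.map_runit F.map_sym
  have F_hom: "F X Y f \<in> SHom T X Y"
    if "X \<in> SObj T" "Y \<in> SObj T" "f \<in> SHom S X Y" for X Y f
    using F.bij that by (auto simp: bij_betw_def F.obj_eq)
  have inj: "f = g"
    if "F X Y f = F X Y g" "X \<in> SObj S" "Y \<in> SObj S" "f \<in> SHom S X Y" "g \<in> SHom S X Y" for X Y f g
    using F.bij that by (auto simp: bij_betw_def inj_on_def)
  \<comment> \<open>The inverse is pulled back by surjectivity of \<open>F\<close>, its two
    equations by injectivity.\<close>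
  have iso: "f \<in> smc_isos S X Y"
    if XY: "X \<in> SObj S" "Y \<in> SObj S" and f: "f \<in> SHom S X Y" and "F X Y f \<in> smc_isos T X Y" for X Y f
  proof -
    from that obtain g' where g': "g' \<in> SHom T Y X"
      "SCmp T X Y X (F X Y f) g' = SId T X" "SCmp T Y X Y g' (F X Y f) = SId T Y"
      by (auto simp: smc_isos_def)
    obtain g where g: "g \<in> SHom S Y X" "g' = F Y X g"
      using F.bij[of Y X] XY g'(1) by (auto simp: bij_betw_def)
    have "SCmp S X Y X f g = SId S X"
      by (rule inj[of X X]) (use XY f g g' in simp_all)
    moreover have "SCmp S Y X Y g f = SId S Y"
      by (rule inj[of Y Y]) (use XY f g g' in simp_all)
    ultimately show ?thesis
      using f g by (auto simp: smc_isos_def)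
  qed
  note T_laws = F.obj_eq F.unit_eq ten0 F_hom T.unit_obj T.ten0_obj T.id_cmp T.cmp_id T.cmp_assoc T.ten_id T.ten_cmp T.assoc_natural T.lunit_natural
    T.runit_natural T.sym_natural T.pentagon T.triangle T.hexagon T.sym_sym
    T.assoc_iso T.lunit_iso T.runit_iso
  show ?thesis
    apply (unfold_locales; simp?)
    apply ((rule inj[OF _ _ _ cmp_hom] inj[OF _ _ _ ten_hom] iso; simp; simp add: T_laws; fail)+)
    done
qed

section \<open>Sequences and the non-empty list construction\<close>

lemma shift_apply [simp]: "shift X n = X (Suc n)"
  by (simp add: shift_def)

lemma dot_apply [simp]:
  "(M \<bullet>\<^bsub>C\<^esub> X) 0 = M \<otimes>\<^bsub>C\<^esub> X 0" "(M \<bullet>\<^bsub>C\<^esub> X) (Suc n) = X (Suc n)"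
  by (simp_all add: dot_def)

lemma dot_hom_apply [simp]:
  "(r \<odot>\<^bsub>C\<^esub> u) 0 = r \<boxtimes>\<^bsub>C\<^esub> u 0" "(r \<odot>\<^bsub>C\<^esub> u) (Suc n) = u (Suc n)"
  by (simp_all add: dot_hom_def)

lemma shift_dot [simp]: "shift (M \<bullet>\<^bsub>C\<^esub> X) = shift X"
  by (simp add: shift_def)

lemma shift_dot_hom [simp]: "shift (r \<odot>\<^bsub>C\<^esub> u) = shift u"
  by (simp add: shift_def)

lemma seq_cmp_apply [simp]: "seq_cmp C u v n = u n \<Zsemi>\<^bsub>C\<^esub> v n"
  by (simp add: seq_cmp_def)

lemma seq_id_apply [simp]: "seq_id C X n = Id C (X n)"
  by (simp add: seq_id_def)

lemma seq_ten0_apply [simp]: "seq_ten0 C X Y n = X n \<otimes>\<^bsub>C\<^esub> Y n"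
  by (simp add: seq_ten0_def)

lemma shift_seq_id [simp]: "shift (seq_id C X) = seq_id C (shift X)"
  by (simp add: fun_eq_iff)

lemma shift_seq_ten0 [simp]: "shift (seq_ten0 C X Y) = seq_ten0 C (shift X) (shift Y)"
  by (simp add: fun_eq_iff)

text \<open>The equation is strict because \<open>lst\<close> associates to the left: the first two
  inputs of \<open>X\<close> together form the first input of \<open>X 0 \<bullet> shift X\<close>.
  The rest of a causal function is therefore just its \<open>shift\<close>.\<close>

lemma lst_dot_shift [simp]: "lst C (X 0 \<bullet>\<^bsub>C\<^esub> shift X) n = lst C X (Suc n)"
  by (induction n) simp_all

lemma lst_dot_dot: "lst C ((M \<otimes>\<^bsub>C\<^esub> X 0) \<bullet>\<^bsub>C\<^esub> shift X) n = lst C (M \<bullet>\<^bsub>C\<^esub> X) (Suc n)"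
  by (induction n) simp_all

lemma lst_map_dot_shift: "lst_map C (u 0 \<odot>\<^bsub>C\<^esub> shift u) n = lst_map C u (Suc n)"
  by (induction n) simp_all

text \<open>The extension of \<open>f\<close> to a morphism \<open>lst X \<longrightarrow> lst Y\<close> that records all of the outputs so far.\<close>

definition lst_extend :: "('o, 'm) cart_cat \<Rightarrow> (nat \<Rightarrow> 'o) \<Rightarrow> (nat \<Rightarrow> 'm) \<Rightarrow> nat \<Rightarrow> 'm" where
  "lst_extend C X f n = lst_comult C X n \<Zsemi>\<^bsub>C\<^esub> lst_map C f n"

text \<open>\<open>carry p W\<close> changes the memory along \<open>p\<close> and keeps the inputs \<open>W\<close>.\<close>

definition carry :: "('o, 'm) cart_cat \<Rightarrow> 'm \<Rightarrow> (nat \<Rightarrow> 'o) \<Rightarrow> nat \<Rightarrow> 'm" where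
  "carry C p W n = lst_map C (p \<odot>\<^bsub>C\<^esub> seq_id C W) n"

context cartesian_category
begin

section \<open>Typing of sequences, their morphisms and causal functions\<close>

lemma seq_objD: "X \<in> seq_obj C \<Longrightarrow> X n \<in> Obj C"
  by (simp add: seq_obj_def)

lemma seq_objI: "(\<And>n. X n \<in> Obj C) \<Longrightarrow> X \<in> seq_obj C"
  by (simp add: seq_obj_def)

lemma seq_obj_intros [simp]:
  "X \<in> seq_obj C \<Longrightarrow> shift X \<in> seq_obj C"
  "\<lbrakk>M \<in> Obj C; X \<in> seq_obj C\<rbrakk> \<Longrightarrow> M \<bullet> X \<in> seq_obj C"
  "\<lbrakk>X \<in> seq_obj C; Y \<in> seq_obj C\<rbrakk> \<Longrightarrow> seq_ten0 C X Y \<in> seq_obj C"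
  "(\<lambda>n. \<one>) \<in> seq_obj C"
  by (auto simp: seq_obj_def shift_def dot_def seq_ten0_def)

lemma seq_homD:
  assumes "u \<in> seq_hom C X Y"
  shows "u n \<in> Arr C" "Dom C (u n) = X n" "Cod C (u n) = Y n" "X \<in> seq_obj C" "Y \<in> seq_obj C"
proof -
  have h: "u n \<in> Hom C (X n) (Y n)" for n
    using assms by (simp add: seq_hom_def)
  show "u n \<in> Arr C" "Dom C (u n) = X n" "Cod C (u n) = Y n" "X \<in> seq_obj C" "Y \<in> seq_obj C"
    using HomD[OF h] by (simp_all add: seq_obj_def)
qed

lemma causalD:
  assumes "f \<in> causal C X Y"
  shows "f n \<in> Arr C" "Dom C (f n) = lst C X n" "Cod C (f n) = Y n" "Y \<in> seq_obj C"
  using seq_homD[of f "lst C X" Y] assms by (simp_all add: causal_def seq_hom_def)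

lemma shift_causal:
  assumes "f \<in> causal C X Y"
  shows "shift f \<in> causal C (X 0 \<bullet> shift X) (shift Y)"
proof -
  have "f (Suc n) \<in> Hom C (lst C X (Suc n)) (Y (Suc n))" for n
    using assms unfolding causal_def by blast
  then show ?thesis
    by (simp add: causal_def)
qed

declare seq_objD [simp]

lemma seq_homI: "(\<And>n. u n \<in> Hom C (X n) (Y n)) \<Longrightarrow> u \<in> seq_hom C X Y"
  by (simp add: seq_hom_def)

lemma seq_id_hom [simp]: "X \<in> seq_obj C \<Longrightarrow> seq_id C X \<in> seq_hom C X X"
  by (simp add: seq_hom_def id_hom)

lemma seq_cmp_hom: "\<lbrakk>u \<in> seq_hom C X Y; v \<in> seq_hom C Y Z\<rbrakk> \<Longrightarrow> seq_cmp C u v \<in> seq_hom C X Z"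
  by (auto simp: seq_hom_def intro: cmp_hom)

lemma shift_hom: "u \<in> seq_hom C X Y \<Longrightarrow> shift u \<in> seq_hom C (shift X) (shift Y)"
  by (simp add: seq_hom_def)

lemma dot_hom_hom:
  assumes "r \<in> Hom C M N" "u \<in> seq_hom C X Y"
  shows "r \<odot> u \<in> seq_hom C (M \<bullet> X) (N \<bullet> Y)"
  using seq_homD[OF assms(2)] HomD[OF assms(1)]
  by (auto simp: seq_hom_def dot_hom_def dot_def Hom_iff)

lemma dot_hom_seq_id [simp]: "\<lbrakk>M \<in> Obj C; X \<in> seq_obj C\<rbrakk> \<Longrightarrow> Id C M \<odot> seq_id C X = seq_id C (M \<bullet> X)"
  by (auto simp: fun_eq_iff dot_hom_def dot_def)

lemma dot_hom_cmp:
  assumes "r \<in> Hom C M N" "r' \<in> Hom C N P" "u \<in> seq_hom C X Y" "v \<in> seq_hom C Y Z"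
  shows "seq_cmp C (r \<odot> u) (r' \<odot> v) = (r \<Zsemi> r') \<odot> seq_cmp C u v"
  using seq_homD[OF assms(3)] seq_homD[OF assms(4)] HomD[OF assms(1)] HomD[OF assms(2)]
  by (auto simp: fun_eq_iff dot_hom_def)

section \<open>Prefixes of sequences\<close>

lemma lst_obj [simp]: "X \<in> seq_obj C \<Longrightarrow> lst C X n \<in> Obj C"
  by (induction n) simp_all

lemma lst_seq_obj [simp]: "X \<in> seq_obj C \<Longrightarrow> lst C X \<in> seq_obj C"
  by (rule seq_objI) simp

lemma lst_map_hom: "u \<in> seq_hom C X Y \<Longrightarrow> lst_map C u n \<in> Hom C (lst C X n) (lst C Y n)"
proof (induction n)
  case 0
  then show ?case by (simp add: seq_hom_def)
next
  case (Suc n)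
  with seq_homD[OF Suc.prems] show ?case
    by (simp add: Hom_iff)
qed

lemma lst_map_id [simp]: "X \<in> seq_obj C \<Longrightarrow> lst_map C (seq_id C X) n = Id C (lst C X n)"
  by (induction n) simp_all

lemma lst_map_cmp:
  assumes "u \<in> seq_hom C X Y" "v \<in> seq_hom C Y Z"
  shows "lst_map C (seq_cmp C u v) n = lst_map C u n \<Zsemi> lst_map C v n"
  using seq_homD[OF assms(1)] seq_homD[OF assms(2)]
    HomD[OF lst_map_hom[OF assms(1)]] HomD[OF lst_map_hom[OF assms(2)]]
  by (induction n) simp_all

lemma lst_counit_hom [simp]: "X \<in> seq_obj C \<Longrightarrow> lst_counit C X \<in> seq_hom C (lst C X) X"
  by (rule seq_homI, case_tac n) (simp_all add: Hom_iff)

lemma lst_comult_hom' [simp]: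
  "X \<in> seq_obj C \<Longrightarrow> lst_comult C X n \<in> Hom C (lst C X n) (lst C (lst C X) n)"
  by (induction n) (simp_all add: Hom_iff)

lemma lst_comult_hom: "X \<in> seq_obj C \<Longrightarrow> lst_comult C X \<in> seq_hom C (lst C X) (lst C (lst C X))"
  by (rule seq_homI) simp

lemma causal_eq: "causal C X Y = seq_hom C (lst C X) Y"
  by (simp add: causal_def seq_hom_def)

lemma seq_hom_lst: "u \<in> seq_hom C X Y \<Longrightarrow> lst_map C u \<in> seq_hom C (lst C X) (lst C Y)"
  by (simp add: seq_hom_def lst_map_hom[unfolded seq_hom_def])

section \<open>Cokleisli extension\<close>

lemma lst_extend_0 [simp]: "f \<in> causal C X Y \<Longrightarrow> X \<in> seq_obj C \<Longrightarrow> lst_extend C X f 0 = f 0"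
  using causalD[of f X Y] by (simp add: lst_extend_def)

lemma lst_extend_hom:
  assumes "f \<in> causal C X Y" "X \<in> seq_obj C"
  shows "lst_extend C X f n \<in> Hom C (lst C X n) (lst C Y n)"
  unfolding lst_extend_def
  using lst_comult_hom'[OF assms(2)] lst_map_hom[of f "lst C X" Y] assms(1)
  by (auto simp: causal_eq intro: cmp_hom)

text \<open>The last component of \<open>lst_comult\<close> is the whole prefix, so the extension
  keeps the earlier outputs and appends the new one. Inductions on extensions use this
  recursion.\<close>

lemma lst_extend_Suc:
  assumes "f \<in> causal C X Y" "X \<in> seq_obj C"
  shows "lst_extend C X f (Suc n) =
    tuple C (Pr1 C (lst C X n) (X (Suc n)) \<Zsemi> lst_extend C X f n) (f (Suc n))"
  using causalD[OF assms(1)] assms HomD[OF lst_comult_hom'[OF assms(2)]]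
    HomD[OF lst_map_hom[OF assms(1)[unfolded causal_eq]]]
  by (simp add: lst_extend_def)

lemma lst_extend_counit:
  assumes "X \<in> seq_obj C"
  shows "lst_extend C X (lst_counit C X) n = Id C (lst C X n)"
proof -
  have "lst_counit C X \<in> causal C X X"
    using assms by (simp add: causal_eq)
  then show ?thesis
    using assms by (induction n) (simp_all add: lst_extend_Suc)
qed

lemma lst_extend_then_counit:
  assumes "f \<in> causal C X Y" "X \<in> seq_obj C"
  shows "lst_extend C X f n \<Zsemi> lst_counit C Y n = f n"
proof (cases n)
  case 0
  then show ?thesis
    using causalD[OF assms(1)] assms by simp
next
  case (Suc m)
  then show ?thesis
    using causalD[OF assms(1)] assms HomD[OF lst_extend_hom[OF assms]]
    by (simp add: lst_extend_Suc[OF assms])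
qed

lemma lst_extend_cmp_hom:
  assumes "f \<in> causal C X Y" "g \<in> causal C Y Z" "X \<in> seq_obj C"
  shows "(\<lambda>n. lst_extend C X f n \<Zsemi> g n) \<in> causal C X Z"
  using lst_extend_hom[OF assms(1,3)] assms(2)
  by (auto simp: causal_def intro: cmp_hom)

text \<open>Extension turns cokleisli composition into ordinary composition; associativity for
  causal functions comes from here.\<close>

lemma lst_extend_cmp:
  assumes "f \<in> causal C X Y" "g \<in> causal C Y Z" "X \<in> seq_obj C"
  shows "lst_extend C X (\<lambda>n. lst_extend C X f n \<Zsemi> g n) n = lst_extend C X f n \<Zsemi> lst_extend C Y g n"
proof -
  note h = lst_extend_cmp_hom[OF assms]
  note fD = causalD[OF assms(1)]
  have Y: "Y \<in> seq_obj C" by (rule fD)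
  note gD = causalD[OF assms(2)] HomD[OF lst_extend_hom[OF assms(1,3)]]
    HomD[OF lst_extend_hom[OF assms(2) Y]]
  show ?thesis
  proof (induction n)
    case 0
    then show ?case using h fD gD assms Y by simp
  next
    case (Suc n)
    then show ?case
      using fD gD assms(3) Y
      by (simp add: lst_extend_Suc[OF h assms(3)] lst_extend_Suc[OF assms(2) Y] 
         lst_extend_Suc[OF assms(1,3)])
  qed
qed

lemma lst_extend_postcmp:
  assumes "f \<in> causal C X Y" "X \<in> seq_obj C" "v \<in> seq_hom C Y Z"
  shows "lst_extend C X f n \<Zsemi> lst_map C v n = lst_extend C X (\<lambda>n. f n \<Zsemi> v n) n"
proof -
  have h: "(\<lambda>n. f n \<Zsemi> v n) \<in> causal C X Z"
    using assms by (auto simp: causal_def seq_hom_def intro: cmp_hom)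
  have eq: "(\<lambda>n. f n \<Zsemi> v n) = seq_cmp C f v"
    by (simp add: fun_eq_iff)
  show ?thesis
    using HomD[OF lst_comult_hom'[OF assms(2)]] HomD[OF lst_map_hom[OF assms(3)]]
      HomD[OF lst_map_hom[OF assms(1)[unfolded causal_eq]]]
    by (simp add: lst_extend_def eq lst_map_cmp[OF assms(1)[unfolded causal_eq] assms(3)])
qed

lemma lst_map_counit:
  assumes "u \<in> seq_hom C X Y"
  shows "lst_map C u n \<Zsemi> lst_counit C Y n = lst_counit C X n \<Zsemi> u n"
  using seq_homD[OF assms] HomD[OF lst_map_hom[OF assms]]
  by (cases n) simp_all

text \<open>A causal function that reads only the last input extends to the plain action on
  prefixes, since the counit cancels against the comultiplication.\<close>

lemma lst_extend_lift:
  assumes "u \<in> seq_hom C X Y"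
  shows "lst_extend C X (\<lambda>n. lst_counit C X n \<Zsemi> u n) n = lst_map C u n"
proof -
  have X: "X \<in> seq_obj C" using seq_homD[OF assms] by simp
  have "lst_counit C X \<in> causal C X X"
    using X by (simp add: causal_eq)
  then have "lst_extend C X (\<lambda>n. lst_counit C X n \<Zsemi> u n) n
    = lst_extend C X (lst_counit C X) n \<Zsemi> lst_map C u n"
    using lst_extend_postcmp[of "lst_counit C X" X X u Y n] assms X by simp
  then show ?thesis
    using HomD[OF lst_map_hom[OF assms]] X by (simp add: lst_extend_counit)
qed

section \<open>Change of memory\<close>

lemma carry_hom:
  assumes "p \<in> Hom C M N" "W \<in> seq_obj C"
  shows "carry C p W n \<in> Hom C (lst C (M \<bullet> W) n) (lst C (N \<bullet> W) n)"
  unfolding carry_def by (intro lst_map_hom dot_hom_hom assms seq_id_hom)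

lemma carry_Id [simp]: "\<lbrakk>M \<in> Obj C; W \<in> seq_obj C\<rbrakk> \<Longrightarrow> carry C (Id C M) W n = Id C (lst C (M \<bullet> W) n)"
  by (simp add: carry_def)

lemma carry_cmp:
  assumes "p \<in> Hom C M N" "q \<in> Hom C N P" "W \<in> seq_obj C"
  shows "carry C (p \<Zsemi> q) W n = carry C p W n \<Zsemi> carry C q W n"
proof -
  have "seq_cmp C (p \<odot> seq_id C W) (q \<odot> seq_id C W) = (p \<Zsemi> q) \<odot> seq_id C W"
    using assms by (subst dot_hom_cmp[where X = W and Y = W and Z = W]) (auto simp: fun_eq_iff dot_hom_def)
  then show ?thesis
    unfolding carry_def
    using lst_map_cmp[OF dot_hom_hom[OF assms(1) seq_id_hom[OF assms(3)]] dot_hom_hom[OF assms(2) seq_id_hom[OF assms(3)]]]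
    by simp
qed

text \<open>Both sides are the image under \<open>lst_map\<close> of one morphism, which is
  \<open>(u 0 \<Zsemi> p) \<boxtimes> u 1\<close> at index \<open>0\<close> and a component of
  \<open>u\<close> beyond. Thus transforming all inputs and then storing the first is the same as
  storing the transformed first input and then transforming the others.\<close>

lemma lst_map_carry:
  assumes u: "u \<in> seq_hom C X' X" and p: "p \<in> Hom C (X 0) M"
  shows "lst_map C u (Suc n) \<Zsemi> carry C p (shift X) n =
    carry C (u 0 \<Zsemi> p) (shift X') n \<Zsemi> lst_map C (Id C M \<odot> shift u) n"
proof -
  note D = seq_homD[OF u] HomD[OF p]
  have u0: "u 0 \<in> Hom C (X' 0) (X 0)" using D by (simp add: Hom_iff)
  have X: "shift X \<in> seq_obj C" "shift X' \<in> seq_obj C" using D by simp_all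
  have "lst_map C (u 0 \<odot> shift u) n \<Zsemi> carry C p (shift X) n
    = lst_map C (seq_cmp C (u 0 \<odot> shift u) (p \<odot> seq_id C (shift X))) n"
    unfolding carry_def
    by (rule lst_map_cmp[symmetric, OF dot_hom_hom[OF u0 shift_hom[OF u]]
        dot_hom_hom[OF p seq_id_hom[OF X(1)]]])
  also have "seq_cmp C (u 0 \<odot> shift u) (p \<odot> seq_id C (shift X))
    = seq_cmp C ((u 0 \<Zsemi> p) \<odot> seq_id C (shift X')) (Id C M \<odot> shift u)"
    using D by (auto simp: fun_eq_iff dot_hom_def)
  also have "lst_map C \<dots> n = carry C (u 0 \<Zsemi> p) (shift X') n \<Zsemi> lst_map C (Id C M \<odot> shift u) n"
    unfolding carry_def
    by (rule lst_map_cmp[OF dot_hom_hom[OF cmp_hom[OF u0 p] seq_id_hom[OF X(2)]]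
        dot_hom_hom[OF id_hom shift_hom[OF u]]]) (use D in simp)
  finally show ?thesis
    unfolding lst_map_dot_shift .
qed

end

section \<open>The list comonad and its cokleisli category\<close>

text \<open>The arrows of the cokleisli category of \<open>List_plus\<close> are tagged with their source and target,
  so that it becomes an instance of \<open>cartesian_category\<close>.\<close>

definition causal_cat ::
  "('o, 'm) cart_cat \<Rightarrow> (nat \<Rightarrow> 'o, (nat \<Rightarrow> 'o) \<times> (nat \<Rightarrow> 'o) \<times> (nat \<Rightarrow> 'm)) cart_cat" where
  "causal_cat C =
     \<lparr>Obj = seq_obj C,
      Arr = {(X, Y, f). X \<in> seq_obj C \<and> Y \<in> seq_obj C \<and> f \<in> causal C X Y},
      Dom = fst,
      Cod = (\<lambda>(X, Y, f). Y),
      Id = (\<lambda>X. (X, X, lst_counit C X)),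
      Cmp = (\<lambda>(X, _, f) (_, Z, g). (X, Z, \<lambda>n. lst_extend C X f n \<Zsemi>\<^bsub>C\<^esub> g n)),
      One = (\<lambda>n. \<one>\<^bsub>C\<^esub>),
      Prd = seq_ten0 C,
      Pr1 = (\<lambda>X Y. (seq_ten0 C X Y, X, \<lambda>n. lst_counit C (seq_ten0 C X Y) n \<Zsemi>\<^bsub>C\<^esub> Pr1 C (X n) (Y n))),
      Pr2 = (\<lambda>X Y. (seq_ten0 C X Y, Y, \<lambda>n. lst_counit C (seq_ten0 C X Y) n \<Zsemi>\<^bsub>C\<^esub> Pr2 C (X n) (Y n)))\<rparr>"

lemma causal_cat_simps [simp]:
  "Obj (causal_cat C) = seq_obj C"
  "(X, Y, f) \<in> Arr (causal_cat C) \<longleftrightarrow> X \<in> seq_obj C \<and> Y \<in> seq_obj C \<and> f \<in> causal C X Y"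
  "Dom (causal_cat C) (X, Y, f) = X" "Cod (causal_cat C) (X, Y, f) = Y"
  "Id (causal_cat C) X = (X, X, lst_counit C X)"
  "Cmp (causal_cat C) (X, Y, f) (Y', Z, g) = (X, Z, \<lambda>n. lst_extend C X f n \<Zsemi>\<^bsub>C\<^esub> g n)"
  "One (causal_cat C) = (\<lambda>n. \<one>\<^bsub>C\<^esub>)"
  "Prd (causal_cat C) = seq_ten0 C"
  "Pr1 (causal_cat C) X Y =
     (seq_ten0 C X Y, X, \<lambda>n. lst_counit C (seq_ten0 C X Y) n \<Zsemi>\<^bsub>C\<^esub> Pr1 C (X n) (Y n))"
  "Pr2 (causal_cat C) X Y =
     (seq_ten0 C X Y, Y, \<lambda>n. lst_counit C (seq_ten0 C X Y) n \<Zsemi>\<^bsub>C\<^esub> Pr2 C (X n) (Y n))"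
  by (simp_all add: causal_cat_def)

lemma SEQ_simps [simp]:
  "SObj (SEQ C) = seq_obj C" "SHom (SEQ C) = seq_hom C" "SId (SEQ C) = seq_id C"
  "SCmp (SEQ C) X Y Z = seq_cmp C" "Ten0 (SEQ C) = seq_ten0 C"
  "Ten (SEQ C) X Y X' Y' f g = (\<lambda>n. f n \<boxtimes>\<^bsub>C\<^esub> g n)" "Unit (SEQ C) = (\<lambda>n. \<one>\<^bsub>C\<^esub>)"
  "Assoc (SEQ C) X Y Z = (\<lambda>n. asc C (X n) (Y n) (Z n))" "LUnit (SEQ C) X = (\<lambda>n. lun C (X n))"
  "RUnit (SEQ C) X = (\<lambda>n. run C (X n))" "Sym (SEQ C) X Y = (\<lambda>n. swp C (X n) (Y n))"
  by (simp_all add: SEQ_def)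

lemma List_plus_simps [simp]:
  "cm_obj (List_plus C) = lst C" "cm_map (List_plus C) X Y = lst_map C"
  "cm_counit (List_plus C) = lst_counit C" "cm_comult (List_plus C) = lst_comult C"
  "cm_split (List_plus C) X Y n =
     tuple C (lst_map C (\<lambda>k. Pr1 C (X k) (Y k)) n) (lst_map C (\<lambda>k. Pr2 C (X k) (Y k)) n)"
  by (simp_all add: List_plus_def)

lemma cokleisli_List_plus_simps [simp]:
  fixes C :: "('o, 'm) cart_cat"
  defines "K \<equiv> cokleisli (SEQ C) (List_plus C)"
  shows "SObj K = seq_obj C" "SHom K X Y = seq_hom C (lst C X) Y" "SId K = lst_counit C"
    "SCmp K X Y Z f g = seq_cmp C (lst_comult C X) (seq_cmp C (lst_map C f) g)"
    "Ten0 K = seq_ten0 C"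
    "Ten K X Y X' Y' f f' = seq_cmp C (cm_split (List_plus C) X X') (\<lambda>n. f n \<boxtimes>\<^bsub>C\<^esub> f' n)"
    "Unit K = (\<lambda>n. \<one>\<^bsub>C\<^esub>)"
    "Assoc K X Y Z = seq_cmp C (lst_counit C (seq_ten0 C (seq_ten0 C X Y) Z)) (\<lambda>n. asc C (X n) (Y n) (Z n))"
    "LUnit K X = seq_cmp C (lst_counit C (seq_ten0 C (\<lambda>n. \<one>\<^bsub>C\<^esub>) X)) (\<lambda>n. lun C (X n))"
    "RUnit K X = seq_cmp C (lst_counit C (seq_ten0 C X (\<lambda>n. \<one>\<^bsub>C\<^esub>))) (\<lambda>n. run C (X n))"
    "Sym K X Y = seq_cmp C (lst_counit C (seq_ten0 C X Y)) (\<lambda>n. swp C (X n) (Y n))"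
  by (simp_all add: K_def cokleisli_def Let_def)

context cartesian_category
begin

section \<open>The comonad laws\<close>

lemma lst_comult_natural:
  assumes "u \<in> seq_hom C X Y"
  shows "lst_map C u n \<Zsemi> lst_comult C Y n = lst_comult C X n \<Zsemi> lst_map C (lst_map C u) n"
proof -
  note D = seq_homD[OF assms] HomD[OF lst_map_hom[OF assms]]
    HomD[OF lst_map_hom[OF seq_hom_lst[OF assms]]]
  note [simp] = HomD[OF lst_comult_hom'[OF D(4)]] HomD[OF lst_comult_hom'[OF D(5)]]
  show ?thesis
  proof (induction n)
    case (Suc n)
    show ?case
      using D by (simp add: Cmp_eq_left[OF Suc])
  qed (use D in simp)
qed

lemma lst_comult_counit:
  assumes [simp]: "X \<in> seq_obj C"
  shows "lst_comult C X n \<Zsemi> lst_counit C (lst C X) n = Id C (lst C X n)"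
  using HomD[OF lst_comult_hom'[OF assms]] by (cases n) simp_all

lemma lst_comult_comult:
  assumes X: "X \<in> seq_obj C"
  shows "lst_comult C X n \<Zsemi> lst_comult C (lst C X) n = lst_comult C X n \<Zsemi> lst_map C (lst_comult C X) n"
proof -
  have X': "lst C X \<in> seq_obj C" "lst C (lst C X) \<in> seq_obj C"
    using X by simp_all
  note [simp] = HomD[OF lst_comult_hom'[OF X]] HomD[OF lst_comult_hom'[OF X'(1)]]
    HomD[OF lst_map_hom[OF lst_comult_hom[OF X]]]
  show ?thesis
  proof (induction n)
    case (Suc n)
    show ?case
      using X by (simp add: Cmp_eq_left[OF Suc])
  qed (use X in simp)
qed

lemma comonad_List_plus: "comonad (SEQ C) (List_plus C)"
proof (unfold_locales; unfold SEQ_simps List_plus_simps)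
  fix X assume X: "X \<in> seq_obj C"
  show "lst C X \<in> seq_obj C"
    using X by simp
  \<comment> \<open>The left side is by definition the extension of the counit.\<close>
  show "seq_cmp C (lst_comult C X) (lst_map C (lst_counit C X)) = seq_id C (lst C X)"
    using lst_extend_counit[OF X] by (simp add: fun_eq_iff lst_extend_def)
qed (auto simp: fun_eq_iff lst_comult_natural lst_comult_counit lst_comult_comult lst_map_counit
    lst_map_cmp seq_cmp_hom lst_comult_hom seq_hom_lst seq_homD)

section \<open>Finite products of causal functions\<close>

lemma lift_causal: "u \<in> seq_hom C X Y \<Longrightarrow> (\<lambda>n. lst_counit C X n \<Zsemi> u n) \<in> causal C X Y"
  using seq_cmp_hom[of "lst_counit C X" "lst C X" X u Y] seq_homD(4)[of u X Y]
  by (simp add: causal_eq seq_cmp_def)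

lemma Pr_seq_hom:
  "\<lbrakk>X \<in> seq_obj C; Y \<in> seq_obj C\<rbrakk> \<Longrightarrow> (\<lambda>n. Pr1 C (X n) (Y n)) \<in> seq_hom C (seq_ten0 C X Y) X"
  "\<lbrakk>X \<in> seq_obj C; Y \<in> seq_obj C\<rbrakk> \<Longrightarrow> (\<lambda>n. Pr2 C (X n) (Y n)) \<in> seq_hom C (seq_ten0 C X Y) Y"
  by (simp_all add: seq_hom_def Hom_iff)

lemma coherence_seq_hom:
  assumes "X \<in> seq_obj C" "Y \<in> seq_obj C" "Z \<in> seq_obj C"
  shows "(\<lambda>n. asc C (X n) (Y n) (Z n)) \<in> seq_hom C (seq_ten0 C (seq_ten0 C X Y) Z) (seq_ten0 C X (seq_ten0 C Y Z))"
    "(\<lambda>n. lun C (X n)) \<in> seq_hom C (seq_ten0 C (\<lambda>n. \<one>) X) X"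
    "(\<lambda>n. run C (X n)) \<in> seq_hom C (seq_ten0 C X (\<lambda>n. \<one>)) X"
    "(\<lambda>n. swp C (X n) (Y n)) \<in> seq_hom C (seq_ten0 C X Y) (seq_ten0 C Y X)"
  using assms by (simp_all add: seq_hom_def Hom_iff)

lemma causal_cat_hom:
  "h \<in> Hom (causal_cat C) X Y \<longleftrightarrow>
     (\<exists>f. h = (X, Y, f) \<and> X \<in> seq_obj C \<and> Y \<in> seq_obj C \<and> f \<in> causal C X Y)"
  by (auto simp: Hom_def causal_cat_def)

text \<open>Extension followed by the counit returns \<open>f\<close>, so cokleisli composition with
  a lifted projection is pointwise composition with the projection.\<close>

lemma lst_extend_Pr:
  assumes "f \<in> causal C Z (seq_ten0 C X Y)" and [simp]: "Z \<in> seq_obj C" "X \<in> seq_obj C" "Y \<in> seq_obj C"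
  shows "lst_extend C Z f n \<Zsemi> (lst_counit C (seq_ten0 C X Y) n \<Zsemi> Pr1 C (X n) (Y n)) = f n \<Zsemi> Pr1 C (X n) (Y n)"
    "lst_extend C Z f n \<Zsemi> (lst_counit C (seq_ten0 C X Y) n \<Zsemi> Pr2 C (X n) (Y n)) = f n \<Zsemi> Pr2 C (X n) (Y n)"
  using HomD[OF lst_extend_hom[OF assms(1,2)]] lst_extend_then_counit[OF assms(1,2)]
    seq_homD(1-3)[OF lst_counit_hom, of "seq_ten0 C X Y" n]
  by simp_all

text \<open>The category laws are the comonad laws in extension form. Products come from the base
  category: a causal function into a product sequence is a pair of causal functions index by index,
  so pairing and its uniqueness are pointwise.\<close>

lemma cartesian_causal_cat: "cartesian_category (causal_cat C)"
proof (unfold_locales; (unfold causal_cat_simps)?)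
  fix f assume "f \<in> Arr (causal_cat C)"
  then show "Dom (causal_cat C) f \<in> seq_obj C" "Cod (causal_cat C) f \<in> seq_obj C"
    by (auto simp: causal_cat_def)
next
  fix h k A B D
  assume "h \<in> Hom (causal_cat C) A B" "k \<in> Hom (causal_cat C) B D"
  then show "h \<Zsemi>\<^bsub>causal_cat C\<^esub> k \<in> Hom (causal_cat C) A D"
    by (auto simp: causal_cat_hom intro: lst_extend_cmp_hom)
next
  fix h A B
  assume "h \<in> Hom (causal_cat C) A B"
  then obtain f where f: "h = (A, B, f)" "A \<in> seq_obj C" "B \<in> seq_obj C" "f \<in> causal C A B"
    by (auto simp: causal_cat_hom)
  show "(A, A, lst_counit C A) \<Zsemi>\<^bsub>causal_cat C\<^esub> h = h"
    using f causalD[OF f(4)] by (simp add: lst_extend_counit)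
  show "h \<Zsemi>\<^bsub>causal_cat C\<^esub> (B, B, lst_counit C B) = h"
    using f by (simp add: lst_extend_then_counit)
next
  fix h k l A B D E
  assume "h \<in> Hom (causal_cat C) A B" "k \<in> Hom (causal_cat C) B D" "l \<in> Hom (causal_cat C) D E"
  then obtain f g i where f: "h = (A, B, f)" "A \<in> seq_obj C" "f \<in> causal C A B"
    and g: "k = (B, D, g)" "B \<in> seq_obj C" "g \<in> causal C B D"
    and i: "l = (D, E, i)" "D \<in> seq_obj C" "i \<in> causal C D E"
    by (auto simp: causal_cat_hom)
  note D = causalD[OF i(3)] HomD[OF lst_extend_hom[OF f(3,2)]] HomD[OF lst_extend_hom[OF g(3,2)]]
  show "h \<Zsemi>\<^bsub>causal_cat C\<^esub> k \<Zsemi>\<^bsub>causal_cat C\<^esub> l = h \<Zsemi>\<^bsub>causal_cat C\<^esub> (k \<Zsemi>\<^bsub>causal_cat C\<^esub> l)"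
    using f g i D by (simp add: lst_extend_cmp[OF f(3) g(3) f(2)])
next
  fix A B assume AB: "A \<in> seq_obj C" "B \<in> seq_obj C"
  show "(seq_ten0 C A B, A, \<lambda>n. lst_counit C (seq_ten0 C A B) n \<Zsemi> Pr1 C (A n) (B n)) \<in> Hom (causal_cat C) (seq_ten0 C A B) A"
    "(seq_ten0 C A B, B, \<lambda>n. lst_counit C (seq_ten0 C A B) n \<Zsemi> Pr2 C (A n) (B n)) \<in> Hom (causal_cat C) (seq_ten0 C A B) B"
    using AB by (simp_all add: causal_cat_hom lift_causal Pr_seq_hom)
next
  fix A assume A: "A \<in> seq_obj C"
  have "(\<lambda>n. bang C (lst C A n)) \<in> causal C A (\<lambda>n. \<one>)"
    using A by (simp add: causal_def Hom_iff)
  moreover have "f = (\<lambda>n. bang C (lst C A n))" if "f \<in> causal C A (\<lambda>n. \<one>)" for f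
    using causalD[OF that] A by (intro ext terminal_unique) simp_all
  ultimately show "\<exists>!h. h \<in> Hom (causal_cat C) A (\<lambda>n. \<one>)"
    unfolding causal_cat_hom using A seq_obj_intros(4) by blast
next
  fix h k Z A B
  assume "h \<in> Hom (causal_cat C) Z A" "k \<in> Hom (causal_cat C) Z B"
  then obtain f g where f: "h = (Z, A, f)" "f \<in> causal C Z A" and g: "k = (Z, B, g)" "g \<in> causal C Z B"
    and [simp]: "Z \<in> seq_obj C" "A \<in> seq_obj C" "B \<in> seq_obj C"
    by (auto simp: causal_cat_hom)
  note [simp] = causalD(1-3)[OF f(2)] causalD(1-3)[OF g(2)]
  let ?t = "\<lambda>n. tuple C (f n) (g n)"
  have t: "?t \<in> causal C Z (seq_ten0 C A B)"
    by (simp add: causal_def Hom_iff)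
  have u: "l = ?t" if "l \<in> causal C Z (seq_ten0 C A B)"
    "(\<lambda>n. l n \<Zsemi> Pr1 C (A n) (B n)) = f" "(\<lambda>n. l n \<Zsemi> Pr2 C (A n) (B n)) = g" for l
  proof
    fix n
    have "f n = l n \<Zsemi> Pr1 C (A n) (B n)" "g n = l n \<Zsemi> Pr2 C (A n) (B n)"
      using that(2,3) by auto
    then show "l n = ?t n"
      using causalD[OF that(1)] by simp
  qed
  show "\<exists>!l. l \<in> Hom (causal_cat C) Z (seq_ten0 C A B) \<and>
      l \<Zsemi>\<^bsub>causal_cat C\<^esub> (seq_ten0 C A B, A, \<lambda>n. lst_counit C (seq_ten0 C A B) n \<Zsemi> Pr1 C (A n) (B n)) = h \<and>
      l \<Zsemi>\<^bsub>causal_cat C\<^esub> (seq_ten0 C A B, B, \<lambda>n. lst_counit C (seq_ten0 C A B) n \<Zsemi> Pr2 C (A n) (B n)) = k"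
    (is "\<exists>!l. ?P l")
  proof (rule ex1I)
    show "?P (Z, seq_ten0 C A B, ?t)"
      using t by (simp add: causal_cat_hom lst_extend_Pr f(1) g(1) del: Cmp_assoc)
    fix l assume l: "?P l"
    then obtain m where m: "l = (Z, seq_ten0 C A B, m)" "m \<in> causal C Z (seq_ten0 C A B)"
      by (auto simp: causal_cat_hom)
    have "m = ?t"
      by (rule u[OF m(2)]) (use l m in \<open>simp_all add: lst_extend_Pr f(1) g(1) del: Cmp_assoc\<close>)
    then show "l = (Z, seq_ten0 C A B, ?t)"
      by (simp add: m)
  qed
qed (simp_all add: causal_cat_hom causal_eq)

end

text \<open>The functor from the base category to the cokleisli category that is the identity on
  objects. It preserves pairing, so the coherence maps of causal functions are lifts of those of
  \<open>C\<close>.\<close>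

definition causal_lift ::
  "('o, 'm) cart_cat \<Rightarrow> (nat \<Rightarrow> 'o) \<Rightarrow> (nat \<Rightarrow> 'o) \<Rightarrow> (nat \<Rightarrow> 'm) \<Rightarrow>
   (nat \<Rightarrow> 'o) \<times> (nat \<Rightarrow> 'o) \<times> (nat \<Rightarrow> 'm)" where
  "causal_lift C X Y u = (X, Y, \<lambda>n. lst_counit C X n \<Zsemi>\<^bsub>C\<^esub> u n)"

context cartesian_category
begin

text \<open>By the eta rule, since the two projections of the pointwise pairing are \<open>f\<close>
  and \<open>g\<close>.\<close>

lemma tuple_causal_cat:
  assumes f: "f \<in> causal C Z A" and g: "g \<in> causal C Z B" and [simp]: "Z \<in> seq_obj C"
  shows "tuple (causal_cat C) (Z, A, f) (Z, B, g) = (Z, seq_ten0 C A B, \<lambda>n. tuple C (f n) (g n))"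
proof -
  interpret K: cartesian_category "causal_cat C"
    by (rule cartesian_causal_cat)
  note [simp] = causalD[OF f] causalD[OF g]
  let ?t = "\<lambda>n. tuple C (f n) (g n)"
  have t: "?t \<in> causal C Z (seq_ten0 C A B)"
    by (simp add: causal_def Hom_iff)
  then have h: "(Z, seq_ten0 C A B, ?t) \<in> Arr (causal_cat C)"
    by (simp add: causal_cat_def)
  show ?thesis
    using K.tuple_eta[OF h, of A B] by (simp add: lst_extend_Pr[OF t] del: Cmp_assoc)
qed

lemma Cmp_causal_lift:
  assumes "u \<in> seq_hom C X Y"
  shows "Cmp (causal_cat C) (causal_lift C X Y u) (Y, Z, f) = (X, Z, \<lambda>n. lst_map C u n \<Zsemi> f n)"
  by (simp add: causal_lift_def lst_extend_lift[OF assms])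

lemma Cmp_causal_lift_lift:
  assumes "u \<in> seq_hom C X Y" "v \<in> seq_hom C Y Z"
  shows "Cmp (causal_cat C) (causal_lift C X Y u) (causal_lift C Y Z v) = causal_lift C X Z (seq_cmp C u v)"
proof -
  have "lst_map C u n \<Zsemi> (lst_counit C Y n \<Zsemi> v n) = lst_counit C X n \<Zsemi> (u n \<Zsemi> v n)" for n
    using seq_homD[OF assms(1)] seq_homD[OF assms(2)] HomD[OF lst_map_hom[OF assms(1)]]
      seq_homD[OF lst_counit_hom]
    by (simp add: lst_map_counit[OF assms(1)])
  then show ?thesis
    using Cmp_causal_lift[OF assms(1), of Z] by (simp add: causal_lift_def)
qed

lemma tuple_causal_lift:
  assumes u: "u \<in> seq_hom C Z A" and v: "v \<in> seq_hom C Z B"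
  shows "tuple (causal_cat C) (causal_lift C Z A u) (causal_lift C Z B v) =
    causal_lift C Z (seq_ten0 C A B) (\<lambda>n. tuple C (u n) (v n))"
  using seq_homD[OF u] seq_homD[OF v] seq_homD[OF lst_counit_hom]
  by (simp add: causal_lift_def tuple_causal_cat[OF lift_causal[OF u] lift_causal[OF v]])

lemma causal_lift_simps:
  "Dom (causal_cat C) (causal_lift C X Y u) = X" "Cod (causal_cat C) (causal_lift C X Y u) = Y"
  "Pr1 (causal_cat C) X Y = causal_lift C (seq_ten0 C X Y) X (\<lambda>n. Pr1 C (X n) (Y n))"
  "Pr2 (causal_cat C) X Y = causal_lift C (seq_ten0 C X Y) Y (\<lambda>n. Pr2 C (X n) (Y n))"
  by (simp_all add: causal_lift_def)

lemma Id_causal_lift: "X \<in> seq_obj C \<Longrightarrow> Id (causal_cat C) X = causal_lift C X X (seq_id C X)"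
  using seq_homD[OF lst_counit_hom] by (simp add: causal_lift_def)

text \<open>A product of arrows precomposes each factor with a lifted projection. Extending that
  projection gives \<open>lst_map\<close> of the projections, and pairing the two results is exactly
  what \<open>cm_split\<close> does.\<close>

lemma cross_causal_cat:
  assumes f: "f \<in> causal C X Y" and f': "f' \<in> causal C X' Y'"
    and X [simp]: "X \<in> seq_obj C" "X' \<in> seq_obj C"
  shows "cross (causal_cat C) (X, Y, f) (X', Y', f') =
    (seq_ten0 C X X', seq_ten0 C Y Y', Ten (cokleisli (SEQ C) (List_plus C)) X Y X' Y' f f')"
proof -
  let ?XX = "seq_ten0 C X X'"
  note P = Pr_seq_hom[OF X]
  note D = HomD[OF lst_map_hom[OF P(1)]] HomD[OF lst_map_hom[OF P(2)]] causalD[OF f] causalD[OF f']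
  have 1: "(\<lambda>n. lst_map C (\<lambda>k. Pr1 C (X k) (X' k)) n \<Zsemi> f n) \<in> causal C ?XX Y"
    and 2: "(\<lambda>n. lst_map C (\<lambda>k. Pr2 C (X k) (X' k)) n \<Zsemi> f' n) \<in> causal C ?XX Y'"
    using D by (simp_all add: causal_def Hom_iff)
  show ?thesis
    unfolding cross_def causal_cat_simps(3,4) causal_lift_simps(3,4) Cmp_causal_lift[OF P(1)]
      Cmp_causal_lift[OF P(2)] tuple_causal_cat[OF 1 2 seq_obj_intros(3)[OF X]]
    using D by (simp add: fun_eq_iff)
qed

lemma cross_causal_lift:
  assumes u: "u \<in> seq_hom C X Y" and u': "u' \<in> seq_hom C X' Y'"
  shows "cross (causal_cat C) (causal_lift C X Y u) (causal_lift C X' Y' u') =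
    causal_lift C (seq_ten0 C X X') (seq_ten0 C Y Y') (\<lambda>n. u n \<boxtimes> u' n)"
proof -
  note D = seq_homD[OF u] seq_homD[OF u']
  note P = Pr_seq_hom[OF D(4) D(9)]
  show ?thesis
    unfolding cross_def causal_lift_simps Cmp_causal_lift_lift[OF P(1) u]
      Cmp_causal_lift_lift[OF P(2) u'] tuple_causal_lift[OF seq_cmp_hom[OF P(1) u] seq_cmp_hom[OF P(2) u']]
    using D by simp
qed

lemma swp_causal_cat:
  assumes X: "X \<in> seq_obj C" "Y \<in> seq_obj C"
  shows "swp (causal_cat C) X Y = causal_lift C (seq_ten0 C X Y) (seq_ten0 C Y X) (\<lambda>n. swp C (X n) (Y n))"
  unfolding swp_def
  by (simp only: causal_lift_simps tuple_causal_lift[OF Pr_seq_hom(2,1)[OF X]])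

lemma asc_causal_cat:
  assumes X: "X \<in> seq_obj C" "Y \<in> seq_obj C" "Z \<in> seq_obj C"
  shows "asc (causal_cat C) X Y Z =
    causal_lift C (seq_ten0 C (seq_ten0 C X Y) Z) (seq_ten0 C X (seq_ten0 C Y Z)) (\<lambda>n. asc C (X n) (Y n) (Z n))"
proof -
  let ?XY = "seq_ten0 C X Y"
  have XY: "?XY \<in> seq_obj C" using X by simp
  note P = Pr_seq_hom[OF X(1,2)] Pr_seq_hom[OF XY X(3)]
  have c: "(\<lambda>n. Pr2 C (X n) (Y n) \<boxtimes> seq_id C Z n) \<in> seq_hom C (seq_ten0 C ?XY Z) (seq_ten0 C Y Z)"
    using X by (simp add: seq_hom_def Hom_iff)
  show ?thesis
    unfolding asc_def causal_lift_simps(3,4) causal_cat_simps(8) Id_causal_lift[OF X(3)]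
      Cmp_causal_lift_lift[OF P(3,1)] cross_causal_lift[OF P(2) seq_id_hom[OF X(3)]]
      tuple_causal_lift[OF seq_cmp_hom[OF P(3,1)] c]
    by simp
qed

text \<open>The comparison with the cartesian structure of \<open>causal_cat\<close> does nothing
  but attach source and target to a causal function.\<close>

lemma symmetric_monoidal_cokleisli: "symmetric_monoidal_category (cokleisli (SEQ C) (List_plus C))"
proof -
  let ?S = "cokleisli (SEQ C) (List_plus C)" and ?T = "cartesian_smc (causal_cat C)"
  interpret K: cartesian_category "causal_cat C"
    by (rule cartesian_causal_cat)
  have one: "(\<lambda>n. \<one>) \<in> seq_obj C" by simp
  have ten: "Ten ?S X Y X' Y' f f' \<in> causal C (seq_ten0 C X X') (seq_ten0 C Y Y')"
    if X: "X \<in> seq_obj C" "X' \<in> seq_obj C" and f: "f \<in> causal C X Y" "f' \<in> causal C X' Y'"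
    for X Y X' Y' f f'
  proof -
    have "cross (causal_cat C) (X, Y, f) (X', Y', f') \<in> Arr (causal_cat C)"
      using X f causalD(4)[OF f(1)] causalD(4)[OF f(2)] by simp
    then show ?thesis
      unfolding cross_causal_cat[OF f X] by (simp only: causal_cat_simps)
  qed
  \<comment> \<open>\<open>cokleisli\<close> brackets the composite to the right,
    \<open>lst_extend\<close> to the left.\<close>
  have cmp: "SCmp ?S X Y Z f g = (\<lambda>n. lst_extend C X f n \<Zsemi> g n)"
    if "X \<in> seq_obj C" "f \<in> causal C X Y" "g \<in> causal C Y Z" for X Y Z f g
    using that HomD[OF lst_comult_hom'[OF that(1)]] HomD[OF lst_map_hom[OF that(2)[unfolded causal_eq]]]
      causalD[OF that(3)] by (simp add: fun_eq_iff lst_extend_def)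
  have iso: "smc_identity_on_objects_iso ?S ?T (\<lambda>X Y f. (X, Y, f))"
  proof (unfold_locales; simp add: causal_eq[symmetric] del: cokleisli_List_plus_simps(4,6))
    fix X Y assume "X \<in> seq_obj C" "Y \<in> seq_obj C"
    then show "bij_betw (\<lambda>f. (X, Y, f)) (causal C X Y) (Hom (causal_cat C) X Y)"
      by (auto simp: bij_betw_def inj_on_def causal_cat_hom)
  next
    fix X Y Z f g assume "X \<in> seq_obj C" "f \<in> causal C X Y" "g \<in> causal C Y Z"
    then show "SCmp ?S X Y Z f g = (\<lambda>n. lst_extend C X f n \<Zsemi> g n)"
      by (rule cmp)
  next
    fix X Y X' Y' f f'
    assume "X \<in> seq_obj C" "X' \<in> seq_obj C" "f \<in> causal C X Y" "f' \<in> causal C X' Y'"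
    then show "(seq_ten0 C X X', seq_ten0 C Y Y', Ten ?S X Y X' Y' f f') =
      cross (causal_cat C) (X, Y, f) (X', Y', f')"
      by (simp only: cross_causal_cat)
  qed (simp_all add: asc_causal_cat swp_causal_cat lun_def run_def causal_lift_def seq_cmp_def)
  have lift: "seq_cmp C (lst_counit C X) u \<in> causal C X Y" if "u \<in> seq_hom C X Y" for X Y u
    using lift_causal[OF that] by (simp add: seq_cmp_def)
  show ?thesis
    by (rule symmetric_monoidal_category_transfer[OF K.symmetric_monoidal_cartesian_smc iso])
      (simp_all add: causal_eq[symmetric] ten cmp lift lst_extend_cmp_hom coherence_seq_hom one
        del: cokleisli_List_plus_simps(4,6), simp_all add: causal_eq)
qed

end

section \<open>Coends\<close>

text \<open>\<open>class_map\<close> takes a union over the whole class. If \<open>f\<close>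
  respects the relations, all its members contribute the same class, so any one of them computes the
  union.\<close>

lemma class_map_class:
  assumes "equiv B r" and "equiv A s" "x \<in> A"
    and "\<And>y. (x, y) \<in> s \<Longrightarrow> (f x, f y) \<in> r"
  shows "class_map r f (s `` {x}) = r `` {f x}"
proof -
  have "r `` {f y} = r `` {f x}" if "y \<in> s `` {x}" for y
    using equiv_class_eq[OF assms(1) assms(4)[of y]] that by simp
  moreover have "x \<in> s `` {x}"
    using equiv_class_self[OF assms(2,3)] .
  ultimately show ?thesis
    unfolding class_map_def by blast
qed

lemma equiv_coend_rel: "equiv (coend_pre C Q X Y) (coend_rel C Q X Y)"
proof (rule equivI)
  let ?d = "dinat C Q X Y \<union> (dinat C Q X Y)\<inverse>"
  have "sym (?d\<^sup>*)"
    by (rule sym_rtrancl) (auto simp: sym_def)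
  then show "sym (coend_rel C Q X Y)"
    by (auto simp: coend_rel_def sym_def)
  show "trans (coend_rel C Q X Y)"
    by (auto simp: coend_rel_def trans_def intro: rtrancl_trans)
qed (auto simp: coend_rel_def refl_on_def)

text \<open>The relation is generated by \<open>dinat\<close>, so only a single slide has to be
  tested.\<close>

lemma coend_rel_invariant:
  assumes "(x, y) \<in> coend_rel C Q X Y" and "\<And>x y. (x, y) \<in> dinat C Q X Y \<Longrightarrow> g x = g y"
  shows "g x = g y"
proof -
  have "(x, y) \<in> (dinat C Q X Y \<union> (dinat C Q X Y)\<inverse>)\<^sup>*"
    using assms(1) by (simp add: coend_rel_def)
  then show ?thesis
    by (induction rule: rtrancl_induct) (use assms(2) in auto)
qed

lemma coend_rel_map:
  assumes "(x, y) \<in> coend_rel C Q X Y"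
    and "\<And>x y. (x, y) \<in> dinat C Q X Y \<Longrightarrow> (g x, g y) \<in> dinat C' Q' X' Y'"
    and "\<And>x. x \<in> coend_pre C Q X Y \<Longrightarrow> g x \<in> coend_pre C' Q' X' Y'"
  shows "(g x, g y) \<in> coend_rel C' Q' X' Y'"
proof -
  have "(x, y) \<in> (dinat C Q X Y \<union> (dinat C Q X Y)\<inverse>)\<^sup>*"
    using assms(1) by (simp add: coend_rel_def)
  then have "(g x, g y) \<in> (dinat C' Q' X' Y' \<union> (dinat C' Q' X' Y')\<inverse>)\<^sup>*"
    by (induction rule: rtrancl_induct) (use assms(2) in \<open>auto intro: rtrancl_into_rtrancl\<close>)
  then show ?thesis
    using assms(1,3) by (auto simp: coend_rel_def)
qed

lemma phi_El_class:
  "x \<in> coend_pre C Q X Y \<Longrightarrow> coend_rel C Q X Y `` {x} \<in> El (phi C Q) X Y"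
  by (simp add: phi_def quotientI)

lemma phi_El_cases:
  assumes "e \<in> El (phi C Q) X Y"
  obtains M f q where "(M, f, q) \<in> coend_pre C Q X Y" "e = coend_rel C Q X Y `` {(M, f, q)}"
  using assms by (auto simp: phi_def elim!: quotientE)

section \<open>Gluing a first action to a rest\<close>

text \<open>Here \<open>k\<close> gives the causal function of each rest. The memory computed by
  \<open>f\<close> takes the place of the first input in the source of the rest, which accounts for
  the \<open>carry\<close>. The value depends on a triple, not on its class in the coend; invariance
  under sliding is \<open>causal_glue_dinat\<close>.\<close>

definition causal_glue ::
  "('o, 'm) cart_cat \<Rightarrow> (nat \<Rightarrow> 'o) \<Rightarrow> (nat \<Rightarrow> 'o) \<Rightarrow>
   ((nat \<Rightarrow> 'o) \<Rightarrow> (nat \<Rightarrow> 'o) \<Rightarrow> 'q \<Rightarrow> nat \<Rightarrow> 'm) \<Rightarrow> 'o \<times> 'm \<times> 'q \<Rightarrow> nat \<Rightarrow> 'm" where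
  "causal_glue C X Y k = (\<lambda>(M, f, q) n. case n of
       0 \<Rightarrow> f \<Zsemi>\<^bsub>C\<^esub> Pr2 C M (Y 0)
     | Suc m \<Rightarrow> carry C (f \<Zsemi>\<^bsub>C\<^esub> Pr1 C M (Y 0)) (shift X) m \<Zsemi>\<^bsub>C\<^esub> k (M \<bullet>\<^bsub>C\<^esub> shift X) (shift Y) q m)"

lemma causal_glue_simps [simp]:
  "causal_glue C X Y k (M, f, q) 0 = f \<Zsemi>\<^bsub>C\<^esub> Pr2 C M (Y 0)"
  "causal_glue C X Y k (M, f, q) (Suc m) =
     carry C (f \<Zsemi>\<^bsub>C\<^esub> Pr1 C M (Y 0)) (shift X) m \<Zsemi>\<^bsub>C\<^esub> k (M \<bullet>\<^bsub>C\<^esub> shift X) (shift Y) q m"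
  by (simp_all add: causal_glue_def)

text \<open>Naturality is split by output index so that it can serve as an induction hypothesis:
  index \<open>Suc m\<close> of a glued function consults the rest at index \<open>m\<close>
  only.\<close>

definition natural_at ::
  "('o, 'm) cart_cat \<Rightarrow> ('o, 'm, 'q) prof \<Rightarrow> ((nat \<Rightarrow> 'o) \<Rightarrow> (nat \<Rightarrow> 'o) \<Rightarrow> 'q \<Rightarrow> nat \<Rightarrow> 'm) \<Rightarrow> nat \<Rightarrow> bool" where
  "natural_at C Q k n \<longleftrightarrow>
     (\<forall>X \<in> seq_obj C. \<forall>Y \<in> seq_obj C. \<forall>q \<in> El Q X Y. k X Y q n \<in> Hom C (lst C X n) (Y n)) \<and>
     (\<forall>X X' Y Y'. \<forall>u \<in> seq_hom C X' X. \<forall>v \<in> seq_hom C Y Y'. \<forall>q \<in> El Q X Y.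
        k X' Y' (Act Q u v q) n = lst_map C u n \<Zsemi>\<^bsub>C\<^esub> k X Y q n \<Zsemi>\<^bsub>C\<^esub> v n)"

lemma natural_atD:
  assumes "natural_at C Q k n"
  shows "\<lbrakk>X \<in> seq_obj C; Y \<in> seq_obj C; q \<in> El Q X Y\<rbrakk> \<Longrightarrow> k X Y q n \<in> Hom C (lst C X n) (Y n)"
    and "\<lbrakk>u \<in> seq_hom C X' X; v \<in> seq_hom C Y Y'; q \<in> El Q X Y\<rbrakk> \<Longrightarrow>
      k X' Y' (Act Q u v q) n = lst_map C u n \<Zsemi>\<^bsub>C\<^esub> k X Y q n \<Zsemi>\<^bsub>C\<^esub> v n"
  using assms by (auto simp: natural_at_def)

lemma natural_transformationD:
  assumes "natural_transformation C Q P h"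
  shows "\<lbrakk>X \<in> seq_obj C; Y \<in> seq_obj C; q \<in> El Q X Y\<rbrakk> \<Longrightarrow> h X Y q \<in> El P X Y"
    and "\<lbrakk>u \<in> seq_hom C X' X; v \<in> seq_hom C Y Y'; q \<in> El Q X Y\<rbrakk> \<Longrightarrow>
      h X' Y' (Act Q u v q) = Act P u v (h X Y q)"
  using assms by (auto simp: natural_transformation_def)

lemma profunctorD:
  assumes "profunctor C Q"
  shows "\<lbrakk>u \<in> seq_hom C X' X; v \<in> seq_hom C Y Y'; q \<in> El Q X Y\<rbrakk> \<Longrightarrow> Act Q u v q \<in> El Q X' Y'"
    and "\<lbrakk>X \<in> seq_obj C; Y \<in> seq_obj C; q \<in> El Q X Y\<rbrakk> \<Longrightarrow> Act Q (seq_id C X) (seq_id C Y) q = q"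
    and "\<lbrakk>u \<in> seq_hom C X' X; u' \<in> seq_hom C X'' X'; v \<in> seq_hom C Y Y'; v' \<in> seq_hom C Y' Y''; q \<in> El Q X Y\<rbrakk> \<Longrightarrow>
      Act Q u' v' (Act Q u v q) = Act Q (seq_cmp C u' u) (seq_cmp C v v') q"
proof -
  note D = assms[unfolded profunctor_def]
  show "Act Q u v q \<in> El Q X' Y'" if "u \<in> seq_hom C X' X" "v \<in> seq_hom C Y Y'" "q \<in> El Q X Y"
    by (rule conjunct1[OF D, rule_format, OF that])
  show "Act Q (seq_id C X) (seq_id C Y) q = q" if "X \<in> seq_obj C" "Y \<in> seq_obj C" "q \<in> El Q X Y"
    by (rule conjunct1[OF conjunct2[OF D], rule_format, OF that])
  show "Act Q u' v' (Act Q u v q) = Act Q (seq_cmp C u' u) (seq_cmp C v v') q"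
    if "u \<in> seq_hom C X' X" "u' \<in> seq_hom C X'' X'" "v \<in> seq_hom C Y Y'" "v' \<in> seq_hom C Y' Y''" "q \<in> El Q X Y"
    by (rule conjunct2[OF conjunct2[OF D], rule_format, OF that, symmetric])
qed

lemma coend_preD:
  assumes "(M, f, q) \<in> coend_pre C Q X Y"
  shows "M \<in> Obj C" "f \<in> Hom C (X 0) (M \<otimes>\<^bsub>C\<^esub> Y 0)" "q \<in> El Q (M \<bullet>\<^bsub>C\<^esub> shift X) (shift Y)"
  using assms by (auto simp: coend_pre_def)

lemma causal_prof_simps [simp]:
  "El (causal_prof C) = causal C"
  "Act (causal_prof C) u v f = (\<lambda>n. lst_map C u n \<Zsemi>\<^bsub>C\<^esub> f n \<Zsemi>\<^bsub>C\<^esub> v n)"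
  by (simp_all add: causal_prof_def)

lemma natural_causal_iff:
  "natural_transformation C Q (causal_prof C) k \<longleftrightarrow> (\<forall>n. natural_at C Q k n)"
  unfolding natural_transformation_def natural_at_def
  by (simp add: causal_def fun_eq_iff) blast

context cartesian_category
begin

section \<open>The coend as a functor of the profunctor\<close>

lemma dinatE:
  assumes "(x, y) \<in> dinat C Q X Y"
  obtains M N r f q where "x = (M, f, Act Q (r \<odot> seq_id C (shift X)) (seq_id C (shift Y)) q)"
    "y = (N, f \<Zsemi> r \<boxtimes> Id C (Y 0), q)" "r \<in> Hom C M N" "f \<in> Hom C (X 0) (M \<otimes> Y 0)"
    "q \<in> El Q (N \<bullet> shift X) (shift Y)"
  using assms unfolding dinat_def by blast

lemma dinat_pre:
  assumes Q: "profunctor C Q" and "X \<in> seq_obj C" "Y \<in> seq_obj C" and "(x, y) \<in> dinat C Q X Y"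
  shows "x \<in> coend_pre C Q X Y" "y \<in> coend_pre C Q X Y"
proof -
  from assms(4) obtain M N r f q where xy: "x = (M, f, Act Q (r \<odot> seq_id C (shift X)) (seq_id C (shift Y)) q)"
    "y = (N, f \<Zsemi> r \<boxtimes> Id C (Y 0), q)"
    and r: "r \<in> Hom C M N" "f \<in> Hom C (X 0) (M \<otimes> Y 0)" "q \<in> El Q (N \<bullet> shift X) (shift Y)"
    by (rule dinatE)
  have "r \<odot> seq_id C (shift X) \<in> seq_hom C (M \<bullet> shift X) (N \<bullet> shift X)"
    using r assms by (intro dot_hom_hom) simp_all
  with r assms xy show "x \<in> coend_pre C Q X Y" "y \<in> coend_pre C Q X Y"
    using HomD[OF r(1)] HomD[OF r(2)] profunctorD(1)[OF Q _ seq_id_hom r(3)]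
    by (auto simp: coend_pre_def Hom_iff)
qed

lemma dinat_coend_rel:
  assumes "profunctor C Q" "X \<in> seq_obj C" "Y \<in> seq_obj C" "(x, y) \<in> dinat C Q X Y"
  shows "(x, y) \<in> coend_rel C Q X Y"
  using dinat_pre[OF assms] assms(4) by (auto simp: coend_rel_def)

lemma phi_Act_pre:
  assumes Q: "profunctor C Q" and u: "u \<in> seq_hom C X' X" and v: "v \<in> seq_hom C Y Y'"
    and x: "(M, f, q) \<in> coend_pre C Q X Y"
  shows "(M, u 0 \<Zsemi> f \<Zsemi> Id C M \<boxtimes> v 0, Act Q (Id C M \<odot> shift u) (shift v) q) \<in> coend_pre C Q X' Y'"
proof -
  note D = coend_preD[OF x]
  have "Act Q (Id C M \<odot> shift u) (shift v) q \<in> El Q (M \<bullet> shift X') (shift Y')"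
    by (rule profunctorD(1)[OF Q _ _ D(3)]) (intro dot_hom_hom id_hom shift_hom D u v)+
  then show ?thesis
    using seq_homD[OF u] seq_homD[OF v] HomD[OF D(2)] D by (simp add: coend_pre_def Hom_iff)
qed

text \<open>Acting on a representative commutes with sliding: \<open>u\<close> and \<open>v\<close>
  act on inputs and outputs, \<open>r\<close> on the memory, and functoriality of \<open>Q\<close>
  allows the two actions to be exchanged.\<close>

lemma phi_Act_class:
  assumes Q: "profunctor C Q" and u: "u \<in> seq_hom C X' X" and v: "v \<in> seq_hom C Y Y'"
    and x: "(M, f, q) \<in> coend_pre C Q X Y"
  shows "Act (phi C Q) u v (coend_rel C Q X Y `` {(M, f, q)}) =
    coend_rel C Q X' Y' `` {(M, u 0 \<Zsemi> f \<Zsemi> Id C M \<boxtimes> v 0, Act Q (Id C M \<odot> shift u) (shift v) q)}"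
proof -
  let ?g = "\<lambda>(M, f, q). (M, u 0 \<Zsemi> f \<Zsemi> Id C M \<boxtimes> v 0, Act Q (Id C M \<odot> shift u) (shift v) q)"
  note U = seq_homD[OF u] and V = seq_homD[OF v]
  have dinat: "(?g x, ?g y) \<in> dinat C Q X' Y'" if d: "(x, y) \<in> dinat C Q X Y" for x y
  proof -
    from d obtain M N r f q where xy: "x = (M, f, Act Q (r \<odot> seq_id C (shift X)) (seq_id C (shift Y)) q)"
      "y = (N, f \<Zsemi> r \<boxtimes> Id C (Y 0), q)"
      and r: "r \<in> Hom C M N" "f \<in> Hom C (X 0) (M \<otimes> Y 0)" "q \<in> El Q (N \<bullet> shift X) (shift Y)"
      by (rule dinatE)
    note R = HomD[OF r(1)] HomD[OF r(2)]
    have X: "shift X \<in> seq_obj C" "shift Y \<in> seq_obj C" "shift X' \<in> seq_obj C" "shift Y' \<in> seq_obj C"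
      using U V by simp_all
    have h: "r \<odot> seq_id C (shift X) \<in> seq_hom C (M \<bullet> shift X) (N \<bullet> shift X)"
      "Id C M \<odot> shift u \<in> seq_hom C (M \<bullet> shift X') (M \<bullet> shift X)"
      "Id C N \<odot> shift u \<in> seq_hom C (N \<bullet> shift X') (N \<bullet> shift X)"
      "r \<odot> seq_id C (shift X') \<in> seq_hom C (M \<bullet> shift X') (N \<bullet> shift X')"
      "shift v \<in> seq_hom C (shift Y) (shift Y')"
      by (intro dot_hom_hom r id_hom R shift_hom u v seq_id_hom X)+
    have "Act Q (Id C M \<odot> shift u) (shift v) (Act Q (r \<odot> seq_id C (shift X)) (seq_id C (shift Y)) q)
      = Act Q (seq_cmp C (Id C M \<odot> shift u) (r \<odot> seq_id C (shift X))) (seq_cmp C (seq_id C (shift Y)) (shift v)) q"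
      by (rule profunctorD(3)[OF Q h(1,2) seq_id_hom[OF X(2)] h(5) r(3)])
    also have "seq_cmp C (Id C M \<odot> shift u) (r \<odot> seq_id C (shift X)) =
        seq_cmp C (r \<odot> seq_id C (shift X')) (Id C N \<odot> shift u)"
      using U R by (auto simp: fun_eq_iff dot_hom_def)
    also have "seq_cmp C (seq_id C (shift Y)) (shift v) = seq_cmp C (shift v) (seq_id C (shift Y'))"
      using V by (auto simp: fun_eq_iff)
    also have "Act Q (seq_cmp C (r \<odot> seq_id C (shift X')) (Id C N \<odot> shift u)) (seq_cmp C (shift v) (seq_id C (shift Y'))) q
      = Act Q (r \<odot> seq_id C (shift X')) (seq_id C (shift Y')) (Act Q (Id C N \<odot> shift u) (shift v) q)"
      by (rule profunctorD(3)[OF Q h(3,4,5) seq_id_hom[OF X(4)] r(3), symmetric])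
    finally have act: "Act Q (Id C M \<odot> shift u) (shift v) (Act Q (r \<odot> seq_id C (shift X)) (seq_id C (shift Y)) q)
      = Act Q (r \<odot> seq_id C (shift X')) (seq_id C (shift Y')) (Act Q (Id C N \<odot> shift u) (shift v) q)" .
    have gx: "?g x = (M, u 0 \<Zsemi> f \<Zsemi> Id C M \<boxtimes> v 0,
        Act Q (r \<odot> seq_id C (shift X')) (seq_id C (shift Y')) (Act Q (Id C N \<odot> shift u) (shift v) q))"
      by (simp only: xy prod.case act)
    \<comment> \<open>Bifunctoriality of the product moves \<open>v 0\<close> past \<open>r\<close>.
      The rules for associativity and for fusing product maps are disabled in turn, so that only the
      neighbouring pair is exchanged.\<close>
    have "u 0 \<Zsemi> (f \<Zsemi> r \<boxtimes> Id C (Y 0)) \<Zsemi> Id C N \<boxtimes> v 0 = u 0 \<Zsemi> f \<Zsemi> (r \<boxtimes> Id C (Y 0) \<Zsemi> Id C N \<boxtimes> v 0)"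
      using U V R by (simp del: cross_cross)
    also have "\<dots> = u 0 \<Zsemi> f \<Zsemi> (Id C M \<boxtimes> v 0 \<Zsemi> r \<boxtimes> Id C (Y' 0))"
      using U V R by (simp del: Cmp_assoc)
    also have "\<dots> = u 0 \<Zsemi> f \<Zsemi> Id C M \<boxtimes> v 0 \<Zsemi> r \<boxtimes> Id C (Y' 0)"
      using U V R by (simp del: cross_cross)
    finally have gy: "?g y = (N, u 0 \<Zsemi> f \<Zsemi> Id C M \<boxtimes> v 0 \<Zsemi> r \<boxtimes> Id C (Y' 0), Act Q (Id C N \<odot> shift u) (shift v) q)"
      by (simp add: xy)
    have "u 0 \<Zsemi> f \<Zsemi> Id C M \<boxtimes> v 0 \<in> Hom C (X' 0) (M \<otimes> Y' 0)"
      using U V R by (simp add: Hom_iff)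
    moreover have "Act Q (Id C N \<odot> shift u) (shift v) q \<in> El Q (N \<bullet> shift X') (shift Y')"
      by (rule profunctorD(1)[OF Q h(3,5) r(3)])
    ultimately show ?thesis
      unfolding gx gy dinat_def using r(1) by blast
  qed
  have pre: "?g y \<in> coend_pre C Q X' Y'" if "y \<in> coend_pre C Q X Y" for y
    using phi_Act_pre[OF Q u v] that by (cases y) auto
  have "class_map (coend_rel C Q X' Y') ?g (coend_rel C Q X Y `` {(M, f, q)})
    = coend_rel C Q X' Y' `` {?g (M, f, q)}"
    by (rule class_map_class[OF equiv_coend_rel equiv_coend_rel x], erule coend_rel_map[where g = ?g])
      (fact dinat pre)+
  then show ?thesis
    using U V by (simp add: phi_def)
qed

lemma phi_map_pre:
  assumes h: "natural_transformation C Q P h" and XY: "X \<in> seq_obj C" "Y \<in> seq_obj C"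
    and x: "(M, f, q) \<in> coend_pre C Q X Y"
  shows "(M, f, h (M \<bullet> shift X) (shift Y) q) \<in> coend_pre C P X Y"
  using coend_preD[OF x] XY natural_transformationD(1)[OF h] by (simp add: coend_pre_def)

lemma phi_map_class:
  assumes h: "natural_transformation C Q P h" and XY: "X \<in> seq_obj C" "Y \<in> seq_obj C"
    and x: "(M, f, q) \<in> coend_pre C Q X Y"
  shows "phi_map C P h X Y (coend_rel C Q X Y `` {(M, f, q)}) =
    coend_rel C P X Y `` {(M, f, h (M \<bullet> shift X) (shift Y) q)}"
proof -
  let ?g = "\<lambda>(M, f, q). (M, f, h (M \<bullet> shift X) (shift Y) q)"
  have dinat: "(?g x, ?g y) \<in> dinat C P X Y" if d: "(x, y) \<in> dinat C Q X Y" for x y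
  proof -
    from d obtain M N r f q where xy: "x = (M, f, Act Q (r \<odot> seq_id C (shift X)) (seq_id C (shift Y)) q)"
      "y = (N, f \<Zsemi> r \<boxtimes> Id C (Y 0), q)"
      and r: "r \<in> Hom C M N" "f \<in> Hom C (X 0) (M \<otimes> Y 0)" "q \<in> El Q (N \<bullet> shift X) (shift Y)"
      by (rule dinatE)
    note R = HomD[OF r(1)]
    have u: "r \<odot> seq_id C (shift X) \<in> seq_hom C (M \<bullet> shift X) (N \<bullet> shift X)"
      "seq_id C (shift Y) \<in> seq_hom C (shift Y) (shift Y)"
      using dot_hom_hom[OF r(1) seq_id_hom] XY by simp_all
    have "h (N \<bullet> shift X) (shift Y) q \<in> El P (N \<bullet> shift X) (shift Y)"
      by (rule natural_transformationD(1)[OF h]) (use XY R r in auto)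
    then show ?thesis
      unfolding dinat_def xy using r(1,2) natural_transformationD(2)[OF h u r(3)] by auto
  qed
  have pre: "?g y \<in> coend_pre C P X Y" if "y \<in> coend_pre C Q X Y" for y
    using phi_map_pre[OF h XY] that by (cases y) auto
  have "class_map (coend_rel C P X Y) ?g (coend_rel C Q X Y `` {(M, f, q)})
    = coend_rel C P X Y `` {?g (M, f, q)}"
    by (rule class_map_class[OF equiv_coend_rel equiv_coend_rel x], erule coend_rel_map[where g = ?g])
      (fact dinat pre)+
  then show ?thesis
    by (simp add: phi_map_def)
qed

lemma phi_map_El:
  assumes "natural_transformation C Q P h" "X \<in> seq_obj C" "Y \<in> seq_obj C" "e \<in> El (phi C Q) X Y"
  shows "phi_map C P h X Y e \<in> El (phi C P) X Y"
  using assms(4) by (elim phi_El_cases) (simp add: phi_map_class[OF assms(1-3)] phi_map_pre[OF assms(1-3)] phi_El_class)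

lemma phi_map_natural:
  assumes Q: "profunctor C Q" and P: "profunctor C P" and h: "natural_transformation C Q P h"
    and u: "u \<in> seq_hom C X' X" and v: "v \<in> seq_hom C Y Y'" and e: "e \<in> El (phi C Q) X Y"
  shows "phi_map C P h X' Y' (Act (phi C Q) u v e) = Act (phi C P) u v (phi_map C P h X Y e)"
  using e
proof (rule phi_El_cases)
  fix M f q assume x: "(M, f, q) \<in> coend_pre C Q X Y" and "e = coend_rel C Q X Y `` {(M, f, q)}"
  moreover have "h (M \<bullet> shift X') (shift Y') (Act Q (Id C M \<odot> shift u) (shift v) q) =
      Act P (Id C M \<odot> shift u) (shift v) (h (M \<bullet> shift X) (shift Y) q)"
    by (rule natural_transformationD(2)[OF h _ _ coend_preD(3)[OF x]])
      (intro dot_hom_hom id_hom shift_hom u v coend_preD(1)[OF x])+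
  ultimately show ?thesis
    using seq_homD[OF u] seq_homD[OF v]
    by (simp add: phi_map_class[OF h] phi_Act_class[OF Q u v] phi_Act_class[OF P u v] phi_map_pre[OF h]
        phi_Act_pre[OF Q u v])
qed

end

section \<open>Causal functions form the final fixpoint\<close>

text \<open>The recursion is on the index, with sequences and state as arguments, because the rest
  lives over \<open>M \<bullet> shift X\<close>. At index \<open>0\<close> only the first action is
  read, hence \<open>undefined\<close> for the rest; at \<open>Suc n\<close> the rest is consulted
  at index \<open>n\<close> alone, hence the ignored argument.\<close>

primrec coalg_behaviour ::
  "('o, 'm) cart_cat \<Rightarrow> ((nat \<Rightarrow> 'o) \<Rightarrow> (nat \<Rightarrow> 'o) \<Rightarrow> 'q \<Rightarrow> ('o \<times> 'm \<times> 'q) set) \<Rightarrow>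
   nat \<Rightarrow> (nat \<Rightarrow> 'o) \<Rightarrow> (nat \<Rightarrow> 'o) \<Rightarrow> 'q \<Rightarrow> 'm" where
  "coalg_behaviour C c 0 = (\<lambda>X Y q. causal_glue C X Y undefined (SOME x. x \<in> c X Y q) 0)"
| "coalg_behaviour C c (Suc n) =
     (\<lambda>X Y q. causal_glue C X Y (\<lambda>X Y q _. coalg_behaviour C c n X Y q) (SOME x. x \<in> c X Y q) (Suc n))"

lemma coalg_behaviour_eq:
  "coalg_behaviour C c n X Y q =
     causal_glue C X Y (\<lambda>X Y q n. coalg_behaviour C c n X Y q) (SOME x. x \<in> c X Y q) n"
  by (cases n; cases "SOME x. x \<in> c X Y q") simp_all

context cartesian_category
begin

text \<open>\<open>lst_map_carry\<close> with a continuation \<open>k\<close> and an output map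
  \<open>b\<close>: the shape in which it occurs whenever a glued causal function or a stream is
  acted upon.\<close>

lemma carry_act:
  assumes u: "u \<in> seq_hom C X' X" and p: "p \<in> Hom C (X 0) M"
    and k: "k \<in> Hom C (lst C (M \<bullet> shift X) n) B" and b: "b \<in> Hom C B B'"
  shows "lst_map C u (Suc n) \<Zsemi> (carry C p (shift X) n \<Zsemi> k) \<Zsemi> b =
    carry C (u 0 \<Zsemi> p) (shift X') n \<Zsemi> (lst_map C (Id C M \<odot> shift u) n \<Zsemi> k \<Zsemi> b)"
proof -
  note U = seq_homD[OF u] and P = HomD[OF p]
  have s: "shift X \<in> seq_obj C" "shift X' \<in> seq_obj C" using U by simp_all
  have up: "u 0 \<Zsemi> p \<in> Hom C (X' 0) M" using U P by (simp add: Hom_iff)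
  note D = HomD[OF carry_hom[OF p s(1)]] HomD[OF carry_hom[OF up s(2)]]
    HomD[OF lst_map_hom[OF dot_hom_hom[OF id_hom shift_hom[OF u]]], OF P(5)] HomD[OF k] HomD[OF b]
    HomD[OF lst_map_hom[OF u, of "Suc n"]]
  have "lst_map C u (Suc n) \<Zsemi> (carry C p (shift X) n \<Zsemi> k) \<Zsemi> b =
      lst_map C u (Suc n) \<Zsemi> carry C p (shift X) n \<Zsemi> k \<Zsemi> b"
    using D by (simp del: lst_map.simps lst.simps)
  also have "\<dots> = carry C (u 0 \<Zsemi> p) (shift X') n \<Zsemi> lst_map C (Id C M \<odot> shift u) n \<Zsemi> k \<Zsemi> b"
    unfolding lst_map_carry[OF u p] ..
  also have "\<dots> = carry C (u 0 \<Zsemi> p) (shift X') n \<Zsemi> (lst_map C (Id C M \<odot> shift u) n \<Zsemi> k \<Zsemi> b)"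
    using D by (simp del: lst_map.simps lst.simps)
  finally show ?thesis .
qed

text \<open>On one side of a slide \<open>r\<close> acts on the rest, on the other it belongs to the
  first action; naturality turns both into \<open>carry\<close> along
  \<open>f \<Zsemi> Pr1 C M (Y 0) \<Zsemi> r\<close>. Naturality is asked for one index below
  \<open>n\<close>, so that an induction on \<open>n\<close> can supply it.\<close>

lemma causal_glue_dinat:
  assumes XY: "X \<in> seq_obj C" "Y \<in> seq_obj C" and k: "\<And>m. n = Suc m \<Longrightarrow> natural_at C Q k m"
    and d: "(x, y) \<in> dinat C Q X Y"
  shows "causal_glue C X Y k x n = causal_glue C X Y k y n"
proof -
  from d obtain M N r f q where xy: "x = (M, f, Act Q (r \<odot> seq_id C (shift X)) (seq_id C (shift Y)) q)"
    "y = (N, f \<Zsemi> r \<boxtimes> Id C (Y 0), q)"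
    and r: "r \<in> Hom C M N" "f \<in> Hom C (X 0) (M \<otimes> Y 0)" "q \<in> El Q (N \<bullet> shift X) (shift Y)"
    by (rule dinatE)
  note R = HomD[OF r(1)] HomD[OF r(2)]
  show ?thesis
  proof (cases n)
    case 0
    then show ?thesis using R XY by (simp add: xy cross_def)
  next
    case (Suc m)
    have s: "shift X \<in> seq_obj C" "shift Y \<in> seq_obj C" using XY by simp_all
    have p: "f \<Zsemi> Pr1 C M (Y 0) \<in> Hom C (X 0) M"
      using R XY by (simp add: Hom_iff)
    have eq: "f \<Zsemi> r \<boxtimes> Id C (Y 0) \<Zsemi> Pr1 C N (Y 0) = f \<Zsemi> Pr1 C M (Y 0) \<Zsemi> r"
      using R XY by (simp add: cross_def)
    have q: "k (N \<bullet> shift X) (shift Y) q m \<in> Hom C (lst C (N \<bullet> shift X) m) (shift Y m)"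
      by (rule natural_atD(1)[OF k[OF Suc]]) (use R s r in simp_all)
    have "k (M \<bullet> shift X) (shift Y) (Act Q (r \<odot> seq_id C (shift X)) (seq_id C (shift Y)) q) m
      = carry C r (shift X) m \<Zsemi> k (N \<bullet> shift X) (shift Y) q m \<Zsemi> seq_id C (shift Y) m"
      unfolding carry_def
      by (rule natural_atD(2)[OF k[OF Suc] dot_hom_hom[OF r(1) seq_id_hom[OF s(1)]] seq_id_hom[OF s(2)] r(3)])
    then show ?thesis
      using HomD[OF q] HomD[OF carry_hom[OF p s(1), of m]] HomD[OF carry_hom[OF r(1) s(1), of m]]
      by (simp add: Suc xy eq carry_cmp[OF p r(1) s(1)])
  qed
qed

lemma causal_glue_hom:
  assumes XY: "X \<in> seq_obj C" "Y \<in> seq_obj C" and k: "\<And>m. n = Suc m \<Longrightarrow> natural_at C Q k m"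
    and x: "(M, f, q) \<in> coend_pre C Q X Y"
  shows "causal_glue C X Y k (M, f, q) n \<in> Hom C (lst C X n) (Y n)"
proof (cases n)
  case 0
  then show ?thesis using XY coend_preD[OF x] HomD[OF coend_preD(2)[OF x]] by (simp add: Hom_iff)
next
  case (Suc m)
  note D = coend_preD[OF x]
  have s: "shift X \<in> seq_obj C" "shift Y \<in> seq_obj C" using XY by simp_all
  have p: "f \<Zsemi> Pr1 C M (Y 0) \<in> Hom C (X 0) M"
    using HomD[OF D(2)] D XY by (simp add: Hom_iff)
  have "k (M \<bullet> shift X) (shift Y) q m \<in> Hom C (lst C (M \<bullet> shift X) m) (shift Y m)"
    by (rule natural_atD(1)[OF k[OF Suc]]) (use D s in simp_all)
  from cmp_hom[OF carry_hom[OF p s(1)] this] show ?thesis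
    by (simp add: Suc)
qed

lemma causal_glue_act:
  assumes u: "u \<in> seq_hom C X' X" and v: "v \<in> seq_hom C Y Y'"
    and k: "\<And>m. n = Suc m \<Longrightarrow> natural_at C Q k m"
    and x: "(M, f, q) \<in> coend_pre C Q X Y"
  shows "causal_glue C X' Y' k (M, u 0 \<Zsemi> f \<Zsemi> Id C M \<boxtimes> v 0, Act Q (Id C M \<odot> shift u) (shift v) q) n =
    lst_map C u n \<Zsemi> causal_glue C X Y k (M, f, q) n \<Zsemi> v n"
proof -
  note D = coend_preD[OF x] HomD[OF coend_preD(2)[OF x]] and U = seq_homD[OF u] and V = seq_homD[OF v]
  show ?thesis
  proof (cases n)
    case 0
    then show ?thesis using D U V by (simp add: cross_def)
  next
    case (Suc m)
    have s: "shift X \<in> seq_obj C" "shift Y \<in> seq_obj C" using U V by simp_all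
    have p: "f \<Zsemi> Pr1 C M (Y 0) \<in> Hom C (X 0) M"
      using D V by (simp add: Hom_iff)
    have eq: "u 0 \<Zsemi> f \<Zsemi> Id C M \<boxtimes> v 0 \<Zsemi> Pr1 C M (Y' 0) = u 0 \<Zsemi> (f \<Zsemi> Pr1 C M (Y 0))"
      using D U V by (simp add: cross_def)
    have kh: "k (M \<bullet> shift X) (shift Y) q m \<in> Hom C (lst C (M \<bullet> shift X) m) (Y (Suc m))"
      using natural_atD(1)[OF k[OF Suc], of "M \<bullet> shift X" "shift Y" q] D s by simp
    have vh: "v (Suc m) \<in> Hom C (Y (Suc m)) (Y' (Suc m))"
      using V by (simp add: Hom_iff)
    have "k (M \<bullet> shift X') (shift Y') (Act Q (Id C M \<odot> shift u) (shift v) q) m =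
      lst_map C (Id C M \<odot> shift u) m \<Zsemi> k (M \<bullet> shift X) (shift Y) q m \<Zsemi> shift v m"
      by (rule natural_atD(2)[OF k[OF Suc] _ _ D(3)]) (intro dot_hom_hom id_hom shift_hom u v D)+
    then show ?thesis
      unfolding Suc causal_glue_simps eq carry_act[OF u p kh vh] by simp
  qed
qed

section \<open>Causal functions as a fixpoint\<close>

lemma profunctor_causal: "profunctor C (causal_prof C)"
  unfolding profunctor_def
proof (intro conjI allI ballI; simp only: causal_prof_simps)
  fix X X' Y Y' u v f
  assume u: "u \<in> seq_hom C X' X" and v: "v \<in> seq_hom C Y Y'" and f: "f \<in> causal C X Y"
  note D = seq_homD[OF v] HomD[OF lst_map_hom[OF u]] causalD[OF f]
  show "(\<lambda>n. lst_map C u n \<Zsemi> f n \<Zsemi> v n) \<in> causal C X' Y'"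
    using D by (simp add: causal_def Hom_iff)
next
  fix X Y f assume "X \<in> seq_obj C" "Y \<in> seq_obj C" "f \<in> causal C X Y"
  then show "(\<lambda>n. lst_map C (seq_id C X) n \<Zsemi> f n \<Zsemi> seq_id C Y n) = f"
    using causalD[of f X Y] by simp
next
  fix X X' X'' Y Y' Y'' u u' v v' f
  assume u: "u \<in> seq_hom C X' X" "u' \<in> seq_hom C X'' X'" and v: "v \<in> seq_hom C Y Y'" "v' \<in> seq_hom C Y' Y''"
    and f: "f \<in> causal C X Y"
  note D = seq_homD[OF v(1)] seq_homD[OF v(2)] HomD[OF lst_map_hom[OF u(1)]] HomD[OF lst_map_hom[OF u(2)]]
    causalD[OF f]
  show "(\<lambda>n. lst_map C (seq_cmp C u' u) n \<Zsemi> f n \<Zsemi> seq_cmp C v v' n) =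
    (\<lambda>n. lst_map C u' n \<Zsemi> (lst_map C u n \<Zsemi> f n \<Zsemi> v n) \<Zsemi> v' n)"
    using D by (simp add: lst_map_cmp[OF u(2,1)])
qed

lemma natural_at_id: "natural_at C (causal_prof C) (\<lambda>_ _ f. f) n"
  by (simp add: natural_at_def causal_def)

lemma causal_glue_causal:
  assumes "natural_transformation C Q (causal_prof C) k" "X \<in> seq_obj C" "Y \<in> seq_obj C"
    and "(M, f, q) \<in> coend_pre C Q X Y"
  shows "causal_glue C X Y k (M, f, q) \<in> causal C X Y"
  using causal_glue_hom[OF assms(2,3) _ assms(4)] assms(1)
  by (simp add: causal_def natural_causal_iff)

lemma natural_causal_id: "natural_transformation C (causal_prof C) (causal_prof C) (\<lambda>_ _ f. f)"
  by (simp add: natural_causal_iff natural_at_id)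

lemma causal_coalg_pre:
  assumes "X \<in> seq_obj C" "f \<in> causal C X Y"
  shows "(X 0, tuple C (Id C (X 0)) (f 0), shift f) \<in> coend_pre C (causal_prof C) X Y"
proof -
  note D = causalD[OF assms(2)]
  have "lst C (X 0 \<bullet> shift X) n = lst C X n \<otimes> X (Suc n)" for n
    by simp
  then show ?thesis
    using assms D by (simp add: coend_pre_def causal_def Hom_iff del: dot_apply)
qed

lemma causal_glue_canonical:
  assumes "X \<in> seq_obj C" "f \<in> causal C X Y"
  shows "causal_glue C X Y (\<lambda>_ _ f. f) (X 0, tuple C (Id C (X 0)) (f 0), shift f) = f"
proof
  fix n
  show "causal_glue C X Y (\<lambda>_ _ f. f) (X 0, tuple C (Id C (X 0)) (f 0), shift f) n = f n"
    using causalD[OF assms(2)] assms(1) by (cases n) simp_all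
qed

text \<open>The given triple is one slide away from the canonical representative of its glued
  function: \<open>?f\<close> copies the input, and \<open>?r\<close> recomputes the memory from
  that copy.\<close>

lemma causal_coalg_glue:
  assumes XY: "X \<in> seq_obj C" "Y \<in> seq_obj C" and x: "(M, f, k) \<in> coend_pre C (causal_prof C) X Y"
  shows "causal_coalg C X Y (causal_glue C X Y (\<lambda>_ _ f. f) (M, f, k)) =
    coend_rel C (causal_prof C) X Y `` {(M, f, k)}"
proof -
  note D = coend_preD[OF x] HomD[OF coend_preD(2)[OF x]]
  let ?r = "f \<Zsemi> Pr1 C M (Y 0)" and ?f = "tuple C (Id C (X 0)) (f \<Zsemi> Pr2 C M (Y 0))"
  have s: "shift X \<in> seq_obj C" "shift Y \<in> seq_obj C" using XY by simp_all
  have r: "?r \<in> Hom C (X 0) M" and f: "?f \<in> Hom C (X 0) (X 0 \<otimes> Y 0)"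
    using D XY by (simp_all add: Hom_iff)
  have kD: "k \<in> causal C (M \<bullet> shift X) (shift Y)" using D by simp
  have "((X 0, ?f, Act (causal_prof C) (?r \<odot> seq_id C (shift X)) (seq_id C (shift Y)) k), (M, ?f \<Zsemi> ?r \<boxtimes> Id C (Y 0), k))
    \<in> dinat C (causal_prof C) X Y"
    unfolding dinat_def using r f D(3) by blast
  moreover have "?f \<Zsemi> ?r \<boxtimes> Id C (Y 0) = f"
    using D XY by simp
  moreover have "Act (causal_prof C) (?r \<odot> seq_id C (shift X)) (seq_id C (shift Y)) k =
      shift (causal_glue C X Y (\<lambda>_ _ f. f) (M, f, k))"
    using causalD[OF kD] HomD[OF carry_hom[OF r s(1)]]
    by (simp add: fun_eq_iff carry_def)
  ultimately have "((X 0, ?f, shift (causal_glue C X Y (\<lambda>_ _ f. f) (M, f, k))), (M, f, k)) \<in> dinat C (causal_prof C) X Y"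
    by metis
  from equiv_class_eq[OF equiv_coend_rel dinat_coend_rel[OF profunctor_causal XY this]]
  show ?thesis
    by (simp add: causal_coalg_def)
qed

lemma causal_glue_class:
  assumes h: "natural_transformation C Q (causal_prof C) h" and XY: "X \<in> seq_obj C" "Y \<in> seq_obj C"
    and xy: "(x, y) \<in> coend_rel C Q X Y"
  shows "causal_glue C X Y h x = causal_glue C X Y h y"
proof
  fix n
  have "natural_at C Q h m" for m
    using h by (simp add: natural_causal_iff)
  from causal_glue_dinat[OF XY this]
  show "causal_glue C X Y h x n = causal_glue C X Y h y n"
    by (rule coend_rel_invariant[OF xy])
qed

text \<open>Gluing is constant on classes and returns \<open>f\<close> from its canonical
  representative, which makes it a left inverse.\<close>

lemma causal_coalg_inj:
  assumes X: "X \<in> seq_obj C" and f: "f \<in> causal C X Y" and g: "g \<in> causal C X Y"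
    and eq: "causal_coalg C X Y f = causal_coalg C X Y g"
  shows "f = g"
proof -
  have Y: "Y \<in> seq_obj C" using causalD[OF f] by simp
  have "((X 0, tuple C (Id C (X 0)) (f 0), shift f), (X 0, tuple C (Id C (X 0)) (g 0), shift g))
    \<in> coend_rel C (causal_prof C) X Y"
    using eq eq_equiv_class[OF _ equiv_coend_rel causal_coalg_pre[OF X g]]
    by (simp add: causal_coalg_def)
  from causal_glue_class[OF natural_causal_id X Y this] show ?thesis
    using causal_glue_canonical[OF X] f g by simp
qed

text \<open>It turns the equation defining a coalgebra morphism, an equation of classes, into one
  between causal functions that can be read index by index.\<close>

lemma causal_coalg_eq_iff:
  assumes h: "natural_transformation C Q (causal_prof C) h" and XY: "X \<in> seq_obj C" "Y \<in> seq_obj C"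
    and x: "(M, f, q) \<in> coend_pre C Q X Y" and g: "g \<in> causal C X Y"
  shows "causal_coalg C X Y g = phi_map C (causal_prof C) h X Y (coend_rel C Q X Y `` {(M, f, q)}) \<longleftrightarrow>
    g = causal_glue C X Y h (M, f, q)"
proof -
  have eq: "causal_glue C X Y h (M, f, q) = causal_glue C X Y (\<lambda>_ _ f. f) (M, f, h (M \<bullet> shift X) (shift Y) q)"
    by (simp add: causal_glue_def)
  show ?thesis
    using causal_coalg_inj[OF XY(1) g causal_glue_causal[OF h XY x]]
      causal_coalg_glue[OF XY phi_map_pre[OF h XY x]] phi_map_class[OF h XY x] eq by auto
qed

lemma causal_coalg_natural: "natural_transformation C (causal_prof C) (phi C (causal_prof C)) (causal_coalg C)"
  unfolding natural_transformation_def
proof (intro conjI ballI allI)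
  fix X Y f assume "X \<in> seq_obj C" "Y \<in> seq_obj C" "f \<in> El (causal_prof C) X Y"
  then show "causal_coalg C X Y f \<in> El (phi C (causal_prof C)) X Y"
    unfolding causal_coalg_def by (intro phi_El_class causal_coalg_pre) simp_all
next
  fix X X' Y Y' u v f
  assume u: "u \<in> seq_hom C X' X" and v: "v \<in> seq_hom C Y Y'" and f: "f \<in> El (causal_prof C) X Y"
  let ?Q = "causal_prof C" and ?a = "(\<lambda>n. lst_map C u n \<Zsemi> f n \<Zsemi> v n)"
  have X: "X \<in> seq_obj C" and XY': "X' \<in> seq_obj C" "Y' \<in> seq_obj C" and f': "f \<in> causal C X Y"
    using seq_homD[OF u] seq_homD[OF v] f by simp_all
  note x = causal_coalg_pre[OF X f']
  \<comment> \<open>The action destroys canonicity, as the memory stays \<open>X 0\<close> while the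
    input is now \<open>X' 0\<close>. The class is therefore identified through its glued
    function.\<close>
  have "causal_glue C X' Y' (\<lambda>_ _ f. f) (X 0, u 0 \<Zsemi> tuple C (Id C (X 0)) (f 0) \<Zsemi> Id C (X 0) \<boxtimes> v 0,
      Act ?Q (Id C (X 0) \<odot> shift u) (shift v) (shift f)) = ?a"
    using causal_glue_act[OF u v natural_at_id x, unfolded causal_glue_canonical[OF X f']] by (rule ext)
  with causal_coalg_glue[OF XY' phi_Act_pre[OF profunctor_causal u v x]]
    phi_Act_class[OF profunctor_causal u v x]
  show "causal_coalg C X' Y' (Act ?Q u v f) = Act (phi C ?Q) u v (causal_coalg C X Y f)"
    by (simp only: causal_coalg_def causal_prof_simps)
qed

lemma causal_coalg_bij:
  assumes X: "X \<in> seq_obj C" and Y: "Y \<in> seq_obj C"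
  shows "bij_betw (causal_coalg C X Y) (causal C X Y) (El (phi C (causal_prof C)) X Y)"
  unfolding bij_betw_def
proof
  show "inj_on (causal_coalg C X Y) (causal C X Y)"
    using causal_coalg_inj[OF X] by (auto simp: inj_on_def)
  have "causal_coalg C X Y ` causal C X Y \<subseteq> El (phi C (causal_prof C)) X Y"
    using natural_transformationD(1)[OF causal_coalg_natural X Y] by auto
  moreover have "e \<in> causal_coalg C X Y ` causal C X Y" if "e \<in> El (phi C (causal_prof C)) X Y" for e
    using that causal_coalg_glue[OF X Y] causal_glue_causal[OF natural_causal_id X Y]
    by (elim phi_El_cases) (metis imageI)
  ultimately show "causal_coalg C X Y ` causal C X Y = El (phi C (causal_prof C)) X Y"
    by blast
qed

section \<open>Running a coalgebra\<close>

lemma coalgebra_rep: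
  assumes "natural_transformation C Q (phi C Q) c" and "X \<in> seq_obj C" "Y \<in> seq_obj C" "q \<in> El Q X Y"
  obtains M f q' where "(M, f, q') \<in> coend_pre C Q X Y" "c X Y q = coend_rel C Q X Y `` {(M, f, q')}"
    "(M, f, q') \<in> c X Y q"
  using natural_transformationD(1)[OF assms]
proof (rule phi_El_cases)
  fix M f q' assume x: "(M, f, q') \<in> coend_pre C Q X Y" and c: "c X Y q = coend_rel C Q X Y `` {(M, f, q')}"
  have "(M, f, q') \<in> c X Y q"
    unfolding c by (rule equiv_class_self[OF equiv_coend_rel x])
  with x c show ?thesis by (rule that)
qed

lemma coalg_behaviour_natural:
  assumes c: "coalgebra C Q c"
  shows "natural_at C Q (\<lambda>X Y q n. coalg_behaviour C c n X Y q) n"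
    and "\<lbrakk>X \<in> seq_obj C; Y \<in> seq_obj C; q \<in> El Q X Y; x \<in> c X Y q\<rbrakk> \<Longrightarrow>
      coalg_behaviour C c n X Y q = causal_glue C X Y (\<lambda>X Y q n. coalg_behaviour C c n X Y q) x n"
proof -
  let ?h = "\<lambda>X Y q n. coalg_behaviour C c n X Y q"
  have Q: "profunctor C Q" and nat: "natural_transformation C Q (phi C Q) c"
    using c by (simp_all add: coalgebra_def)
  \<comment> \<open>Independence of the chosen representative: the members of \<open>c X Y q\<close>
    are connected by slides, and gluing is invariant under these once the rest is natural one index
    lower.\<close>
  have rep: "?h X Y q n = causal_glue C X Y ?h x n"
    if prev: "\<And>m. n = Suc m \<Longrightarrow> natural_at C Q ?h m"
      and XY: "X \<in> seq_obj C" "Y \<in> seq_obj C" and q: "q \<in> El Q X Y" and x: "x \<in> c X Y q" for n X Y q x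
  proof -
    have "(SOME x. x \<in> c X Y q) \<in> c X Y q"
      using x by (rule someI)
    moreover obtain z where "c X Y q = coend_rel C Q X Y `` {z}"
      using natural_transformationD(1)[OF nat XY q] by (rule phi_El_cases) blast
    ultimately have "(SOME x. x \<in> c X Y q, x) \<in> coend_rel C Q X Y"
      using x equiv_coend_rel[of C Q X Y] by (auto simp: equiv_def dest: symD transD)
    from coend_rel_invariant[OF this, of "\<lambda>x. causal_glue C X Y ?h x n"] causal_glue_dinat[OF XY prev]
    show ?thesis
      using coalg_behaviour_eq[of C c n X Y q] by simp
  qed
  \<comment> \<open>By \<open>rep\<close>, the behaviour of \<open>Act Q u v q\<close> may be
    evaluated at the image of a representative of \<open>c X Y q\<close>, where it is given by
    \<open>causal_glue_act\<close>.\<close>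
  have step: "natural_at C Q ?h n" if prev: "\<And>m. n = Suc m \<Longrightarrow> natural_at C Q ?h m" for n
    unfolding natural_at_def
  proof (intro conjI ballI allI)
    fix X Y q assume XY: "X \<in> seq_obj C" "Y \<in> seq_obj C" and q: "q \<in> El Q X Y"
    from nat XY q obtain M f q' where x: "(M, f, q') \<in> coend_pre C Q X Y" "(M, f, q') \<in> c X Y q"
      by (rule coalgebra_rep)
    from rep[OF prev XY q x(2)] causal_glue_hom[OF XY prev x(1)]
    show "coalg_behaviour C c n X Y q \<in> Hom C (lst C X n) (Y n)"
      by simp
  next
    fix X X' Y Y' u v q
    assume u: "u \<in> seq_hom C X' X" and v: "v \<in> seq_hom C Y Y'" and q: "q \<in> El Q X Y"
    have XY: "X \<in> seq_obj C" "Y \<in> seq_obj C" and XY': "X' \<in> seq_obj C" "Y' \<in> seq_obj C"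
      using seq_homD[OF u] seq_homD[OF v] by simp_all
    from nat XY q obtain M f q' where x: "(M, f, q') \<in> coend_pre C Q X Y"
      "c X Y q = coend_rel C Q X Y `` {(M, f, q')}" and 1: "(M, f, q') \<in> c X Y q"
      by (rule coalgebra_rep)
    let ?x' = "(M, u 0 \<Zsemi> f \<Zsemi> Id C M \<boxtimes> v 0, Act Q (Id C M \<odot> shift u) (shift v) q')"
    have "c X' Y' (Act Q u v q) = coend_rel C Q X' Y' `` {?x'}"
      using natural_transformationD(2)[OF nat u v q] phi_Act_class[OF Q u v x(1)] x(2) by simp
    then have 2: "?x' \<in> c X' Y' (Act Q u v q)"
      using equiv_class_self[OF equiv_coend_rel phi_Act_pre[OF Q u v x(1)]] by simp
    show "coalg_behaviour C c n X' Y' (Act Q u v q) = lst_map C u n \<Zsemi> coalg_behaviour C c n X Y q \<Zsemi> v n"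
      using rep[OF prev XY q 1] rep[OF prev XY' profunctorD(1)[OF Q u v q] 2]
        causal_glue_act[OF u v prev x(1)] by metis
  qed
  have all: "natural_at C Q ?h n" for n
    by (induction n) (use step in auto)
  show "natural_at C Q ?h n" by (rule all)
  show "?h X Y q n = causal_glue C X Y ?h x n"
    if "X \<in> seq_obj C" "Y \<in> seq_obj C" "q \<in> El Q X Y" "x \<in> c X Y q"
    using rep[OF all that] .
qed

text \<open>In this form a morphism is a natural solution of a recursive equation:
  \<open>coalg_behaviour\<close> is a solution, and the equation determines each index from the one
  below.\<close>

lemma coalgebra_hom_causal_iff:
  assumes c: "coalgebra C Q c"
  shows "coalgebra_hom C Q c (causal_prof C) (causal_coalg C) h \<longleftrightarrow>
    natural_transformation C Q (causal_prof C) h \<and>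
    (\<forall>X \<in> seq_obj C. \<forall>Y \<in> seq_obj C. \<forall>q \<in> El Q X Y. \<forall>x \<in> c X Y q. h X Y q = causal_glue C X Y h x)"
proof -
  have nat: "natural_transformation C Q (phi C Q) c"
    using c by (simp add: coalgebra_def)
  have "causal_coalg C X Y (h X Y q) = phi_map C (causal_prof C) h X Y (c X Y q) \<longleftrightarrow>
      (\<forall>x \<in> c X Y q. h X Y q = causal_glue C X Y h x)"
    if h: "natural_transformation C Q (causal_prof C) h"
      and XY: "X \<in> seq_obj C" "Y \<in> seq_obj C" and q: "q \<in> El Q X Y" for X Y q
  proof -
    from nat XY q obtain M f q' where x: "(M, f, q') \<in> coend_pre C Q X Y"
      "c X Y q = coend_rel C Q X Y `` {(M, f, q')}" "(M, f, q') \<in> c X Y q"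
      by (rule coalgebra_rep)
    have "h X Y q \<in> causal C X Y"
      using natural_transformationD(1)[OF h XY q] by simp
    from causal_coalg_eq_iff[OF h XY x(1) this]
    have iff: "causal_coalg C X Y (h X Y q) = phi_map C (causal_prof C) h X Y (c X Y q) \<longleftrightarrow>
      h X Y q = causal_glue C X Y h (M, f, q')"
      by (simp only: x(2))
    note x(3)
    moreover have "causal_glue C X Y h (M, f, q') = causal_glue C X Y h y" if "y \<in> c X Y q" for y
      using causal_glue_class[OF h XY] that x(2) by auto
    ultimately show ?thesis
      unfolding iff by metis
  qed
  then show ?thesis
    unfolding coalgebra_hom_def by blast
qed

lemma final_fixpoint_causal: "final_fixpoint TYPE('q) C (causal_prof C) (causal_coalg C)"
  unfolding final_fixpoint_def
proof (intro conjI allI impI ballI)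
  show "coalgebra C (causal_prof C) (causal_coalg C)"
    by (simp add: coalgebra_def profunctor_causal causal_coalg_natural)
next
  fix X Y assume "X \<in> seq_obj C" "Y \<in> seq_obj C"
  then show "bij_betw (causal_coalg C X Y) (El (causal_prof C) X Y) (El (phi C (causal_prof C)) X Y)"
    using causal_coalg_bij by simp
next
  fix Q :: "('o, 'm, 'q) prof" and c assume c: "coalgebra C Q c"
  have hom: "coalgebra_hom C Q c (causal_prof C) (causal_coalg C) (\<lambda>X Y q n. coalg_behaviour C c n X Y q)"
    unfolding coalgebra_hom_causal_iff[OF c] natural_causal_iff
    using coalg_behaviour_natural[OF c] by (auto simp: fun_eq_iff)
  show "\<exists>h. coalgebra_hom C Q c (causal_prof C) (causal_coalg C) h"
    by (rule exI, rule hom)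
next
  fix Q :: "('o, 'm, 'q) prof" and c h h' X Y q
  assume c: "coalgebra C Q c" and h: "coalgebra_hom C Q c (causal_prof C) (causal_coalg C) h"
    and h': "coalgebra_hom C Q c (causal_prof C) (causal_coalg C) h'"
    and XY: "X \<in> seq_obj C" "Y \<in> seq_obj C" and q: "q \<in> El Q X Y"
  note H = h[unfolded coalgebra_hom_causal_iff[OF c]] and H' = h'[unfolded coalgebra_hom_causal_iff[OF c]]
  have nat: "natural_transformation C Q (phi C Q) c"
    using c by (simp add: coalgebra_def)
  \<comment> \<open>Sequences and state vary in the induction, because index \<open>Suc n\<close> at
    \<open>q\<close> is reduced to index \<open>n\<close> at the rest \<open>q'\<close> over
    \<open>M \<bullet> shift X\<close>.\<close>
  have "h X Y q n = h' X Y q n" for n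
    using XY q
  proof (induction n arbitrary: X Y q)
    case (0 X Y q)
    from nat 0 obtain M f q' where "(M, f, q') \<in> c X Y q"
      by (rule coalgebra_rep)
    then show ?case using H H' 0 by (metis causal_glue_simps(1))
  next
    case (Suc n X Y q)
    from nat Suc.prems obtain M f q' where x: "(M, f, q') \<in> coend_pre C Q X Y" "(M, f, q') \<in> c X Y q"
      by (rule coalgebra_rep)
    have "h (M \<bullet> shift X) (shift Y) q' n = h' (M \<bullet> shift X) (shift Y) q' n"
      by (rule Suc.IH) (intro seq_obj_intros coend_preD[OF x(1)] Suc.prems)+
    moreover have "h X Y q = causal_glue C X Y h (M, f, q')" "h' X Y q = causal_glue C X Y h' (M, f, q')"
      using H H' Suc.prems x(2) by blast+
    ultimately show ?case
      by (metis causal_glue_simps(2))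
  qed
  then show "h X Y q = h' X Y q" by (rule ext)
qed

end

section \<open>Transport of finality\<close>

text \<open>The recursion of \<open>causal_glue\<close>, written out for a raw stream.\<close>

fun stream_fun ::
  "('o, 'm) cart_cat \<Rightarrow> (nat \<Rightarrow> 'o) \<Rightarrow> (nat \<Rightarrow> 'o) \<Rightarrow> ('o, 'm) raw \<Rightarrow> nat \<Rightarrow> 'm" where
  "stream_fun C X Y s 0 = now s \<Zsemi>\<^bsub>C\<^esub> Pr2 C (mem s) (Y 0)"
| "stream_fun C X Y s (Suc n) = carry C (now s \<Zsemi>\<^bsub>C\<^esub> Pr1 C (mem s) (Y 0)) (shift X) n \<Zsemi>\<^bsub>C\<^esub>
     stream_fun C (mem s \<bullet>\<^bsub>C\<^esub> shift X) (shift Y) (later s) n"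

text \<open>The memory is the current input. Since the rest has source
  \<open>X 0 \<bullet> shift X\<close>, this is the whole history at every later step.\<close>

primcorec causal_stream :: "('o, 'm) cart_cat \<Rightarrow> (nat \<Rightarrow> 'o) \<Rightarrow> (nat \<Rightarrow> 'm) \<Rightarrow> ('o, 'm) raw" where
  "mem (causal_stream C X f) = X 0"
| "now (causal_stream C X f) = tuple C (Id C (X 0)) (f 0)"
| "later (causal_stream C X f) = causal_stream C (X 0 \<bullet>\<^bsub>C\<^esub> shift X) (shift f)"

text \<open>Only the first step is normalised. The rest is unchanged except that it first computes
  the old memory from the stored input.\<close>

definition stream_nf :: "('o, 'm) cart_cat \<Rightarrow> (nat \<Rightarrow> 'o) \<Rightarrow> (nat \<Rightarrow> 'o) \<Rightarrow> ('o, 'm) raw \<Rightarrow> ('o, 'm) raw" where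
  "stream_nf C X Y s = Raw (X 0) (tuple C (Id C (X 0)) (now s \<Zsemi>\<^bsub>C\<^esub> Pr2 C (mem s) (Y 0)))
     (precomp C ((now s \<Zsemi>\<^bsub>C\<^esub> Pr1 C (mem s) (Y 0)) \<boxtimes>\<^bsub>C\<^esub> Id C (X 1)) (later s))"

definition stream_class_fun ::
  "('o, 'm) cart_cat \<Rightarrow> (nat \<Rightarrow> 'o) \<Rightarrow> (nat \<Rightarrow> 'o) \<Rightarrow> ('o, 'm) raw set \<Rightarrow> nat \<Rightarrow> 'm" where
  "stream_class_fun C X Y c = stream_fun C X Y (SOME s. s \<in> c)"

lemma precomp_simps [simp]:
  "mem (precomp C u s) = mem s" "now (precomp C u s) = u \<Zsemi>\<^bsub>C\<^esub> now s" "later (precomp C u s) = later s"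
  by (simp_all add: precomp_def)

lemma stream_nf_simps [simp]:
  "mem (stream_nf C X Y s) = X 0"
  "now (stream_nf C X Y s) = tuple C (Id C (X 0)) (now s \<Zsemi>\<^bsub>C\<^esub> Pr2 C (mem s) (Y 0))"
  "later (stream_nf C X Y s) = precomp C ((now s \<Zsemi>\<^bsub>C\<^esub> Pr1 C (mem s) (Y 0)) \<boxtimes>\<^bsub>C\<^esub> Id C (X 1)) (later s)"
  by (simp_all add: stream_nf_def)

lemma wtD:
  assumes "wt C X Y s"
  shows "mem s \<in> Obj C" "now s \<in> Hom C (X 0) (mem s \<otimes>\<^bsub>C\<^esub> Y 0)"
    "wt C (mem s \<bullet>\<^bsub>C\<^esub> shift X) (shift Y) (later s)"
  using assms by (auto elim: wt.cases)

lemma equivclp_invariant: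
  assumes "equivclp r x y" and "\<And>x y. r x y \<Longrightarrow> g x = g y"
  shows "g x = g y"
  using assms(1) by (induction rule: equivclp_induct) (use assms(2) in auto)

context cartesian_category
begin

section \<open>Functoriality of the coend and transport of final coalgebras\<close>

lemma natural_transformation_comp:
  assumes h: "natural_transformation C Q P h" and k: "natural_transformation C P R k"
  shows "natural_transformation C Q R (\<lambda>X Y q. k X Y (h X Y q))"
proof (unfold natural_transformation_def, intro conjI ballI allI)
  fix X Y q assume "X \<in> seq_obj C" "Y \<in> seq_obj C" "q \<in> El Q X Y"
  then show "k X Y (h X Y q) \<in> El R X Y"
    by (intro natural_transformationD(1)[OF k] natural_transformationD(1)[OF h])
next
  fix X X' Y Y' u v q assume u: "u \<in> seq_hom C X' X" and v: "v \<in> seq_hom C Y Y'" and q: "q \<in> El Q X Y"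
  have "h X Y q \<in> El P X Y"
    using natural_transformationD(1)[OF h seq_homD(5)[OF u] seq_homD(4)[OF v] q] .
  from natural_transformationD(2)[OF k u v this] natural_transformationD(2)[OF h u v q]
  show "k X' Y' (h X' Y' (Act Q u v q)) = Act R u v (k X Y (h X Y q))"
    by simp
qed

lemma phi_map_comp:
  assumes h: "natural_transformation C Q P h" and k: "natural_transformation C P R k"
    and XY: "X \<in> seq_obj C" "Y \<in> seq_obj C" and e: "e \<in> El (phi C Q) X Y"
  shows "phi_map C R k X Y (phi_map C P h X Y e) = phi_map C R (\<lambda>X Y q. k X Y (h X Y q)) X Y e"
  using e
proof (rule phi_El_cases)
  fix M f q assume x: "(M, f, q) \<in> coend_pre C Q X Y" and e: "e = coend_rel C Q X Y `` {(M, f, q)}"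
  show ?thesis
    unfolding e phi_map_class[OF h XY x] phi_map_class[OF k XY phi_map_pre[OF h XY x]]
      phi_map_class[OF natural_transformation_comp[OF h k] XY x] ..
qed

text \<open>Families count only on the sets \<open>El\<close>, so agreement there has to suffice for
  \<open>phi_map\<close> as well.\<close>

lemma phi_map_cong:
  assumes h: "natural_transformation C Q P h" and k: "natural_transformation C Q P k"
    and XY: "X \<in> seq_obj C" "Y \<in> seq_obj C" and e: "e \<in> El (phi C Q) X Y"
    and eq: "\<And>X Y q. \<lbrakk>X \<in> seq_obj C; Y \<in> seq_obj C; q \<in> El Q X Y\<rbrakk> \<Longrightarrow> h X Y q = k X Y q"
  shows "phi_map C P h X Y e = phi_map C P k X Y e"
  using e
proof (rule phi_El_cases)
  fix M f q assume x: "(M, f, q) \<in> coend_pre C Q X Y" and e: "e = coend_rel C Q X Y `` {(M, f, q)}"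
  have "h (M \<bullet> shift X) (shift Y) q = k (M \<bullet> shift X) (shift Y) q"
    by (rule eq) (intro seq_obj_intros coend_preD[OF x] XY)+
  then show ?thesis
    unfolding e phi_map_class[OF h XY x] phi_map_class[OF k XY x] by simp
qed

lemma natural_transformation_inverse:
  assumes P: "profunctor C P" and h: "natural_transformation C P R h"
    and bij: "\<And>X Y. \<lbrakk>X \<in> seq_obj C; Y \<in> seq_obj C\<rbrakk> \<Longrightarrow> bij_betw (h X Y) (El P X Y) (El R X Y)"
  shows "natural_transformation C R P (\<lambda>X Y. inv_into (El P X Y) (h X Y))"
proof (unfold natural_transformation_def, intro conjI ballI allI)
  fix X Y q assume "X \<in> seq_obj C" "Y \<in> seq_obj C" "q \<in> El R X Y"
  then show "inv_into (El P X Y) (h X Y) q \<in> El P X Y"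
    using bij_betw_imp_surj_on[OF bij] inv_into_into[of q "h X Y" "El P X Y"] by simp
next
  fix X X' Y Y' u v q assume u: "u \<in> seq_hom C X' X" and v: "v \<in> seq_hom C Y Y'" and q: "q \<in> El R X Y"
  have XY: "X \<in> seq_obj C" "Y \<in> seq_obj C" and XY': "X' \<in> seq_obj C" "Y' \<in> seq_obj C"
    using seq_homD[OF u] seq_homD[OF v] by simp_all
  obtain p where p: "p \<in> El P X Y" "q = h X Y p"
    using bij_betw_imp_surj_on[OF bij[OF XY]] q by blast
  have "inv_into (El P X Y) (h X Y) q = p"
    using bij_betw_inv_into_left[OF bij[OF XY] p(1)] p(2) by simp
  moreover have "inv_into (El P X' Y') (h X' Y') (Act R u v q) = Act P u v p"
    using bij_betw_inv_into_left[OF bij[OF XY'] profunctorD(1)[OF P u v p(1)]]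
      natural_transformationD(2)[OF h u v p(1)] p(2) by simp
  ultimately show "inv_into (El P X' Y') (h X' Y') (Act R u v q) = Act P u v (inv_into (El P X Y) (h X Y) q)"
    by simp
qed

text \<open>\<open>phi_map\<close> is functorial, so the inverse of the bijection \<open>h\<close>
  gives a left inverse.\<close>

lemma phi_map_inj:
  assumes P: "profunctor C P" and h: "natural_transformation C P R h"
    and bij: "\<And>X Y. \<lbrakk>X \<in> seq_obj C; Y \<in> seq_obj C\<rbrakk> \<Longrightarrow> bij_betw (h X Y) (El P X Y) (El R X Y)"
    and XY: "X \<in> seq_obj C" "Y \<in> seq_obj C"
  shows "inj_on (phi_map C R h X Y) (El (phi C P) X Y)"
proof (rule inj_on_inverseI)
  let ?g = "\<lambda>X Y. inv_into (El P X Y) (h X Y)"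
  fix e assume e: "e \<in> El (phi C P) X Y"
  have id: "natural_transformation C P P (\<lambda>_ _ q. q)"
    by (simp add: natural_transformation_def)
  note g = natural_transformation_inverse[OF P h bij]
  have "phi_map C P ?g X Y (phi_map C R h X Y e) = phi_map C P (\<lambda>X Y q. ?g X Y (h X Y q)) X Y e"
    by (rule phi_map_comp[OF h g XY e])
  also have "\<dots> = phi_map C P (\<lambda>_ _ q. q) X Y e"
    by (rule phi_map_cong[OF natural_transformation_comp[OF h g] id XY e])
      (simp_all add: bij_betw_inv_into_left[OF bij])
  also have "\<dots> = e"
    using e by (rule phi_El_cases) (use phi_map_class[OF id XY] in auto)
  finally show "phi_map C P ?g X Y (phi_map C R h X Y e) = e" .
qed

text \<open>Naturality and bijectivity of \<open>d\<close> are conclusions: they follow from those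
  of \<open>d'\<close>, because \<open>phi_map C R h\<close> is injective and relates
  \<open>d\<close> to \<open>d'\<close>. This matters for streams, whose coalgebra is thereby
  handled by its comparison with causal functions alone.\<close>

lemma final_fixpoint_transfer:
  assumes fin: "final_fixpoint TYPE('q) C R d'" and P: "profunctor C P"
    and h: "natural_transformation C P R h"
    and bij: "\<And>X Y. \<lbrakk>X \<in> seq_obj C; Y \<in> seq_obj C\<rbrakk> \<Longrightarrow> bij_betw (h X Y) (El P X Y) (El R X Y)"
    and d_in: "\<And>X Y p. \<lbrakk>X \<in> seq_obj C; Y \<in> seq_obj C; p \<in> El P X Y\<rbrakk> \<Longrightarrow> d X Y p \<in> El (phi C P) X Y"
    and d_h: "\<And>X Y p. \<lbrakk>X \<in> seq_obj C; Y \<in> seq_obj C; p \<in> El P X Y\<rbrakk> \<Longrightarrow>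
      d' X Y (h X Y p) = phi_map C R h X Y (d X Y p)"
  shows "final_fixpoint TYPE('q) C P d"
proof -
  let ?g = "\<lambda>X Y. inv_into (El P X Y) (h X Y)"
  have R: "profunctor C R" and d': "natural_transformation C R (phi C R) d'"
    and d'_bij: "\<And>X Y. \<lbrakk>X \<in> seq_obj C; Y \<in> seq_obj C\<rbrakk> \<Longrightarrow> bij_betw (d' X Y) (El R X Y) (El (phi C R) X Y)"
    using fin by (auto simp: final_fixpoint_def coalgebra_def)
  have ex: "\<exists>k. coalgebra_hom C Q c R d' k" if "coalgebra C Q c" for Q :: "('o, 'm, 'q) prof" and c
    using fin that unfolding final_fixpoint_def by blast
  have unique: "k X Y q = k' X Y q"
    if "coalgebra C Q c" "coalgebra_hom C Q c R d' k" "coalgebra_hom C Q c R d' k'"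
      "X \<in> seq_obj C" "Y \<in> seq_obj C" "q \<in> El Q X Y" for Q :: "('o, 'm, 'q) prof" and c k k' X Y q
    using fin that unfolding final_fixpoint_def by blast
  note g = natural_transformation_inverse[OF P h bij]
  have inj: "e = e'" if XY: "X \<in> seq_obj C" "Y \<in> seq_obj C"
    and "phi_map C R h X Y e = phi_map C R h X Y e'" "e \<in> El (phi C P) X Y" "e' \<in> El (phi C P) X Y" for X Y e e'
    using inj_onD[OF phi_map_inj[OF P h _ XY]] bij that(3-5) by blast
  have natural: "natural_transformation C P (phi C P) d"
  proof (unfold natural_transformation_def, intro conjI ballI allI)
    fix X X' Y Y' u v p assume u: "u \<in> seq_hom C X' X" and v: "v \<in> seq_hom C Y Y'" and p: "p \<in> El P X Y"
    have XY: "X \<in> seq_obj C" "Y \<in> seq_obj C" and XY': "X' \<in> seq_obj C" "Y' \<in> seq_obj C"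
      using seq_homD[OF u] seq_homD[OF v] by simp_all
    note up = profunctorD(1)[OF P u v p]
    have "phi_map C R h X' Y' (d X' Y' (Act P u v p)) = d' X' Y' (h X' Y' (Act P u v p))"
      by (rule d_h[OF XY' up, symmetric])
    also have "\<dots> = Act (phi C R) u v (d' X Y (h X Y p))"
      unfolding natural_transformationD(2)[OF h u v p]
      by (rule natural_transformationD(2)[OF d' u v natural_transformationD(1)[OF h XY p]])
    also have "\<dots> = phi_map C R h X' Y' (Act (phi C P) u v (d X Y p))"
      unfolding d_h[OF XY p] by (rule phi_map_natural[OF P R h u v d_in[OF XY p], symmetric])
    finally show "d X' Y' (Act P u v p) = Act (phi C P) u v (d X Y p)"
    proof (rule inj[OF XY'])
      show "Act (phi C P) u v (d X Y p) \<in> El (phi C P) X' Y'"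
        using d_in[OF XY p]
        by (rule phi_El_cases) (simp add: phi_Act_class[OF P u v] phi_Act_pre[OF P u v] phi_El_class)
    qed (rule d_in[OF XY' up])
  qed (rule d_in)
  have d_bij: "bij_betw (d X Y) (El P X Y) (El (phi C P) X Y)" if XY: "X \<in> seq_obj C" "Y \<in> seq_obj C" for X Y
  proof (rule bij_betw_imageI)
    show "inj_on (d X Y) (El P X Y)"
    proof (rule inj_onI)
      fix p q assume p: "p \<in> El P X Y" and q: "q \<in> El P X Y" and "d X Y p = d X Y q"
      then have "d' X Y (h X Y p) = d' X Y (h X Y q)"
        using d_h[OF XY] by simp
      then have "h X Y p = h X Y q"
        using inj_onD[OF bij_betw_imp_inj_on[OF d'_bij[OF XY]]] natural_transformationD(1)[OF h XY] p q by blast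
      then show "p = q"
        using inj_onD[OF bij_betw_imp_inj_on[OF bij[OF XY]]] p q by blast
    qed
    have "e \<in> d X Y ` El P X Y" if e: "e \<in> El (phi C P) X Y" for e
    proof -
      obtain r where r: "r \<in> El R X Y" "phi_map C R h X Y e = d' X Y r"
        using bij_betw_imp_surj_on[OF d'_bij[OF XY]] phi_map_El[OF h XY e] by blast
      obtain p where p: "p \<in> El P X Y" "r = h X Y p"
        using bij_betw_imp_surj_on[OF bij[OF XY]] r by blast
      have "phi_map C R h X Y e = phi_map C R h X Y (d X Y p)"
        using d_h[OF XY p(1)] r p by simp
      then have "e = d X Y p"
        by (rule inj[OF XY]) (use e d_in[OF XY p(1)] in auto)
      then show ?thesis using p by blast
    qed
    then show "d X Y ` El P X Y = El (phi C P) X Y"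
      using d_in[OF XY] by blast
  qed
  \<comment> \<open>Composition with \<open>h\<close> loses no information: injectivity of
    \<open>phi_map C R h\<close> recovers the equation over \<open>P\<close> from the one over
    \<open>R\<close>.\<close>
  have hom_iff: "coalgebra_hom C Q c P d k \<longleftrightarrow> coalgebra_hom C Q c R d' (\<lambda>X Y q. h X Y (k X Y q))"
    if k: "natural_transformation C Q P k" and c: "coalgebra C Q c" for Q :: "('o, 'm, 'q) prof" and c k
  proof -
    have "d X Y (k X Y q) = phi_map C P k X Y (c X Y q) \<longleftrightarrow>
        d' X Y (h X Y (k X Y q)) = phi_map C R (\<lambda>X Y q. h X Y (k X Y q)) X Y (c X Y q)"
      if XY: "X \<in> seq_obj C" "Y \<in> seq_obj C" and q: "q \<in> El Q X Y" for X Y q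
    proof -
      have cq: "c X Y q \<in> El (phi C Q) X Y"
        using c natural_transformationD(1)[OF _ XY q] by (auto simp: coalgebra_def)
      note kq = natural_transformationD(1)[OF k XY q]
      have "d X Y (k X Y q) = phi_map C P k X Y (c X Y q)"
        if "phi_map C R h X Y (d X Y (k X Y q)) = phi_map C R h X Y (phi_map C P k X Y (c X Y q))"
        using that d_in[OF XY kq] phi_map_El[OF k XY cq] by (rule inj[OF XY])
      then show ?thesis
        unfolding d_h[OF XY kq] phi_map_comp[OF k h XY cq, symmetric] by metis
    qed
    then show ?thesis
      unfolding coalgebra_hom_def using k natural_transformation_comp[OF k h] by blast
  qed
  show ?thesis
    unfolding final_fixpoint_def
  proof (intro conjI allI impI ballI)
    show "coalgebra C P d"
      using P natural by (simp add: coalgebra_def)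
  next
    fix X Y assume "X \<in> seq_obj C" "Y \<in> seq_obj C"
    then show "bij_betw (d X Y) (El P X Y) (El (phi C P) X Y)" by (rule d_bij)
  next
    fix Q :: "('o, 'm, 'q) prof" and c assume c: "coalgebra C Q c"
    obtain k where k: "coalgebra_hom C Q c R d' k"
      using ex[OF c] by blast
    then have k_nat: "natural_transformation C Q R k"
      by (simp add: coalgebra_hom_def)
    let ?k = "\<lambda>X Y q. ?g X Y (k X Y q)"
    note gk = natural_transformation_comp[OF k_nat g]
    have eq: "h X Y (?k X Y q) = k X Y q" if "X \<in> seq_obj C" "Y \<in> seq_obj C" "q \<in> El Q X Y" for X Y q
      using bij_betw_inv_into_right[OF bij[OF that(1,2)]] natural_transformationD(1)[OF k_nat that] by simp
    \<comment> \<open>This family agrees with \<open>k\<close> only on the sets \<open>El\<close>,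
      so the morphism equation is carried over by \<open>phi_map_cong\<close>.\<close>
    have "coalgebra_hom C Q c R d' (\<lambda>X Y q. h X Y (?k X Y q))"
      unfolding coalgebra_hom_def
    proof (intro conjI ballI)
      show hgk: "natural_transformation C Q R (\<lambda>X Y q. h X Y (?k X Y q))"
        by (rule natural_transformation_comp[OF gk h])
      fix X Y q assume XYq: "X \<in> seq_obj C" "Y \<in> seq_obj C" "q \<in> El Q X Y"
      have cq: "c X Y q \<in> El (phi C Q) X Y"
        using c natural_transformationD(1)[OF _ XYq] by (auto simp: coalgebra_def)
      have "phi_map C R (\<lambda>X Y q. h X Y (?k X Y q)) X Y (c X Y q) = phi_map C R k X Y (c X Y q)"
        by (rule phi_map_cong[OF hgk k_nat XYq(1,2) cq eq])
      then show "d' X Y (h X Y (?k X Y q)) = phi_map C R (\<lambda>X Y q. h X Y (?k X Y q)) X Y (c X Y q)"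
        using k XYq eq[OF XYq] by (simp add: coalgebra_hom_def)
    qed
    with hom_iff[OF gk c] have hom: "coalgebra_hom C Q c P d ?k" by blast
    show "\<exists>k. coalgebra_hom C Q c P d k"
      by (rule exI, rule hom)
  next
    fix Q :: "('o, 'm, 'q) prof" and c k k' X Y q
    assume c: "coalgebra C Q c" and k: "coalgebra_hom C Q c P d k" and k': "coalgebra_hom C Q c P d k'"
      and XYq: "X \<in> seq_obj C" "Y \<in> seq_obj C" "q \<in> El Q X Y"
    have nat: "natural_transformation C Q P k" "natural_transformation C Q P k'"
      using k k' by (simp_all add: coalgebra_hom_def)
    have "h X Y (k X Y q) = h X Y (k' X Y q)"
      using unique[OF c _ _ XYq] hom_iff[OF nat(1) c] hom_iff[OF nat(2) c] k k' by blast
    then show "k X Y q = k' X Y q"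
      using inj_onD[OF bij_betw_imp_inj_on[OF bij[OF XYq(1,2)]]] natural_transformationD(1)[OF nat(1) XYq]
        natural_transformationD(1)[OF nat(2) XYq] by blast
  qed
qed

end

section \<open>Streams and their causal functions\<close>

context cartesian_category
begin

lemmas wt_now = wtD HomD[OF wtD(2)]

lemma now_Pr_hom:
  assumes "wt C X Y s" "Y \<in> seq_obj C"
  shows "now s \<Zsemi> Pr1 C (mem s) (Y 0) \<in> Hom C (X 0) (mem s)"
    and "now s \<Zsemi> Pr2 C (mem s) (Y 0) \<in> Hom C (X 0) (Y 0)"
  using wt_now[OF assms(1)] assms(2) by (simp_all add: Hom_iff)

lemma stream_fun_hom:
  assumes "wt C X Y s" "X \<in> seq_obj C" "Y \<in> seq_obj C"
  shows "stream_fun C X Y s n \<in> Hom C (lst C X n) (Y n)"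
  using assms
proof (induction n arbitrary: X Y s)
  case 0
  then show ?case using now_Pr_hom by simp
next
  case (Suc n)
  have "stream_fun C (mem s \<bullet> shift X) (shift Y) (later s) n \<in> Hom C (lst C (mem s \<bullet> shift X) n) (shift Y n)"
    by (rule Suc.IH) (intro wtD[OF Suc.prems(1)] seq_obj_intros Suc.prems)+
  from cmp_hom[OF carry_hom[OF now_Pr_hom(1)[OF Suc.prems(1,3)] seq_obj_intros(1)[OF Suc.prems(2)]] this]
  show ?case by simp
qed

lemma stream_fun_causal:
  "\<lbrakk>wt C X Y s; X \<in> seq_obj C; Y \<in> seq_obj C\<rbrakk> \<Longrightarrow> stream_fun C X Y s \<in> causal C X Y"
  by (simp add: causal_def stream_fun_hom)

lemma wt_precomp:
  assumes r: "r \<in> Hom C M N" and s: "wt C (N \<bullet> W) Y s" and W: "W \<in> seq_obj C"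
  shows "wt C (M \<bullet> W) Y (precomp C (r \<boxtimes> Id C (W 0)) s)"
  by (rule wt.intros) (use wt_now[OF s] HomD[OF r] W in \<open>simp_all add: Hom_iff\<close>)

text \<open>This is the effect of a slide on the rest. At positive indices it is
  \<open>carry_act\<close> for \<open>r \<odot> seq_id C W\<close>, which is the identity on all
  later inputs.\<close>

lemma stream_fun_precomp:
  assumes r: "r \<in> Hom C M N" and s: "wt C (N \<bullet> W) Y s" and W: "W \<in> seq_obj C" and Y: "Y \<in> seq_obj C"
  shows "stream_fun C (M \<bullet> W) Y (precomp C (r \<boxtimes> Id C (W 0)) s) n = carry C r W n \<Zsemi> stream_fun C (N \<bullet> W) Y s n"
proof -
  note D = wt_now[OF s] HomD[OF r]
  show ?thesis
  proof (cases n)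
    case 0
    then show ?thesis using D W Y by (simp add: carry_def)
  next
    case (Suc m)
    let ?p = "now s \<Zsemi> Pr1 C (mem s) (Y 0)" and ?k = "stream_fun C (mem s \<bullet> shift W) (shift Y) (later s) m"
    have s': "shift W \<in> seq_obj C" "shift Y \<in> seq_obj C" "mem s \<bullet> shift W \<in> seq_obj C"
      using W Y D by simp_all
    have k: "?k \<in> Hom C (lst C (mem s \<bullet> shift W) m) (Y (Suc m))"
      using stream_fun_hom[of "mem s \<bullet> shift W" "shift Y" "later s" m] D(3) s' by simp
    have u: "r \<odot> seq_id C W \<in> seq_hom C (M \<bullet> W) (N \<bullet> W)"
      by (rule dot_hom_hom[OF r seq_id_hom[OF W]])
    have YI: "Id C (Y (Suc m)) \<in> Hom C (Y (Suc m)) (Y (Suc m))"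
      using Y by (simp add: id_hom)
    have id: "lst_map C (Id C (mem s) \<odot> shift (r \<odot> seq_id C W)) m = Id C (lst C (mem s \<bullet> shift W) m)"
      using D s' by simp
    have eq: "(r \<odot> seq_id C W) 0 \<Zsemi> ?p = r \<boxtimes> Id C (W 0) \<Zsemi> now s \<Zsemi> Pr1 C (mem s) (Y 0)"
      using D W Y by simp
    have h: "r \<boxtimes> Id C (W 0) \<Zsemi> now s \<Zsemi> Pr1 C (mem s) (Y 0) \<in> Hom C (M \<otimes> W 0) (mem s)"
      using D W Y by (simp add: Hom_iff)
    show ?thesis
      using carry_act[OF u now_Pr_hom(1)[OF s Y] k[folded shift_dot[of C N W]] YI]
        HomD[OF k] HomD[OF carry_hom[OF now_Pr_hom(1)[OF s Y] s'(1), of m]] HomD[OF carry_hom[OF h s'(1), of m]]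
        HomD[OF lst_map_hom[OF u, of n]] D Y s'
      by (simp only: id eq shift_dot dot_apply Suc lst_dot_dot stream_fun.simps precomp_simps carry_def[of C r W] Id_Cmp Cmp_Id Cmp_simps)
  qed
qed

lemma wt_stream_nf:
  assumes s: "wt C X Y s" and XY: "X \<in> seq_obj C" "Y \<in> seq_obj C"
  shows "wt C X Y (stream_nf C X Y s)"
proof (rule wt.intros)
  show "mem (stream_nf C X Y s) \<in> Obj C" using XY by simp
  show "now (stream_nf C X Y s) \<in> Hom C (X 0) (mem (stream_nf C X Y s) \<otimes> Y 0)"
    using HomD[OF now_Pr_hom(2)[OF s XY(2)]] XY by (simp add: Hom_iff)
  show "wt C (mem (stream_nf C X Y s) \<bullet> shift X) (shift Y) (later (stream_nf C X Y s))"
    using wt_precomp[OF now_Pr_hom(1)[OF s XY(2)] wtD(3)[OF s]] XY by simp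
qed

text \<open>The point of normal forms: rests of arbitrary streams may start from different memories,
  so equality of causal functions cannot be passed on to them. Here the memory is the input, and it
  can.\<close>

lemma stream_fun_later_nf:
  assumes s: "wt C X Y s" and XY: "X \<in> seq_obj C" "Y \<in> seq_obj C"
  shows "stream_fun C (X 0 \<bullet> shift X) (shift Y) (later (stream_nf C X Y s)) n = stream_fun C X Y s (Suc n)"
  using stream_fun_precomp[OF now_Pr_hom(1)[OF s XY(2)] wtD(3)[OF s]] XY by simp

section \<open>Equivalence of streams and equality of causal functions\<close>

text \<open>Output \<open>n\<close> sees only finitely many unfoldings of the coinductive relation,
  so induction on \<open>n\<close> applies. Each unfolding is a chain of slides, and the output is
  constant along a single slide.\<close>

lemma streq_imp_stream_fun_eq:
  assumes "streq C X Y s t" "X \<in> seq_obj C" "Y \<in> seq_obj C"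
  shows "stream_fun C X Y s n = stream_fun C X Y t n"
  using assms
proof (induction n arbitrary: X Y s t)
  case (0 X Y s t)
  from 0(1) show ?case
  proof cases
    case 1
    from this(3) show ?thesis
    proof (rule equivclp_invariant)
      fix f g assume a: "wt C X Y f \<and> wt C X Y g \<and>
        (\<exists>r\<in>Hom C (mem g) (mem f). now f = now g \<Zsemi> r \<boxtimes> Id C (Y 0) \<and>
          streq C (mem g \<bullet> shift X) (shift Y) (precomp C (r \<boxtimes> Id C (X 1)) (later f)) (later g))"
      then obtain r where r: "r \<in> Hom C (mem g) (mem f)" "now f = now g \<Zsemi> r \<boxtimes> Id C (Y 0)" by blast
      have "wt C X Y g" using a by blast
      with r HomD[OF r(1)] HomD[OF wtD(2)[OF this]] 0
      show "stream_fun C X Y f 0 = stream_fun C X Y g 0"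
        by (simp add: cross_def)
    qed
  qed
next
  case (Suc n X Y s t)
  from Suc(2) show ?case
  proof cases
    case 1
    from this(3) show ?thesis
    proof (rule equivclp_invariant)
      fix f g assume a: "wt C X Y f \<and> wt C X Y g \<and>
        (\<exists>r\<in>Hom C (mem g) (mem f). now f = now g \<Zsemi> r \<boxtimes> Id C (Y 0) \<and>
          streq C (mem g \<bullet> shift X) (shift Y) (precomp C (r \<boxtimes> Id C (X 1)) (later f)) (later g))"
      then obtain r where r: "r \<in> Hom C (mem g) (mem f)" "now f = now g \<Zsemi> r \<boxtimes> Id C (Y 0)"
        and eq: "streq C (mem g \<bullet> shift X) (shift Y) (precomp C (r \<boxtimes> Id C (X 1)) (later f)) (later g)" by blast
      have f: "wt C X Y f" and g: "wt C X Y g" using a by blast+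
      have s: "shift X \<in> seq_obj C" "shift Y \<in> seq_obj C" "mem g \<bullet> shift X \<in> seq_obj C" "mem f \<bullet> shift X \<in> seq_obj C"
        using Suc.prems HomD[OF r(1)] by simp_all
      let ?q = "now g \<Zsemi> Pr1 C (mem g) (Y 0)" and ?k = "stream_fun C (mem f \<bullet> shift X) (shift Y) (later f) n"
      note q = now_Pr_hom(1)[OF g Suc.prems(3)]
      have p: "now f \<Zsemi> Pr1 C (mem f) (Y 0) = ?q \<Zsemi> r"
        using r HomD[OF r(1)] HomD[OF wtD(2)[OF g]] Suc.prems by (simp add: cross_def)
      note D = HomD[OF carry_hom[OF q s(1), of n]] HomD[OF carry_hom[OF r(1) s(1), of n]]
        HomD[OF stream_fun_hom[OF wtD(3)[OF f] s(4,2), of n]]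
      \<comment> \<open>\<open>carry_cmp\<close> separates \<open>r\<close> from the memory of
        \<open>g\<close>, and \<open>stream_fun_precomp\<close> absorbs it into the rest of
        \<open>f\<close>, where the induction hypothesis applies.\<close>
      have "stream_fun C X Y f (Suc n) = carry C ?q (shift X) n \<Zsemi> (carry C r (shift X) n \<Zsemi> ?k)"
        using D by (simp add: p carry_cmp[OF q r(1) s(1)])
      also have "carry C r (shift X) n \<Zsemi> ?k =
          stream_fun C (mem g \<bullet> shift X) (shift Y) (precomp C (r \<boxtimes> Id C (X 1)) (later f)) n"
        using stream_fun_precomp[OF r(1) wtD(3)[OF f] s(1,2)] by simp
      also have "\<dots> = stream_fun C (mem g \<bullet> shift X) (shift Y) (later g) n"
        by (rule Suc.IH[OF eq s(3,2)])
      finally show "stream_fun C X Y f (Suc n) = stream_fun C X Y g (Suc n)"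
        by (simp only: stream_fun.simps)
    qed
  qed
qed

text \<open>A stream is related to its normal form by sliding all of its memory except for the input, and
  normal forms of streams with the same causal function differ only in their rests, which again
  have the same causal function.\<close>

lemma stream_fun_eq_imp_streq:
  assumes "wt C X Y s" "wt C X Y t" "X \<in> seq_obj C" "Y \<in> seq_obj C"
    and "stream_fun C X Y s = stream_fun C X Y t"
  shows "streq C X Y s t"
proof -
  define E where "E X Y s t \<longleftrightarrow> X \<in> seq_obj C \<and> Y \<in> seq_obj C \<and> wt C X Y s \<and> wt C X Y t \<and>
    stream_fun C X Y s = stream_fun C X Y t" for X Y s t
  \<comment> \<open>One generating slide, with the rests compared by the candidate \<open>E\<close>
    or by \<open>streq\<close>: the shape that coinduction for \<open>streq\<close> asks
    for.\<close>
  define S where "S X Y f g \<longleftrightarrow> wt C X Y f \<and> wt C X Y g \<and>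
    (\<exists>r\<in>Hom C (mem g) (mem f). now f = now g \<Zsemi> r \<boxtimes> Id C (Y 0) \<and>
      (E (mem g \<bullet> shift X) (shift Y) (precomp C (r \<boxtimes> Id C (X 1)) (later f)) (later g) \<or>
       streq C (mem g \<bullet> shift X) (shift Y) (precomp C (r \<boxtimes> Id C (X 1)) (later f)) (later g)))" for X Y f g
  have nf: "S X Y s (stream_nf C X Y s)"
    if s: "wt C X Y s" and XY: "X \<in> seq_obj C" "Y \<in> seq_obj C" for X Y s
  proof -
    let ?r = "now s \<Zsemi> Pr1 C (mem s) (Y 0)"
    note D = HomD[OF wtD(2)[OF s]] wtD(1)[OF s] HomD[OF now_Pr_hom(1)[OF s XY(2)]] HomD[OF now_Pr_hom(2)[OF s XY(2)]]
    note w = wt_stream_nf[OF s XY]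
    have "now s = now (stream_nf C X Y s) \<Zsemi> ?r \<boxtimes> Id C (Y 0)"
      using D XY by simp
    moreover have "precomp C (?r \<boxtimes> Id C (X 1)) (later s) = later (stream_nf C X Y s)"
      by simp
    moreover have "E (X 0 \<bullet> shift X) (shift Y) (later (stream_nf C X Y s)) (later (stream_nf C X Y s))"
      using wtD(3)[OF w] XY by (simp add: E_def del: stream_nf_simps(3))
    ultimately show ?thesis
      unfolding S_def using s w now_Pr_hom(1)[OF s XY(2)] by (metis stream_nf_simps(1))
  qed
  have nf_nf: "S X Y (stream_nf C X Y s) (stream_nf C X Y t)" if "E X Y s t" for X Y s t
  proof -
    have XY: "X \<in> seq_obj C" "Y \<in> seq_obj C" and s: "wt C X Y s" and t: "wt C X Y t"
      and eq: "stream_fun C X Y s = stream_fun C X Y t"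
      using that by (simp_all add: E_def)
    note ws = wt_stream_nf[OF s XY] and wt = wt_stream_nf[OF t XY]
    have id: "Id C (X 0) \<in> Hom C (X 0) (X 0)" using XY by (simp add: id_hom)
    have s': "shift X \<in> seq_obj C" "shift Y \<in> seq_obj C" "X 0 \<bullet> shift X \<in> seq_obj C" using XY by simp_all
    have ws': "wt C (X 0 \<bullet> shift X) (shift Y) (later (stream_nf C X Y s))"
      and wt': "wt C (X 0 \<bullet> shift X) (shift Y) (later (stream_nf C X Y t))"
      using wtD(3)[OF ws] wtD(3)[OF wt] by (simp_all del: stream_nf_simps(3))
    have now: "now s \<Zsemi> Pr2 C (mem s) (Y 0) = now t \<Zsemi> Pr2 C (mem t) (Y 0)"
      using fun_cong[OF eq, of 0] by simp
    \<comment> \<open>Both normal forms have memory \<open>X 0\<close>, so the slide is along the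
      identity; equality of the first outputs makes the first actions equal.\<close>
    have "now (stream_nf C X Y s) = now (stream_nf C X Y t) \<Zsemi> Id C (X 0) \<boxtimes> Id C (Y 0)"
      using HomD[OF wtD(2)[OF wt]] XY by (simp add: now)
    moreover have "E (X 0 \<bullet> shift X) (shift Y) (precomp C (Id C (X 0) \<boxtimes> Id C (X 1)) (later (stream_nf C X Y s))) (later (stream_nf C X Y t))"
      unfolding E_def
    proof (intro conjI s' wt')
      show "wt C (X 0 \<bullet> shift X) (shift Y) (precomp C (Id C (X 0) \<boxtimes> Id C (X 1)) (later (stream_nf C X Y s)))"
        using wt_precomp[OF id ws' s'(1)] by simp
      show "stream_fun C (X 0 \<bullet> shift X) (shift Y) (precomp C (Id C (X 0) \<boxtimes> Id C (X 1)) (later (stream_nf C X Y s))) =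
        stream_fun C (X 0 \<bullet> shift X) (shift Y) (later (stream_nf C X Y t))"
      proof
        fix n
        have "stream_fun C (X 0 \<bullet> shift X) (shift Y) (precomp C (Id C (X 0) \<boxtimes> Id C (shift X 0)) (later (stream_nf C X Y s))) n =
          carry C (Id C (X 0)) (shift X) n \<Zsemi> stream_fun C (X 0 \<bullet> shift X) (shift Y) (later (stream_nf C X Y s)) n"
          by (rule stream_fun_precomp[OF id ws' s'(1,2)])
        also have "\<dots> = stream_fun C (X 0 \<bullet> shift X) (shift Y) (later (stream_nf C X Y s)) n"
          using HomD[OF stream_fun_hom[OF ws' s'(3,2), of n]] s' XY by (simp del: stream_nf_simps(3))
        also have "\<dots> = stream_fun C (X 0 \<bullet> shift X) (shift Y) (later (stream_nf C X Y t)) n"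
          unfolding stream_fun_later_nf[OF s XY] stream_fun_later_nf[OF t XY] eq ..
        finally show "stream_fun C (X 0 \<bullet> shift X) (shift Y) (precomp C (Id C (X 0) \<boxtimes> Id C (X 1)) (later (stream_nf C X Y s))) n =
          stream_fun C (X 0 \<bullet> shift X) (shift Y) (later (stream_nf C X Y t)) n"
          by simp
      qed
    qed
    ultimately show ?thesis
      unfolding S_def using ws wt id by (metis stream_nf_simps(1))
  qed
  have "E X Y s t" using assms by (simp add: E_def)
  then show ?thesis
  proof (coinduction arbitrary: X Y s t rule: streq.coinduct)
    case (streq X Y s t)
    then have XY: "X \<in> seq_obj C" "Y \<in> seq_obj C" and s: "wt C X Y s" and t: "wt C X Y t"
      by (simp_all add: E_def)
    \<comment> \<open>The chain runs from \<open>s\<close> to its normal form, to the normal form of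
      \<open>t\<close>, and along the last link backwards to \<open>t\<close>.\<close>
    have "equivclp (S X Y) s t"
      by (meson equivclp_trans equivclp_sym r_into_equivclp nf[OF s XY] nf[OF t XY] nf_nf[OF streq])
    moreover have "S X Y = (\<lambda>f g. wt C X Y f \<and> wt C X Y g \<and>
      (\<exists>r\<in>Hom C (mem g) (mem f). now f = now g \<Zsemi> r \<boxtimes> Id C (Y 0) \<and>
        ((\<exists>X' Y' s t. mem g \<bullet> shift X = X' \<and> shift Y = Y' \<and> precomp C (r \<boxtimes> Id C (X 1)) (later f) = s \<and> later g = t \<and> E X' Y' s t) \<or>
         streq C (mem g \<bullet> shift X) (shift Y) (precomp C (r \<boxtimes> Id C (X 1)) (later f)) (later g))))"
      by (intro ext) (simp add: S_def)
    ultimately show ?case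
      using s t by simp
  qed
qed

text \<open>Equivalence of well-typed streams is the kernel of \<open>stream_fun\<close>. Hence it
  is an equivalence relation, and an operation on raw streams descends to classes if the causal
  function of its result is determined by those of its arguments.\<close>

lemma streq_iff:
  assumes "X \<in> seq_obj C" "Y \<in> seq_obj C"
  shows "streq C X Y s t \<longleftrightarrow> wt C X Y s \<and> wt C X Y t \<and> stream_fun C X Y s = stream_fun C X Y t"
  using stream_fun_eq_imp_streq[of X Y s t] streq_imp_stream_fun_eq[of X Y s t] assms
  by (auto elim: streq.cases)

section \<open>Realisation of causal functions by streams\<close>

lemma wt_causal_stream:
  assumes "f \<in> causal C X Y" "X \<in> seq_obj C"
  shows "wt C X Y (causal_stream C X f)"
  using assms
proof (coinduction arbitrary: X Y f)
  case (wt X Y f)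
  have "shift f \<in> causal C (X 0 \<bullet> shift X) (shift Y)"
    by (rule shift_causal[OF wt(1)])
  moreover have "X 0 \<bullet> shift X \<in> seq_obj C" using wt by simp
  ultimately show ?case
    using wt causalD[OF wt(1)] by (auto simp: Hom_iff)
qed

lemma stream_fun_causal_stream:
  assumes "f \<in> causal C X Y" "X \<in> seq_obj C"
  shows "stream_fun C X Y (causal_stream C X f) n = f n"
  using assms
proof (induction n arbitrary: X Y f)
  case (0 X Y f)
  then show ?case using causalD[OF 0(1)] by simp
next
  case (Suc n X Y f)
  have f: "shift f \<in> causal C (X 0 \<bullet> shift X) (shift Y)"
    by (rule shift_causal[OF Suc.prems(1)])
  have X: "X 0 \<bullet> shift X \<in> seq_obj C" using Suc.prems by simp
  have "stream_fun C (X 0 \<bullet> shift X) (shift Y) (causal_stream C (X 0 \<bullet> shift X) (shift f)) n = f (Suc n)"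
    by (rule trans[OF Suc.IH[OF f X] shift_apply])
  then show ?case
    using causalD[OF Suc.prems(1)] Suc.prems(2) by simp
qed

end

lemma stream_prof_simps [simp]:
  "El (stream_prof C) = streams C"
  "Act (stream_prof C) u v = class_map (streq_rel C (\<lambda>n. Dom C (u n)) (\<lambda>n. Cod C (v n))) (raw_act C u v)"
  by (simp_all add: stream_prof_def)

lemma streams_cases:
  assumes "c \<in> streams C X Y"
  obtains s where "wt C X Y s" "c = stream_class C X Y s"
  using assms by (auto simp: streams_def stream_class_def elim: quotientE)

context cartesian_category
begin

section \<open>Classes of streams\<close>

lemma equiv_streq:
  assumes "X \<in> seq_obj C" "Y \<in> seq_obj C"
  shows "equiv {s. wt C X Y s} (streq_rel C X Y)"
  by (rule equivI) (auto simp: streq_rel_def streq_iff[OF assms] refl_on_def sym_def trans_def)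

lemma stream_class_in: "wt C X Y s \<Longrightarrow> stream_class C X Y s \<in> streams C X Y"
  by (simp add: streams_def stream_class_def quotientI)

lemma mem_stream_class:
  assumes "X \<in> seq_obj C" "Y \<in> seq_obj C"
  shows "t \<in> stream_class C X Y s \<longleftrightarrow> wt C X Y s \<and> wt C X Y t \<and> stream_fun C X Y s = stream_fun C X Y t"
  by (simp add: stream_class_def streq_rel_def streq_iff[OF assms])

lemma stream_class_eqI:
  assumes "X \<in> seq_obj C" "Y \<in> seq_obj C" "wt C X Y s" "wt C X Y t" "stream_fun C X Y s = stream_fun C X Y t"
  shows "stream_class C X Y s = stream_class C X Y t"
  using assms by (auto simp: mem_stream_class)

lemma stream_class_fun_class:
  assumes XY: "X \<in> seq_obj C" "Y \<in> seq_obj C" and s: "wt C X Y s"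
  shows "stream_class_fun C X Y (stream_class C X Y s) = stream_fun C X Y s"
proof -
  have "s \<in> stream_class C X Y s"
    using s by (simp add: mem_stream_class[OF XY])
  then have "(SOME t. t \<in> stream_class C X Y s) \<in> stream_class C X Y s"
    by (rule someI)
  then have "stream_fun C X Y s = stream_fun C X Y (SOME t. t \<in> stream_class C X Y s)"
    using mem_stream_class[OF XY] by blast
  then show ?thesis
    by (simp only: stream_class_fun_def)
qed

lemma class_map_stream_class:
  assumes XY: "X \<in> seq_obj C" "Y \<in> seq_obj C" "X' \<in> seq_obj C" "Y' \<in> seq_obj C" and s: "wt C X Y s"
    and g: "\<And>t. \<lbrakk>wt C X Y t; stream_fun C X Y t = stream_fun C X Y s\<rbrakk> \<Longrightarrow>
      wt C X' Y' (g t) \<and> stream_fun C X' Y' (g t) = stream_fun C X' Y' (g s)"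
  shows "class_map (streq_rel C X' Y') g (stream_class C X Y s) = stream_class C X' Y' (g s)"
  unfolding stream_class_def
proof (rule class_map_class[OF equiv_streq[OF XY(3,4)] equiv_streq[OF XY(1,2)]])
  show "s \<in> {s. wt C X Y s}"
    using s by simp
  fix t assume "(s, t) \<in> streq_rel C X Y"
  then have t: "wt C X Y t" and eq: "stream_fun C X Y t = stream_fun C X Y s"
    by (simp_all add: streq_rel_def streq_iff[OF XY(1,2)])
  from g[OF t eq] g[OF s refl] show "(g s, g t) \<in> streq_rel C X' Y'"
    by (simp add: streq_rel_def streq_iff[OF XY(3,4)])
qed

lemma bij_stream_class_fun:
  assumes XY: "X \<in> seq_obj C" "Y \<in> seq_obj C"
  shows "bij_betw (stream_class_fun C X Y) (streams C X Y) (causal C X Y)"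
proof (rule bij_betw_imageI)
  show "inj_on (stream_class_fun C X Y) (streams C X Y)"
  proof (rule inj_onI)
    fix c d assume c: "c \<in> streams C X Y" and d: "d \<in> streams C X Y"
      and eq: "stream_class_fun C X Y c = stream_class_fun C X Y d"
    obtain s where s: "wt C X Y s" "c = stream_class C X Y s" using c by (rule streams_cases)
    obtain t where t: "wt C X Y t" "d = stream_class C X Y t" using d by (rule streams_cases)
    show "c = d"
      using eq unfolding s(2) t(2) stream_class_fun_class[OF XY s(1)] stream_class_fun_class[OF XY t(1)]
      by (rule stream_class_eqI[OF XY s(1) t(1)])
  qed
  have "f \<in> stream_class_fun C X Y ` streams C X Y" if f: "f \<in> causal C X Y" for f
  proof -
    note w = wt_causal_stream[OF f XY(1)]
    have "f = stream_class_fun C X Y (stream_class C X Y (causal_stream C X f))"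
      unfolding stream_class_fun_class[OF XY w] using stream_fun_causal_stream[OF f XY(1)] by (simp add: fun_eq_iff)
    then show ?thesis
      using stream_class_in[OF w] by (rule image_eqI)
  qed
  moreover have "stream_class_fun C X Y c \<in> causal C X Y" if "c \<in> streams C X Y" for c
    using that by (rule streams_cases) (simp add: stream_class_fun_class[OF XY] stream_fun_causal XY)
  ultimately show "stream_class_fun C X Y ` streams C X Y = causal C X Y"
    by blast
qed

lemma wt_coinduct:
  assumes "R X Y s"
    and "\<And>X Y s. R X Y s \<Longrightarrow> mem s \<in> Obj C \<and> now s \<in> Hom C (X 0) (mem s \<otimes> Y 0) \<and>
      R (mem s \<bullet> shift X) (shift Y) (later s)"
  shows "wt C X Y s"
  using assms(1) by (coinduction arbitrary: X Y s) (use assms(2) in blast)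

section \<open>Streams as a profunctor\<close>

lemma wt_raw_act:
  assumes "u \<in> seq_hom C X' X" "v \<in> seq_hom C Y Y'" "wt C X Y s"
  shows "wt C X' Y' (raw_act C u v s)"
proof (rule wt_coinduct[where R = "\<lambda>X' Y' t. \<exists>X Y u v s. t = raw_act C u v s \<and>
    u \<in> seq_hom C X' X \<and> v \<in> seq_hom C Y Y' \<and> wt C X Y s"])
  show "\<exists>Xa Ya ua va sa. raw_act C u v s = raw_act C ua va sa \<and>
      ua \<in> seq_hom C X' Xa \<and> va \<in> seq_hom C Ya Y' \<and> wt C Xa Ya sa"
    using assms by blast
next
  fix X' Y' t
  assume "\<exists>X Y u v s. t = raw_act C u v s \<and> u \<in> seq_hom C X' X \<and> v \<in> seq_hom C Y Y' \<and> wt C X Y s"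
  then obtain X Y u v s where t: "t = raw_act C u v s"
    and u: "u \<in> seq_hom C X' X" and v: "v \<in> seq_hom C Y Y'" and s: "wt C X Y s"
    by blast
  note D = wt_now[OF s]
  have "Id C (mem s) \<odot> shift u \<in> seq_hom C (mem s \<bullet> shift X') (mem s \<bullet> shift X)"
    by (intro dot_hom_hom id_hom shift_hom u D)
  moreover have "now t \<in> Hom C (X' 0) (mem t \<otimes> Y' 0)"
    using D seq_homD[OF u] seq_homD[OF v] by (simp add: Hom_iff t)
  moreover have "mem t = mem s" "later t = raw_act C (Id C (mem s) \<odot> shift u) (shift v) (later s)"
    by (simp_all add: t)
  ultimately show "mem t \<in> Obj C \<and> now t \<in> Hom C (X' 0) (mem t \<otimes> Y' 0) \<and>
      (\<exists>Xa Ya u v s. later t = raw_act C u v s \<and> u \<in> seq_hom C (mem t \<bullet> shift X') Xa \<and>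
        v \<in> seq_hom C Ya (shift Y') \<and> wt C Xa Ya s)"
    using D shift_hom[OF v] by metis
qed

lemma stream_fun_raw_act:
  assumes "u \<in> seq_hom C X' X" "v \<in> seq_hom C Y Y'" "wt C X Y s"
  shows "stream_fun C X' Y' (raw_act C u v s) n = lst_map C u n \<Zsemi> stream_fun C X Y s n \<Zsemi> v n"
  using assms
proof (induction n arbitrary: X X' Y Y' u v s)
  case (0 X X' Y Y' u v s)
  then show ?case
    using HomD[OF wtD(2)[OF 0(3)]] wtD(1)[OF 0(3)] seq_homD[OF 0(1)] seq_homD[OF 0(2)] by (simp add: cross_def)
next
  case (Suc n X X' Y Y' u v s)
  note u = Suc.prems(1) and v = Suc.prems(2) and s = Suc.prems(3)
  note D = wt_now[OF s] and U = seq_homD[OF u] and V = seq_homD[OF v]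
  have XY: "X \<in> seq_obj C" "Y \<in> seq_obj C" "mem s \<bullet> shift X \<in> seq_obj C" "shift Y \<in> seq_obj C"
    using U V D by simp_all
  have eq: "now (raw_act C u v s) \<Zsemi> Pr1 C (mem s) (Y' 0) = u 0 \<Zsemi> (now s \<Zsemi> Pr1 C (mem s) (Y 0))"
    using D U V by (simp add: cross_def)
  have k: "stream_fun C (mem s \<bullet> shift X) (shift Y) (later s) n \<in> Hom C (lst C (mem s \<bullet> shift X) n) (Y (Suc n))"
    using stream_fun_hom[OF D(3) XY(3,4), of n] by simp
  have vh: "v (Suc n) \<in> Hom C (Y (Suc n)) (Y' (Suc n))"
    using V by (simp add: Hom_iff)
  have "stream_fun C (mem s \<bullet> shift X') (shift Y') (raw_act C (Id C (mem s) \<odot> shift u) (shift v) (later s)) n =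
    lst_map C (Id C (mem s) \<odot> shift u) n \<Zsemi> stream_fun C (mem s \<bullet> shift X) (shift Y) (later s) n \<Zsemi> shift v n"
    by (rule Suc.IH) (intro dot_hom_hom id_hom shift_hom u v D)+
  then show ?case
    unfolding stream_fun.simps raw_act.simps(1,3) eq carry_act[OF u now_Pr_hom(1)[OF s XY(2)] k vh] by simp
qed

lemma Act_stream_class:
  assumes u: "u \<in> seq_hom C X' X" and v: "v \<in> seq_hom C Y Y'" and s: "wt C X Y s"
  shows "Act (stream_prof C) u v (stream_class C X Y s) = stream_class C X' Y' (raw_act C u v s)"
proof -
  note U = seq_homD[OF u] and V = seq_homD[OF v]
  have dom: "(\<lambda>n. Dom C (u n)) = X'" "(\<lambda>n. Cod C (v n)) = Y'"
    using U V by simp_all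
  have "class_map (streq_rel C X' Y') (raw_act C u v) (stream_class C X Y s) = stream_class C X' Y' (raw_act C u v s)"
  proof (rule class_map_stream_class[OF U(5) V(4) U(4) V(5) s])
    fix t assume t: "wt C X Y t" and eq: "stream_fun C X Y t = stream_fun C X Y s"
    have "stream_fun C X' Y' (raw_act C u v t) n = stream_fun C X' Y' (raw_act C u v s) n" for n
      unfolding stream_fun_raw_act[OF u v s] stream_fun_raw_act[OF u v t] eq ..
    then show "wt C X' Y' (raw_act C u v t) \<and>
        stream_fun C X' Y' (raw_act C u v t) = stream_fun C X' Y' (raw_act C u v s)"
      using wt_raw_act[OF u v t] by blast
  qed
  then show ?thesis
    unfolding stream_prof_simps dom .
qed

lemma Act_stream_in:
  assumes u: "u \<in> seq_hom C X' X" and v: "v \<in> seq_hom C Y Y'" and c: "c \<in> streams C X Y"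
  shows "Act (stream_prof C) u v c \<in> streams C X' Y'"
  using c
proof (rule streams_cases)
  fix s assume s: "wt C X Y s" and "c = stream_class C X Y s"
  then show ?thesis
    using Act_stream_class[OF u v s] stream_class_in[OF wt_raw_act[OF u v s]] by simp
qed

lemma stream_class_fun_Act:
  assumes u: "u \<in> seq_hom C X' X" and v: "v \<in> seq_hom C Y Y'" and c: "c \<in> streams C X Y"
  shows "stream_class_fun C X' Y' (Act (stream_prof C) u v c) =
    Act (causal_prof C) u v (stream_class_fun C X Y c)"
  using c
proof (rule streams_cases)
  fix s assume s: "wt C X Y s" and c: "c = stream_class C X Y s"
  note U = seq_homD[OF u] and V = seq_homD[OF v]
  show ?thesis
    unfolding c Act_stream_class[OF u v s] stream_class_fun_class[OF U(5) V(4) s]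
      stream_class_fun_class[OF U(4) V(5) wt_raw_act[OF u v s]] causal_prof_simps
    by (rule ext) (rule stream_fun_raw_act[OF u v s])
qed

lemma stream_class_fun_natural:
  "natural_transformation C (stream_prof C) (causal_prof C) (stream_class_fun C)"
  unfolding natural_transformation_def
  using bij_betw_imp_surj_on[OF bij_stream_class_fun] stream_class_fun_Act
  by (auto simp del: stream_prof_simps(2) causal_prof_simps(2))

text \<open>The laws hold for causal functions and are reflected by \<open>stream_class_fun\<close>,
  which is injective and compatible with the actions.\<close>

lemma profunctor_stream: "profunctor C (stream_prof C)"
  unfolding profunctor_def
proof (intro conjI allI ballI)
  fix X X' Y Y' u v c assume "u \<in> seq_hom C X' X" "v \<in> seq_hom C Y Y'" "c \<in> El (stream_prof C) X Y"
  then show "Act (stream_prof C) u v c \<in> El (stream_prof C) X' Y'"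
    using Act_stream_in by simp
next
  fix X Y c assume XY: "X \<in> seq_obj C" "Y \<in> seq_obj C" and "c \<in> El (stream_prof C) X Y"
  then have c: "c \<in> streams C X Y" by simp
  have f: "stream_class_fun C X Y c \<in> El (causal_prof C) X Y"
    using bij_betw_imp_surj_on[OF bij_stream_class_fun[OF XY]] c by auto
  note id = seq_id_hom[OF XY(1)] seq_id_hom[OF XY(2)]
  show "Act (stream_prof C) (seq_id C X) (seq_id C Y) c = c"
    using stream_class_fun_Act[OF id c] profunctorD(2)[OF profunctor_causal XY f]
      inj_onD[OF bij_betw_imp_inj_on[OF bij_stream_class_fun[OF XY]] _ Act_stream_in[OF id c] c] by simp
next
  fix X X' X'' Y Y' Y'' u u' v v' c
  assume u: "u \<in> seq_hom C X' X" "u' \<in> seq_hom C X'' X'" and v: "v \<in> seq_hom C Y Y'" "v' \<in> seq_hom C Y' Y''"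
    and "c \<in> El (stream_prof C) X Y"
  then have c: "c \<in> streams C X Y" by simp
  note U = seq_homD[OF u(1)] seq_homD[OF u(2)] and V = seq_homD[OF v(1)] seq_homD[OF v(2)]
  have f: "stream_class_fun C X Y c \<in> El (causal_prof C) X Y"
    using bij_betw_imp_surj_on[OF bij_stream_class_fun[OF U(5) V(4)]] c by auto
  note uu = seq_cmp_hom[OF u(2,1)] and vv = seq_cmp_hom[OF v]
  note c' = Act_stream_in[OF u(1) v(1) c]
  show "Act (stream_prof C) (seq_cmp C u' u) (seq_cmp C v v') c = Act (stream_prof C) u' v' (Act (stream_prof C) u v c)"
  proof (rule inj_onD[OF bij_betw_imp_inj_on[OF bij_stream_class_fun[OF U(9) V(10)]]
        _ Act_stream_in[OF uu vv c] Act_stream_in[OF u(2) v(2) c']])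
    show "stream_class_fun C X'' Y'' (Act (stream_prof C) (seq_cmp C u' u) (seq_cmp C v v') c) =
      stream_class_fun C X'' Y'' (Act (stream_prof C) u' v' (Act (stream_prof C) u v c))"
      unfolding stream_class_fun_Act[OF uu vv c] stream_class_fun_Act[OF u(2) v(2) c'] stream_class_fun_Act[OF u(1) v(1) c]
      by (rule profunctorD(3)[OF profunctor_causal u v f, symmetric])
  qed
qed

section \<open>The coalgebra of streams\<close>

text \<open>That \<open>stream_coalg\<close> does not depend on the representative is seen in the
  coend over causal functions. There the triples of equivalent streams become the class of their
  common causal function, and injectivity of \<open>phi_map\<close> brings the equality
  back.\<close>

lemma stream_coalg_class:
  assumes XY: "X \<in> seq_obj C" "Y \<in> seq_obj C" and s: "wt C X Y s"
  shows "(mem s, now s, stream_class C (mem s \<bullet> shift X) (shift Y) (later s)) \<in> coend_pre C (stream_prof C) X Y"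
    and "stream_coalg C X Y (stream_class C X Y s) = coend_rel C (stream_prof C) X Y ``
      {(mem s, now s, stream_class C (mem s \<bullet> shift X) (shift Y) (later s))}"
    and "causal_coalg C X Y (stream_fun C X Y s) = phi_map C (causal_prof C) (stream_class_fun C) X Y
      (coend_rel C (stream_prof C) X Y ``
        {(mem s, now s, stream_class C (mem s \<bullet> shift X) (shift Y) (later s))})"
proof -
  let ?P = "stream_prof C" and ?R = "causal_prof C" and ?h = "stream_class_fun C"
  let ?x = "\<lambda>s. (mem s, now s, stream_class C (mem s \<bullet> shift X) (shift Y) (later s))"
  have pre: "?x t \<in> coend_pre C ?P X Y" if "wt C X Y t" for t
    using wtD[OF that] stream_class_in by (simp add: coend_pre_def)
  then show "?x s \<in> coend_pre C ?P X Y" using s by blast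
  have coalg: "causal_coalg C X Y (stream_fun C X Y t) = phi_map C ?R ?h X Y (coend_rel C ?P X Y `` {?x t})"
    if t: "wt C X Y t" for t
  proof -
    have "?h (mem t \<bullet> shift X) (shift Y) (stream_class C (mem t \<bullet> shift X) (shift Y) (later t)) =
        stream_fun C (mem t \<bullet> shift X) (shift Y) (later t)"
      by (rule stream_class_fun_class) (intro seq_obj_intros XY wtD[OF t])+
    then have "stream_fun C X Y t n = causal_glue C X Y ?h (?x t) n" for n
      by (cases n) simp_all
    then have "stream_fun C X Y t = causal_glue C X Y ?h (?x t)"
      by (rule ext)
    then show ?thesis
      using causal_coalg_eq_iff[OF stream_class_fun_natural XY pre[OF t] stream_fun_causal[OF t XY]] by blast
  qed
  show "causal_coalg C X Y (stream_fun C X Y s) = phi_map C ?R ?h X Y (coend_rel C ?P X Y `` {?x s})"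
    by (rule coalg[OF s])
  have bij: "bij_betw (?h X Y) (El ?P X Y) (El ?R X Y)" if "X \<in> seq_obj C" "Y \<in> seq_obj C" for X Y
    using bij_stream_class_fun[OF that] by simp
  have "inj_on (phi_map C ?R ?h X Y) (El (phi C ?P) X Y)"
    by (rule phi_map_inj[OF profunctor_stream stream_class_fun_natural _ XY]) (rule bij)
  note inj = inj_onD[OF this]
  show "stream_coalg C X Y (stream_class C X Y s) = coend_rel C ?P X Y `` {?x s}"
    unfolding stream_coalg_def stream_class_def[of C X Y s]
  proof (rule class_map_class[OF equiv_coend_rel equiv_streq[OF XY]])
    show "s \<in> {s. wt C X Y s}" using s by simp
    fix t assume "(s, t) \<in> streq_rel C X Y"
    then have t: "wt C X Y t" and eq: "stream_fun C X Y s = stream_fun C X Y t"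
      by (simp_all add: streq_rel_def streq_iff[OF XY])
    have "coend_rel C ?P X Y `` {?x s} = coend_rel C ?P X Y `` {?x t}"
    proof (rule inj)
      show "phi_map C ?R ?h X Y (coend_rel C ?P X Y `` {?x s}) = phi_map C ?R ?h X Y (coend_rel C ?P X Y `` {?x t})"
        using coalg[OF s] coalg[OF t] eq by simp
    qed (intro phi_El_class pre s t)+
    then show "(?x s, ?x t) \<in> coend_rel C ?P X Y"
      using eq_equiv_class[OF _ equiv_coend_rel pre[OF t]] by blast
  qed
qed

lemma stream_coalg_hom:
  assumes XY: "X \<in> seq_obj C" "Y \<in> seq_obj C" and c: "c \<in> El (stream_prof C) X Y"
  shows "stream_coalg C X Y c \<in> El (phi C (stream_prof C)) X Y"
    and "causal_coalg C X Y (stream_class_fun C X Y c) =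
      phi_map C (causal_prof C) (stream_class_fun C) X Y (stream_coalg C X Y c)"
proof -
  obtain s where s: "wt C X Y s" "c = stream_class C X Y s"
    using c by (auto elim: streams_cases)
  show "stream_coalg C X Y c \<in> El (phi C (stream_prof C)) X Y"
    unfolding s(2) stream_coalg_class(2)[OF XY s(1)] by (rule phi_El_class[OF stream_coalg_class(1)[OF XY s(1)]])
  show "causal_coalg C X Y (stream_class_fun C X Y c) =
      phi_map C (causal_prof C) (stream_class_fun C) X Y (stream_coalg C X Y c)"
    unfolding s(2) stream_coalg_class(2)[OF XY s(1)] stream_class_fun_class[OF XY s(1)]
    by (rule stream_coalg_class(3)[OF XY s(1)])
qed

lemma final_fixpoint_stream: "final_fixpoint TYPE('q) C (stream_prof C) (stream_coalg C)"
  by (rule final_fixpoint_transfer[OF final_fixpoint_causal profunctor_stream stream_class_fun_natural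
        _ stream_coalg_hom]) (simp_all add: bij_stream_class_fun)

lemma coalgebra_hom_stream:
  "coalgebra_hom C (stream_prof C) (stream_coalg C) (causal_prof C) (causal_coalg C) (stream_class_fun C)"
  using stream_class_fun_natural stream_coalg_hom(2) by (simp add: coalgebra_hom_def)

end

section \<open>Lifting, composition and tensor of streams\<close>

text \<open>The inputs \<open>Y\<close> of the second stream of a composite together with its initial memory \<open>B\<close>,
  as a causal function of the joint memory \<open>A \<otimes> B\<close> and the inputs \<open>X\<close> of the first stream \<open>s\<close>.\<close>

definition cmp_env ::
  "('o, 'm) cart_cat \<Rightarrow> 'o \<Rightarrow> 'o \<Rightarrow> (nat \<Rightarrow> 'o) \<Rightarrow> (nat \<Rightarrow> 'o) \<Rightarrow> ('o, 'm) raw \<Rightarrow> nat \<Rightarrow> 'm" where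
  "cmp_env C A B X Y s =
     (let g = \<lambda>n. carry C (Pr1 C A B) X n \<Zsemi>\<^bsub>C\<^esub> stream_fun C (A \<bullet>\<^bsub>C\<^esub> X) Y s n
      in g(0 := tuple C (Pr1 C (A \<otimes>\<^bsub>C\<^esub> B) (X 0) \<Zsemi>\<^bsub>C\<^esub> Pr2 C A B) (g 0)))"

lemma cmp_env_simps:
  "cmp_env C A B X Y s 0 = tuple C (Pr1 C (A \<otimes>\<^bsub>C\<^esub> B) (X 0) \<Zsemi>\<^bsub>C\<^esub> Pr2 C A B)
     (carry C (Pr1 C A B) X 0 \<Zsemi>\<^bsub>C\<^esub> stream_fun C (A \<bullet>\<^bsub>C\<^esub> X) Y s 0)"
  "cmp_env C A B X Y s (Suc n) =
     carry C (Pr1 C A B) X (Suc n) \<Zsemi>\<^bsub>C\<^esub> stream_fun C (A \<bullet>\<^bsub>C\<^esub> X) Y s (Suc n)"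
  by (simp_all add: cmp_env_def)

context cartesian_category
begin

section \<open>Lifted morphisms of sequences\<close>

lemma wt_raw_lift_mem:
  assumes "u \<in> seq_hom C X Y"
  shows "wt C (\<one> \<bullet> X) Y (raw_lift_mem C u)"
proof (rule wt_coinduct[where R = "\<lambda>X' Y t. \<exists>X u. X' = \<one> \<bullet> X \<and> t = raw_lift_mem C u \<and> u \<in> seq_hom C X Y"])
  show "\<exists>Xa ua. \<one> \<bullet> X = \<one> \<bullet> Xa \<and> raw_lift_mem C u = raw_lift_mem C ua \<and> ua \<in> seq_hom C Xa Y"
    using assms by blast
next
  fix X' Y t assume "\<exists>X u. X' = \<one> \<bullet> X \<and> t = raw_lift_mem C u \<and> u \<in> seq_hom C X Y"
  then obtain X u where t: "X' = \<one> \<bullet> X" "t = raw_lift_mem C u" and u: "u \<in> seq_hom C X Y"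
    by blast
  have "mem t \<bullet> shift X' = \<one> \<bullet> shift X" "later t = raw_lift_mem C (shift u)"
    by (simp_all add: t)
  moreover have "now t \<in> Hom C (X' 0) (mem t \<otimes> Y 0)" "mem t \<in> Obj C"
    using seq_homD[OF u] by (simp_all add: t Hom_iff)
  ultimately show "mem t \<in> Obj C \<and> now t \<in> Hom C (X' 0) (mem t \<otimes> Y 0) \<and>
      (\<exists>X u. mem t \<bullet> shift X' = \<one> \<bullet> X \<and> later t = raw_lift_mem C u \<and> u \<in> seq_hom C X (shift Y))"
    using shift_hom[OF u] by blast
qed

lemma wt_raw_lift:
  assumes u: "u \<in> seq_hom C X Y"
  shows "wt C X Y (raw_lift C u)"
proof (rule wt.intros)
  show "wt C (mem (raw_lift C u) \<bullet> shift X) (shift Y) (later (raw_lift C u))"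
    using wt_raw_lift_mem[OF shift_hom[OF u]] by (simp add: raw_lift_def)
qed (use seq_homD[OF u] in \<open>simp_all add: raw_lift_def Hom_iff\<close>)

text \<open>At a positive index the last input lies outside the memory factor, which is all that
  \<open>carry\<close> changes.\<close>

lemma carry_Pr2:
  assumes "p \<in> Hom C M N" "W \<in> seq_obj C" "h \<in> Arr C" "Dom C h = W (Suc n)"
  shows "carry C p W (Suc n) \<Zsemi> (Pr2 C (lst C (N \<bullet> W) n) (W (Suc n)) \<Zsemi> h) =
    Pr2 C (lst C (M \<bullet> W) n) (W (Suc n)) \<Zsemi> h"
proof -
  note D = HomD[OF carry_hom[OF assms(1,2), of n]] HomD[OF assms(1)]
  have "carry C p W (Suc n) = carry C p W n \<boxtimes> Id C (W (Suc n))"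
    by (simp add: carry_def)
  then show ?thesis
    using D assms(2-) by simp
qed

text \<open>The source is \<open>\<one> \<bullet> X\<close>, so even at index \<open>0\<close> the
  last input has to be projected out, namely from beside the unit memory; this is the difference
  from \<open>lst_counit\<close>.\<close>

lemma stream_fun_raw_lift_mem:
  assumes "u \<in> seq_hom C X Y"
  shows "stream_fun C (\<one> \<bullet> X) Y (raw_lift_mem C u) n =
    (case n of 0 \<Rightarrow> Pr2 C \<one> (X 0) | Suc m \<Rightarrow> Pr2 C (lst C (\<one> \<bullet> X) m) (X (Suc m))) \<Zsemi> u n"
  using assms
proof (induction n arbitrary: X Y u)
  case (0 X Y u)
  then show ?case using seq_homD[OF 0] by simp
next
  case (Suc n X Y u)
  note U = seq_homD[OF Suc.prems]
  have s: "shift X \<in> seq_obj C" using U by simp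
  have p: "Pr1 C \<one> (X 0) \<in> Hom C (\<one> \<otimes> X 0) \<one>"
    using U by (simp add: Hom_iff)
  have eq: "now (raw_lift_mem C u) \<Zsemi> Pr1 C (mem (raw_lift_mem C u)) (Y 0) = Pr1 C \<one> (X 0)"
    using U by simp
  have ih: "stream_fun C (\<one> \<bullet> shift X) (shift Y) (raw_lift_mem C (shift u)) n =
      (case n of 0 \<Rightarrow> Pr2 C \<one> (shift X 0) | Suc m \<Rightarrow> Pr2 C (lst C (\<one> \<bullet> shift X) m) (shift X (Suc m))) \<Zsemi> shift u n"
    by (rule Suc.IH[OF shift_hom[OF Suc.prems]])
  show ?case
  proof (cases n)
    case 0
    then show ?thesis
      using U ih by (simp add: carry_def)
  next
    case m: (Suc m)
    have "carry C (Pr1 C \<one> (X 0)) (shift X) n \<Zsemi> (Pr2 C (lst C (\<one> \<bullet> shift X) m) (shift X (Suc m)) \<Zsemi> u (Suc n)) =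
        Pr2 C (lst C ((\<one> \<otimes> X 0) \<bullet> shift X) m) (shift X (Suc m)) \<Zsemi> u (Suc n)"
      unfolding m by (rule carry_Pr2[OF p s]) (use U m in simp_all)
    then show ?thesis
      unfolding stream_fun.simps eq using ih m lst_dot_dot[of C \<one> X m]
      by (simp only: shift_dot raw_lift_mem.simps nat.case shift_apply)
  qed
qed

text \<open>The right side is the cokleisli lift of \<open>u\<close>, so identities and coherence
  maps of streams match those of the cokleisli category.\<close>

lemma stream_fun_raw_lift:
  assumes u: "u \<in> seq_hom C X Y"
  shows "stream_fun C X Y (raw_lift C u) n = lst_counit C X n \<Zsemi> u n"
proof (cases n)
  case 0
  then show ?thesis using seq_homD[OF u] by (simp add: raw_lift_def lun'_def)
next
  case (Suc m)
  note U = seq_homD[OF u]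
  have s: "shift X \<in> seq_obj C" using U by simp
  have p: "bang C (X 0) \<in> Hom C (X 0) \<one>"
    using U by (simp add: Hom_iff)
  have eq: "now (raw_lift C u) \<Zsemi> Pr1 C \<one> (Y 0) = bang C (X 0)"
    using U by (simp add: raw_lift_def lun'_def)
  have rest: "mem (raw_lift C u) = \<one>" "later (raw_lift C u) = raw_lift_mem C (shift u)"
    by (simp_all add: raw_lift_def)
  note mem = stream_fun_raw_lift_mem[OF shift_hom[OF u], of m]
  show ?thesis
  proof (cases m)
    case 0
    then show ?thesis
      using U mem eq by (simp add: Suc carry_def rest)
  next
    case k: (Suc k)
    have "carry C (bang C (X 0)) (shift X) m \<Zsemi> (Pr2 C (lst C (\<one> \<bullet> shift X) k) (shift X (Suc k)) \<Zsemi> u (Suc m)) =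
        Pr2 C (lst C (X 0 \<bullet> shift X) k) (shift X (Suc k)) \<Zsemi> u (Suc m)"
      unfolding k by (rule carry_Pr2[OF p s]) (use U k in simp_all)
    then show ?thesis
      unfolding Suc stream_fun.simps eq rest mem
      using k by (simp only: nat.case shift_apply lst_counit.simps lst_dot_shift)
  qed
qed

section \<open>Composition of streams\<close>

text \<open>The index of \<open>P \<bullet> shift W\<close> runs one behind that of
  \<open>W\<close>: its input \<open>0\<close> joins the memory with input \<open>1\<close> of
  \<open>W\<close>. Accordingly \<open>base\<close> pairs the memory obtained from
  \<open>e 0\<close> with the output \<open>e 1\<close>, and from then on both extensions append the
  same outputs.\<close>

lemma carry_lst_extend:
  assumes W: "W \<in> seq_obj C" and e: "e \<in> causal C W V" and p: "p \<in> Hom C (W 0) P" and q: "q \<in> Hom C (V 0) N"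
    and e': "e' \<in> causal C (P \<bullet> shift W) (N \<bullet> shift V)"
    and base: "carry C p (shift W) 0 \<Zsemi> e' 0 = tuple C (Pr1 C (W 0) (W 1) \<Zsemi> e 0 \<Zsemi> q) (e 1)"
    and step: "\<And>k. carry C p (shift W) (Suc k) \<Zsemi> e' (Suc k) = e (Suc (Suc k))"
  shows "carry C p (shift W) n \<Zsemi> lst_extend C (P \<bullet> shift W) e' n =
    lst_extend C W e (Suc n) \<Zsemi> carry C q (shift V) n"
proof -
  have V: "V \<in> seq_obj C" using causalD[OF e] by simp
  have s: "shift W \<in> seq_obj C" "shift V \<in> seq_obj C" and PW: "P \<bullet> shift W \<in> seq_obj C"
    using W V HomD[OF p] by simp_all
  note D = causalD[OF e] causalD[OF e'] HomD[OF p] HomD[OF q] HomD[OF carry_hom[OF p s(1)]] HomD[OF carry_hom[OF q s(2)]]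
    HomD[OF lst_extend_hom[OF e W]] HomD[OF lst_extend_hom[OF e' PW]]
  have carry_Suc: "carry C p (shift W) (Suc n) = carry C p (shift W) n \<boxtimes> Id C (W (Suc (Suc n)))"
    "carry C q (shift V) (Suc n) = carry C q (shift V) n \<boxtimes> Id C (V (Suc (Suc n)))" for n
    by (simp_all add: carry_def)
  show ?thesis
  proof (induction n)
    case 0
    have eq: "lst_extend C W e (Suc 0) \<Zsemi> carry C q (shift V) 0 = tuple C (Pr1 C (W 0) (W 1) \<Zsemi> e 0 \<Zsemi> q) (e 1)"
      using D W V e by (simp add: lst_extend_Suc[OF e W] carry_def)
    show ?case
      unfolding lst_extend_0[OF e' PW] base eq ..
  next
    case (Suc n)
    have "carry C p (shift W) (Suc n) \<Zsemi> lst_extend C (P \<bullet> shift W) e' (Suc n) =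
      tuple C (carry C p (shift W) (Suc n) \<Zsemi> (Pr1 C (lst C (P \<bullet> shift W) n) (W (Suc (Suc n))) \<Zsemi> lst_extend C (P \<bullet> shift W) e' n))
        (carry C p (shift W) (Suc n) \<Zsemi> e' (Suc n))"
      using D PW W by (simp add: lst_extend_Suc[OF e' PW] del: Cmp_assoc)
    also have "carry C p (shift W) (Suc n) \<Zsemi> (Pr1 C (lst C (P \<bullet> shift W) n) (W (Suc (Suc n))) \<Zsemi> lst_extend C (P \<bullet> shift W) e' n) =
      Pr1 C (lst C W (Suc n)) (W (Suc (Suc n))) \<Zsemi> (carry C p (shift W) n \<Zsemi> lst_extend C (P \<bullet> shift W) e' n)"
      using D W PW by (simp add: carry_Suc)
    also have "tuple C \<dots> (carry C p (shift W) (Suc n) \<Zsemi> e' (Suc n)) =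
      lst_extend C W e (Suc (Suc n)) \<Zsemi> carry C q (shift V) (Suc n)"
      unfolding Suc step lst_extend_Suc[OF e W, of "Suc n"] carry_Suc(2)
      using D W V by simp
    finally show ?case .
  qed
qed

lemma cmp_env_causal:
  assumes A: "A \<in> Obj C" "B \<in> Obj C" and XY: "X \<in> seq_obj C" "Y \<in> seq_obj C" and s: "wt C (A \<bullet> X) Y s"
  shows "cmp_env C A B X Y s \<in> causal C ((A \<otimes> B) \<bullet> X) (B \<bullet> Y)"
proof -
  have pr: "Pr1 C A B \<in> Hom C (A \<otimes> B) A" using A by (simp add: Hom_iff)
  have AX: "A \<bullet> X \<in> seq_obj C" using A XY by simp
  note D = HomD[OF carry_hom[OF pr XY(1)]] HomD[OF stream_fun_hom[OF s AX XY(2)]]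
  have "cmp_env C A B X Y s n \<in> Hom C (lst C ((A \<otimes> B) \<bullet> X) n) ((B \<bullet> Y) n)" for n
  proof (cases n)
    case 0
    then show ?thesis
      using D(1-3)[of 0] D(6-8)[of 0] A XY by (simp add: cmp_env_simps Hom_iff del: stream_fun.simps)
  next
    case (Suc m)
    then show ?thesis
      using D(1-3)[of n] D(6-8)[of n] A XY by (simp add: cmp_env_simps Hom_iff del: stream_fun.simps)
  qed
  then show ?thesis by (simp add: causal_def)
qed

text \<open>The induction step shared by \<open>raw_cmp_mem\<close>, where \<open>e\<close> is \<open>cmp_env\<close>, and \<open>raw_cmp\<close>, where it
  is the causal function of the first stream.\<close>

lemma cmp_step:
  assumes W: "W \<in> seq_obj C" and e: "e \<in> causal C W V" and MN: "M \<in> Obj C" "N \<in> Obj C"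
    and p: "p \<in> Hom C (W 0) (M \<otimes> N)" and q: "q \<in> Hom C (V 0) N"
    and l: "wt C (M \<bullet> shift W) (shift V) l"
    and p1: "\<And>n. e (Suc n) = carry C (p \<Zsemi> Pr1 C M N) (shift W) n \<Zsemi> stream_fun C (M \<bullet> shift W) (shift V) l n"
    and p2: "p \<Zsemi> Pr2 C M N = e 0 \<Zsemi> q" and k: "k \<in> Hom C (lst C (N \<bullet> shift V) n) Z"
  shows "carry C p (shift W) n \<Zsemi>
      (lst_extend C ((M \<otimes> N) \<bullet> shift W) (cmp_env C M N (shift W) (shift V) l) n \<Zsemi> k) =
    lst_extend C W e (Suc n) \<Zsemi> (carry C q (shift V) n \<Zsemi> k)"
proof -
  have V: "V \<in> seq_obj C" using causalD[OF e] by simp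
  have s: "shift W \<in> seq_obj C" "shift V \<in> seq_obj C" and MW: "M \<bullet> shift W \<in> seq_obj C"
    using W V MN by simp_all
  have pr: "Pr1 C M N \<in> Hom C (M \<otimes> N) M" using MN by (simp add: Hom_iff)
  note D = HomD[OF p] HomD[OF q] causalD[OF e] HomD[OF carry_hom[OF p s(1)]] HomD[OF carry_hom[OF pr s(1)]]
    HomD[OF stream_fun_hom[OF l MW s(2)]]
  have step: "carry C p (shift W) k \<Zsemi> (carry C (Pr1 C M N) (shift W) k \<Zsemi> stream_fun C (M \<bullet> shift W) (shift V) l k) = e (Suc k)" for k
    unfolding p1 carry_cmp[OF p pr s(1)] using D by (simp del: stream_fun.simps)
  note env = cmp_env_causal[OF MN s l]
  have "carry C p (shift W) n \<Zsemi> lst_extend C ((M \<otimes> N) \<bullet> shift W) (cmp_env C M N (shift W) (shift V) l) n =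
    lst_extend C W e (Suc n) \<Zsemi> carry C q (shift V) n"
  proof (rule carry_lst_extend[OF W e p q env])
    show "carry C p (shift W) (Suc k) \<Zsemi> cmp_env C M N (shift W) (shift V) l (Suc k) = e (Suc (Suc k))" for k
      unfolding cmp_env_simps by (rule step)
    let ?g = "carry C (Pr1 C M N) (shift W) 0 \<Zsemi> stream_fun C (M \<bullet> shift W) (shift V) l 0"
    have g: "?g \<in> Arr C" "Dom C ?g = (M \<otimes> N) \<otimes> W 1"
      using D MN by (simp_all del: stream_fun.simps)
    \<comment> \<open>At index \<open>0\<close> the environment also hands on the initial memory of
      the second stream, which \<open>p2\<close> identifies with
      \<open>e 0 \<Zsemi> q\<close>.\<close>
    have "carry C p (shift W) 0 \<Zsemi> cmp_env C M N (shift W) (shift V) l 0 =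
      tuple C (carry C p (shift W) 0 \<Zsemi> (Pr1 C (M \<otimes> N) (W 1) \<Zsemi> Pr2 C M N)) (carry C p (shift W) 0 \<Zsemi> ?g)"
      unfolding cmp_env_simps using g D MN W by (simp del: Cmp_assoc stream_fun.simps)
    also have "carry C p (shift W) 0 \<Zsemi> (Pr1 C (M \<otimes> N) (W 1) \<Zsemi> Pr2 C M N) = Pr1 C (W 0) (W 1) \<Zsemi> (p \<Zsemi> Pr2 C M N)"
      using D MN W by (simp add: carry_def)
    also have "\<dots> = Pr1 C (W 0) (W 1) \<Zsemi> e 0 \<Zsemi> q"
      unfolding p2 using D W by simp
    also have "carry C p (shift W) 0 \<Zsemi> ?g = e 1"
      unfolding step by simp
    finally show "carry C p (shift W) 0 \<Zsemi> cmp_env C M N (shift W) (shift V) l 0 = tuple C (Pr1 C (W 0) (W 1) \<Zsemi> e 0 \<Zsemi> q) (e 1)" .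
  qed
  moreover have "(M \<otimes> N) \<bullet> shift W \<in> seq_obj C" using MN s by simp
  ultimately show ?thesis
    using cmp_assoc[OF carry_hom[OF p s(1)] lst_extend_hom[OF env] k]
      cmp_assoc[OF lst_extend_hom[OF e W, of "Suc n"] carry_hom[OF q s(2), unfolded lst_dot_shift] k]
    by (simp only:)
qed

text \<open>The type of the first action, its two memory components and its output: the wiring
  enters the later arguments only through these facts.\<close>

lemma now_raw_cmp_mem:
  assumes A: "A \<in> Obj C" "B \<in> Obj C" and XYZ: "X \<in> seq_obj C" "Y \<in> seq_obj C" "Z \<in> seq_obj C"
    and s: "wt C (A \<bullet> X) Y s" and t: "wt C (B \<bullet> Y) Z t"
  shows "now (raw_cmp_mem C A B X Y Z s t) \<in> Hom C ((A \<otimes> B) \<otimes> X 0) ((mem s \<otimes> mem t) \<otimes> Z 0)"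
    and "now (raw_cmp_mem C A B X Y Z s t) \<Zsemi> Pr1 C (mem s \<otimes> mem t) (Z 0) \<Zsemi> Pr1 C (mem s) (mem t) =
      Pr1 C A B \<boxtimes> Id C (X 0) \<Zsemi> (now s \<Zsemi> Pr1 C (mem s) (Y 0))"
    and "now (raw_cmp_mem C A B X Y Z s t) \<Zsemi> Pr1 C (mem s \<otimes> mem t) (Z 0) \<Zsemi> Pr2 C (mem s) (mem t) =
      cmp_env C A B X Y s 0 \<Zsemi> (now t \<Zsemi> Pr1 C (mem t) (Z 0))"
    and "now (raw_cmp_mem C A B X Y Z s t) \<Zsemi> Pr2 C (mem s \<otimes> mem t) (Z 0) =
      cmp_env C A B X Y s 0 \<Zsemi> (now t \<Zsemi> Pr2 C (mem t) (Z 0))"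
  using wt_now[OF s] wt_now[OF t] A XYZ
  by (simp_all add: Hom_iff tuple_asc tuple_asc' tuple_swp swp_right_eq cmp_env_simps carry_def)

lemma wt_raw_cmp_mem:
  assumes "A \<in> Obj C" "B \<in> Obj C" "X \<in> seq_obj C" "Y \<in> seq_obj C" "Z \<in> seq_obj C"
    and "wt C (A \<bullet> X) Y s" "wt C (B \<bullet> Y) Z t"
  shows "wt C ((A \<otimes> B) \<bullet> X) Z (raw_cmp_mem C A B X Y Z s t)"
proof (rule wt_coinduct[where R = "\<lambda>W Z r. \<exists>A B X Y s t. W = (A \<otimes> B) \<bullet> X \<and> r = raw_cmp_mem C A B X Y Z s t \<and>
    A \<in> Obj C \<and> B \<in> Obj C \<and> X \<in> seq_obj C \<and> Y \<in> seq_obj C \<and> Z \<in> seq_obj C \<and>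
    wt C (A \<bullet> X) Y s \<and> wt C (B \<bullet> Y) Z t"], goal_cases)
  case 1
  then show ?case using assms by blast
next
  case (2 W Z r)
  then obtain A B X Y s t where r: "W = (A \<otimes> B) \<bullet> X" "r = raw_cmp_mem C A B X Y Z s t"
    and AB: "A \<in> Obj C" "B \<in> Obj C" and XYZ: "X \<in> seq_obj C" "Y \<in> seq_obj C" "Z \<in> seq_obj C"
    and s: "wt C (A \<bullet> X) Y s" and t: "wt C (B \<bullet> Y) Z t"
    by blast
  have "wt C (mem s \<bullet> shift X) (shift Y) (later s)" "wt C (mem t \<bullet> shift Y) (shift Z) (later t)"
    using wtD(3)[OF s] wtD(3)[OF t] by simp_all
  moreover have "mem r \<bullet> shift W = (mem s \<otimes> mem t) \<bullet> shift X"
    "later r = raw_cmp_mem C (mem s) (mem t) (shift X) (shift Y) (shift Z) (later s) (later t)"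
    by (simp_all add: r)
  moreover have "now r \<in> Hom C (W 0) (mem r \<otimes> Z 0)"
    using now_raw_cmp_mem(1)[OF AB XYZ s t] by (simp add: r del: raw_cmp_mem.simps(2))
  moreover have "mem s \<in> Obj C" "mem t \<in> Obj C" "mem r \<in> Obj C"
    using wtD(1)[OF s] wtD(1)[OF t] by (simp_all add: r)
  ultimately show ?case
    using seq_obj_intros(1)[OF XYZ(1)] seq_obj_intros(1)[OF XYZ(2)] seq_obj_intros(1)[OF XYZ(3)] by blast
qed

text \<open>The induction needs arbitrary initial memories, since the rest of a composite runs from
  the memories of both streams. The second stream then receives the outputs of the first together
  with the memory \<open>B\<close>, and \<open>cmp_env\<close> supplies both.\<close>

lemma stream_fun_raw_cmp_mem:
  assumes "A \<in> Obj C" "B \<in> Obj C" "X \<in> seq_obj C" "Y \<in> seq_obj C" "Z \<in> seq_obj C"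
    and "wt C (A \<bullet> X) Y s" "wt C (B \<bullet> Y) Z t"
  shows "stream_fun C ((A \<otimes> B) \<bullet> X) Z (raw_cmp_mem C A B X Y Z s t) n =
    lst_extend C ((A \<otimes> B) \<bullet> X) (cmp_env C A B X Y s) n \<Zsemi> stream_fun C (B \<bullet> Y) Z t n"
  using assms
proof (induction n arbitrary: A B X Y Z s t)
  case (0 A B X Y Z s t)
  have W: "(A \<otimes> B) \<bullet> X \<in> seq_obj C" using 0 by simp
  show ?case
    unfolding lst_extend_0[OF cmp_env_causal[OF 0(1-4,6)] W] stream_fun.simps raw_cmp_mem.simps(1)
    by (rule now_raw_cmp_mem(4)[OF 0])
next
  case (Suc n A B X Y Z s t)
  note AB = Suc.prems(1,2) and XYZ = Suc.prems(3-5) and s = Suc.prems(6) and t = Suc.prems(7)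
  let ?W = "(A \<otimes> B) \<bullet> X" and ?M = "mem s" and ?N = "mem t" and ?r = "raw_cmp_mem C A B X Y Z s t"
  let ?p = "now ?r \<Zsemi> Pr1 C (?M \<otimes> ?N) (Z 0)" and ?q = "now t \<Zsemi> Pr1 C ?N (Z 0)"
  let ?e = "cmp_env C A B X Y s"
  note MN = wtD(1)[OF s] wtD(1)[OF t]
  note now = now_raw_cmp_mem[OF AB XYZ s t]
  have W: "?W \<in> seq_obj C" using AB XYZ by simp
  have sh: "shift X \<in> seq_obj C" "shift Y \<in> seq_obj C" "shift Z \<in> seq_obj C" using XYZ by simp_all
  have ls: "wt C (?M \<bullet> shift X) (shift Y) (later s)" and lt: "wt C (?N \<bullet> shift Y) (shift Z) (later t)"
    using wtD(3)[OF s] wtD(3)[OF t] by simp_all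
  have p: "?p \<in> Hom C (?W 0) (?M \<otimes> ?N)"
    using HomD[OF now(1)] MN XYZ by (simp add: Hom_iff del: raw_cmp_mem.simps(2))
  note q = now_Pr_hom(1)[OF t XYZ(3)]
  have e: "?e \<in> causal C ?W (B \<bullet> Y)" by (rule cmp_env_causal[OF AB XYZ(1,2) s])
  have ls': "wt C (?M \<bullet> shift ?W) (shift (B \<bullet> Y)) (later s)" using ls by simp
  have pr: "Pr1 C A B \<in> Hom C (A \<otimes> B) A" using AB by (simp add: Hom_iff)
  have e_Suc: "?e (Suc k) = carry C (?p \<Zsemi> Pr1 C ?M ?N) (shift ?W) k \<Zsemi>
      stream_fun C (?M \<bullet> shift ?W) (shift (B \<bullet> Y)) (later s) k" for k
  proof -
    \<comment> \<open>Beyond index \<open>0\<close> the environment is the causal function of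
      \<open>s\<close> precomposed with the projection to its memory \<open>A\<close>. Unfolding
      that stream once exposes the rest of \<open>s\<close>.\<close>
    have "?e (Suc k) = stream_fun C ?W Y (precomp C (Pr1 C A B \<boxtimes> Id C (X 0)) s) (Suc k)"
      unfolding cmp_env_simps by (rule stream_fun_precomp[OF pr s XYZ(1,2), symmetric])
    moreover have "Pr1 C A B \<boxtimes> Id C (X 0) \<Zsemi> now s \<Zsemi> Pr1 C ?M (Y 0) = ?p \<Zsemi> Pr1 C ?M ?N"
      unfolding now(2) using HomD[OF wtD(2)[OF s]] MN AB XYZ by simp
    ultimately show ?thesis
      unfolding stream_fun.simps precomp_simps shift_dot by simp
  qed
  have k: "stream_fun C (?N \<bullet> shift Y) (shift Z) (later t) n \<in> Hom C (lst C (?N \<bullet> shift (B \<bullet> Y)) n) (shift Z n)"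
    unfolding shift_dot by (rule stream_fun_hom[OF lt _ sh(3)]) (use MN sh in simp)
  show ?case
    unfolding stream_fun.simps raw_cmp_mem.simps(1,3) shift_dot Suc.IH[OF MN sh ls lt]
    using cmp_step[OF W e MN p q ls' e_Suc now(3) k] by (simp only: shift_dot)
qed

lemma now_raw_cmp:
  assumes XYZ: "X \<in> seq_obj C" "Y \<in> seq_obj C" "Z \<in> seq_obj C"
    and s: "wt C X Y s" and t: "wt C Y Z t"
  shows "now (raw_cmp C X Y Z s t) \<in> Hom C (X 0) ((mem s \<otimes> mem t) \<otimes> Z 0)"
    and "now (raw_cmp C X Y Z s t) \<Zsemi> Pr1 C (mem s \<otimes> mem t) (Z 0) \<Zsemi> Pr1 C (mem s) (mem t) =
      now s \<Zsemi> Pr1 C (mem s) (Y 0)"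
    and "now (raw_cmp C X Y Z s t) \<Zsemi> Pr1 C (mem s \<otimes> mem t) (Z 0) \<Zsemi> Pr2 C (mem s) (mem t) =
      stream_fun C X Y s 0 \<Zsemi> (now t \<Zsemi> Pr1 C (mem t) (Z 0))"
    and "now (raw_cmp C X Y Z s t) \<Zsemi> Pr2 C (mem s \<otimes> mem t) (Z 0) =
      stream_fun C X Y s 0 \<Zsemi> (now t \<Zsemi> Pr2 C (mem t) (Z 0))"
  using wt_now[OF s] wt_now[OF t] XYZ
  by (simp_all add: Hom_iff coherence_defs cross_def raw_cmp_def)

lemma raw_cmp_rest:
  "mem (raw_cmp C X Y Z s t) = mem s \<otimes> mem t"
  "later (raw_cmp C X Y Z s t) =
     raw_cmp_mem C (mem s) (mem t) (shift X) (shift Y) (shift Z) (later s) (later t)"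
  by (simp_all add: raw_cmp_def)

lemma wt_raw_cmp:
  assumes XYZ: "X \<in> seq_obj C" "Y \<in> seq_obj C" "Z \<in> seq_obj C"
    and s: "wt C X Y s" and t: "wt C Y Z t"
  shows "wt C X Z (raw_cmp C X Y Z s t)"
proof (rule wt.intros; unfold raw_cmp_rest)
  show "wt C ((mem s \<otimes> mem t) \<bullet> shift X) (shift Z)
     (raw_cmp_mem C (mem s) (mem t) (shift X) (shift Y) (shift Z) (later s) (later t))"
    by (rule wt_raw_cmp_mem) (intro wtD[OF s] wtD[OF t] seq_obj_intros XYZ)+
qed (use now_raw_cmp(1)[OF assms] wtD(1)[OF s] wtD(1)[OF t] in simp_all)

text \<open>From its second step on the composite is a \<open>raw_cmp_mem\<close>, so a case
  distinction on the index takes the place of another induction.\<close>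

lemma stream_fun_raw_cmp:
  assumes XYZ: "X \<in> seq_obj C" "Y \<in> seq_obj C" "Z \<in> seq_obj C"
    and s: "wt C X Y s" and t: "wt C Y Z t"
  shows "stream_fun C X Z (raw_cmp C X Y Z s t) n = lst_extend C X (stream_fun C X Y s) n \<Zsemi> stream_fun C Y Z t n"
proof -
  let ?M = "mem s" and ?N = "mem t" and ?r = "raw_cmp C X Y Z s t" and ?e = "stream_fun C X Y s"
  let ?p = "now ?r \<Zsemi> Pr1 C (?M \<otimes> ?N) (Z 0)" and ?q = "now t \<Zsemi> Pr1 C ?N (Z 0)"
  note now = now_raw_cmp[OF assms]
  note MN = wtD(1)[OF s] wtD(1)[OF t] and ls = wtD(3)[OF s] and lt = wtD(3)[OF t]
  note e = stream_fun_causal[OF s XYZ(1,2)] and q = now_Pr_hom(1)[OF t XYZ(3)]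
  have sh: "shift X \<in> seq_obj C" "shift Y \<in> seq_obj C" "shift Z \<in> seq_obj C" using XYZ by simp_all
  have p: "?p \<in> Hom C (X 0) (?M \<otimes> ?N)"
    using HomD[OF now(1)] MN XYZ by (simp add: Hom_iff)
  show ?thesis
  proof (cases n)
    case 0
    then show ?thesis
      unfolding 0 lst_extend_0[OF e XYZ(1)] using now(4) by (simp only: stream_fun.simps raw_cmp_rest)
  next
    case (Suc m)
    have e_Suc: "?e (Suc k) = carry C (?p \<Zsemi> Pr1 C ?M ?N) (shift X) k \<Zsemi>
        stream_fun C (?M \<bullet> shift X) (shift Y) (later s) k" for k
      unfolding stream_fun.simps now(2) ..
    have k: "stream_fun C (?N \<bullet> shift Y) (shift Z) (later t) m \<in> Hom C (lst C (?N \<bullet> shift Y) m) (shift Z m)"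
      by (rule stream_fun_hom[OF lt _ sh(3)]) (use MN sh in simp)
    show ?thesis
      unfolding Suc stream_fun.simps raw_cmp_rest stream_fun_raw_cmp_mem[OF MN sh ls lt]
      by (rule cmp_step[OF XYZ(1) e MN p q ls e_Suc now(3) k])
  qed
qed

section \<open>Tensor of streams\<close>

lemma tuple_swp_mid:
  "\<lbrakk>f \<in> Arr C; g \<in> Arr C; Dom C f = Dom C g; Cod C f = A \<otimes> B; Cod C g = D \<otimes> E;
    A \<in> Obj C; B \<in> Obj C; D \<in> Obj C; E \<in> Obj C\<rbrakk> \<Longrightarrow>
     tuple C f g \<Zsemi> swp_mid C A B D E =
     tuple C (tuple C (f \<Zsemi> Pr1 C A B) (g \<Zsemi> Pr1 C D E)) (tuple C (f \<Zsemi> Pr2 C A B) (g \<Zsemi> Pr2 C D E))"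
  by (auto simp: coherence_defs cross_def)

lemma swp_mid_eq:
  assumes [simp]: "A \<in> Obj C" "B \<in> Obj C" "D \<in> Obj C" "E \<in> Obj C"
  shows "swp_mid C A B D E = tuple C (Pr1 C A B \<boxtimes> Pr1 C D E) (Pr2 C A B \<boxtimes> Pr2 C D E)"
  by (simp add: coherence_defs cross_def)

text \<open>Acting by \<open>r\<close> on the memory and by \<open>shift u\<close> on the inputs is
  a \<open>carry\<close> followed by an action on the inputs alone. The square \<open>eq\<close>
  then lets the memory be computed from the image of the first input under \<open>u\<close>.\<close>

lemma carry_lst_map:
  assumes u: "u \<in> seq_hom C W X" and p: "p \<in> Hom C (W 0) P" and r: "r \<in> Hom C P M" and c: "c \<in> Hom C (X 0) M"
    and eq: "p \<Zsemi> r = u 0 \<Zsemi> c"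
  shows "carry C p (shift W) n \<Zsemi> lst_map C (r \<odot> shift u) n = lst_map C u (Suc n) \<Zsemi> carry C c (shift X) n"
proof -
  have W: "shift W \<in> seq_obj C" using seq_homD[OF u] by simp
  have M: "M \<in> Obj C" using HomD[OF r] by simp
  note iu = dot_hom_hom[OF id_hom[OF M] shift_hom[OF u]]
  have "seq_cmp C (r \<odot> seq_id C (shift W)) (Id C M \<odot> shift u) = r \<odot> shift u"
    using seq_homD[OF u] HomD[OF r] by (auto simp: fun_eq_iff dot_hom_def)
  then have ru: "lst_map C (r \<odot> shift u) n = carry C r (shift W) n \<Zsemi> lst_map C (Id C M \<odot> shift u) n"
    using lst_map_cmp[OF dot_hom_hom[OF r seq_id_hom[OF W]] iu] by (simp only: carry_def)
  show ?thesis
    unfolding ru lst_map_carry[OF u c] eq[symmetric] carry_cmp[OF p r W]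
    by (rule cmp_assoc[symmetric, OF carry_hom[OF p W] carry_hom[OF r W] lst_map_hom[OF iu]])
qed

lemma now_raw_ten_mem:
  assumes A: "A \<in> Obj C" "B \<in> Obj C" and X: "X \<in> seq_obj C" "Y \<in> seq_obj C" "X' \<in> seq_obj C" "Y' \<in> seq_obj C"
    and s: "wt C (A \<bullet> X) Y s" and t: "wt C (B \<bullet> X') Y' t"
  shows "now (raw_ten_mem C A B X Y X' Y' s t) =
    tuple C (tuple C (Pr1 C A B \<boxtimes> Pr1 C (X 0) (X' 0) \<Zsemi> (now s \<Zsemi> Pr1 C (mem s) (Y 0)))
        (Pr2 C A B \<boxtimes> Pr2 C (X 0) (X' 0) \<Zsemi> (now t \<Zsemi> Pr1 C (mem t) (Y' 0))))
      (tuple C (Pr1 C A B \<boxtimes> Pr1 C (X 0) (X' 0) \<Zsemi> (now s \<Zsemi> Pr2 C (mem s) (Y 0)))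
        (Pr2 C A B \<boxtimes> Pr2 C (X 0) (X' 0) \<Zsemi> (now t \<Zsemi> Pr2 C (mem t) (Y' 0))))"
proof -
  note D = wt_now[OF s] wt_now[OF t]
  show ?thesis
    using D A X by (simp add: tuple_swp_mid swp_mid_eq[of A B "X 0" "X' 0"])
qed

lemma now_raw_ten:
  assumes X: "X \<in> seq_obj C" "Y \<in> seq_obj C" "X' \<in> seq_obj C" "Y' \<in> seq_obj C"
    and s: "wt C X Y s" and t: "wt C X' Y' t"
  shows "now (raw_ten C X Y X' Y' s t) =
    tuple C (tuple C (Pr1 C (X 0) (X' 0) \<Zsemi> (now s \<Zsemi> Pr1 C (mem s) (Y 0)))
        (Pr2 C (X 0) (X' 0) \<Zsemi> (now t \<Zsemi> Pr1 C (mem t) (Y' 0))))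
      (tuple C (Pr1 C (X 0) (X' 0) \<Zsemi> (now s \<Zsemi> Pr2 C (mem s) (Y 0)))
        (Pr2 C (X 0) (X' 0) \<Zsemi> (now t \<Zsemi> Pr2 C (mem t) (Y' 0))))"
proof -
  note D = wt_now[OF s] wt_now[OF t]
  show ?thesis
    using D X by (simp add: raw_ten_def tuple_swp_mid cross_def)
qed

text \<open>The induction step shared by \<open>raw_ten_mem\<close> and \<open>raw_ten\<close>, where \<open>u\<close> and \<open>u'\<close> project the joint
  inputs \<open>W\<close> to the inputs of the two factors.\<close>

lemma ten_step:
  assumes u: "u \<in> seq_hom C W X" "u' \<in> seq_hom C W X'" and MN: "M \<in> Obj C" "N \<in> Obj C"
    and c: "c \<in> Hom C (X 0) M" "c' \<in> Hom C (X' 0) N"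
    and k: "k \<in> Hom C (lst C (M \<bullet> shift X) n) B" "k' \<in> Hom C (lst C (N \<bullet> shift X') n) B'"
  shows "carry C (tuple C (u 0 \<Zsemi> c) (u' 0 \<Zsemi> c')) (shift W) n \<Zsemi>
      tuple C (lst_map C (Pr1 C M N \<odot> shift u) n \<Zsemi> k) (lst_map C (Pr2 C M N \<odot> shift u') n \<Zsemi> k') =
    tuple C (lst_map C u (Suc n) \<Zsemi> (carry C c (shift X) n \<Zsemi> k)) (lst_map C u' (Suc n) \<Zsemi> (carry C c' (shift X') n \<Zsemi> k'))"
proof -
  note D = seq_homD[OF u(1)] seq_homD[OF u(2)] HomD[OF c(1)] HomD[OF c(2)]
  let ?p = "tuple C (u 0 \<Zsemi> c) (u' 0 \<Zsemi> c')"
  have p: "?p \<in> Hom C (W 0) (M \<otimes> N)" and pr: "Pr1 C M N \<in> Hom C (M \<otimes> N) M" "Pr2 C M N \<in> Hom C (M \<otimes> N) N"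
    using D MN by (simp_all add: Hom_iff)
  have eq: "?p \<Zsemi> Pr1 C M N = u 0 \<Zsemi> c" "?p \<Zsemi> Pr2 C M N = u' 0 \<Zsemi> c'"
    using D by simp_all
  have sh: "shift W \<in> seq_obj C" "shift X \<in> seq_obj C" "shift X' \<in> seq_obj C"
    using D by simp_all
  note m = carry_lst_map[OF u(1) p pr(1) c(1) eq(1), of n] carry_lst_map[OF u(2) p pr(2) c(2) eq(2), of n]
  note K = HomD[OF k(1)] HomD[OF k(2)]
    HomD[OF lst_map_hom[OF dot_hom_hom[OF pr(1) shift_hom[OF u(1)]], of n]]
    HomD[OF lst_map_hom[OF dot_hom_hom[OF pr(2) shift_hom[OF u(2)]], of n]]
    HomD[OF carry_hom[OF p sh(1), of n]] HomD[OF carry_hom[OF c(1) sh(2), of n]] HomD[OF carry_hom[OF c(2) sh(3), of n]]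
    HomD[OF lst_map_hom[OF u(1), of "Suc n"]] HomD[OF lst_map_hom[OF u(2), of "Suc n"]]
  show ?thesis
    using K by (simp add: m del: lst_map.simps(2))
qed

lemma wt_raw_ten_mem:
  assumes "A \<in> Obj C" "B \<in> Obj C" "X \<in> seq_obj C" "Y \<in> seq_obj C" "X' \<in> seq_obj C" "Y' \<in> seq_obj C"
    and "wt C (A \<bullet> X) Y s" "wt C (B \<bullet> X') Y' t"
  shows "wt C ((A \<otimes> B) \<bullet> seq_ten0 C X X') (seq_ten0 C Y Y') (raw_ten_mem C A B X Y X' Y' s t)"
proof (rule wt_coinduct[where R = "\<lambda>W V r. \<exists>A B X Y X' Y' s t. W = (A \<otimes> B) \<bullet> seq_ten0 C X X' \<and>
    V = seq_ten0 C Y Y' \<and> r = raw_ten_mem C A B X Y X' Y' s t \<and>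
    A \<in> Obj C \<and> B \<in> Obj C \<and> X \<in> seq_obj C \<and> Y \<in> seq_obj C \<and> X' \<in> seq_obj C \<and> Y' \<in> seq_obj C \<and>
    wt C (A \<bullet> X) Y s \<and> wt C (B \<bullet> X') Y' t"], goal_cases)
  case 1
  then show ?case using assms by blast
next
  case (2 W V r)
  then obtain A B X Y X' Y' s t where r: "W = (A \<otimes> B) \<bullet> seq_ten0 C X X'" "V = seq_ten0 C Y Y'"
    "r = raw_ten_mem C A B X Y X' Y' s t"
    and AB: "A \<in> Obj C" "B \<in> Obj C" and X: "X \<in> seq_obj C" "Y \<in> seq_obj C" "X' \<in> seq_obj C" "Y' \<in> seq_obj C"
    and s: "wt C (A \<bullet> X) Y s" and t: "wt C (B \<bullet> X') Y' t"
    by blast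
  note D = wt_now[OF s] wt_now[OF t]
  have "wt C (mem s \<bullet> shift X) (shift Y) (later s)" "wt C (mem t \<bullet> shift X') (shift Y') (later t)"
    using D by simp_all
  moreover have "mem r \<bullet> shift W = (mem s \<otimes> mem t) \<bullet> seq_ten0 C (shift X) (shift X')"
    "shift V = seq_ten0 C (shift Y) (shift Y')"
    "later r = raw_ten_mem C (mem s) (mem t) (shift X) (shift Y) (shift X') (shift Y') (later s) (later t)"
    by (simp_all add: r)
  moreover have "now r \<in> Hom C (W 0) (mem r \<otimes> V 0)"
    unfolding r(3) now_raw_ten_mem[OF AB X s t] using D AB X
    by (simp add: r Hom_iff del: raw_ten_mem.simps(2))
  moreover have "mem s \<in> Obj C" "mem t \<in> Obj C" "mem r \<in> Obj C"
    using D by (simp_all add: r)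
  ultimately show ?case
    using seq_obj_intros(1)[OF X(1)] seq_obj_intros(1)[OF X(2)] seq_obj_intros(1)[OF X(3)]
      seq_obj_intros(1)[OF X(4)] by blast
qed

lemma Pr_dot_hom:
  assumes "A \<in> Obj C" "B \<in> Obj C" "X \<in> seq_obj C" "X' \<in> seq_obj C"
  shows "Pr1 C A B \<odot> (\<lambda>n. Pr1 C (X n) (X' n)) \<in> seq_hom C ((A \<otimes> B) \<bullet> seq_ten0 C X X') (A \<bullet> X)"
    and "Pr2 C A B \<odot> (\<lambda>n. Pr2 C (X n) (X' n)) \<in> seq_hom C ((A \<otimes> B) \<bullet> seq_ten0 C X X') (B \<bullet> X')"
  using assms by (intro dot_hom_hom Pr_seq_hom; simp add: Hom_iff)+

text \<open>The factors do not interact: each is reached by projecting joint memory and joint inputs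
  at once. As for composition, arbitrary initial memories are what the induction needs.\<close>

lemma stream_fun_raw_ten_mem:
  assumes "A \<in> Obj C" "B \<in> Obj C" "X \<in> seq_obj C" "Y \<in> seq_obj C" "X' \<in> seq_obj C" "Y' \<in> seq_obj C"
    and "wt C (A \<bullet> X) Y s" "wt C (B \<bullet> X') Y' t"
  shows "stream_fun C ((A \<otimes> B) \<bullet> seq_ten0 C X X') (seq_ten0 C Y Y') (raw_ten_mem C A B X Y X' Y' s t) n =
    tuple C (lst_map C (Pr1 C A B \<odot> (\<lambda>n. Pr1 C (X n) (X' n))) n \<Zsemi> stream_fun C (A \<bullet> X) Y s n)
      (lst_map C (Pr2 C A B \<odot> (\<lambda>n. Pr2 C (X n) (X' n))) n \<Zsemi> stream_fun C (B \<bullet> X') Y' t n)"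
  using assms
proof (induction n arbitrary: A B X Y X' Y' s t)
  case (0 A B X Y X' Y' s t)
  note D = wt_now[OF 0(7)] wt_now[OF 0(8)]
  show ?case
    unfolding stream_fun.simps now_raw_ten_mem[OF 0] using D 0(1-6) by (simp del: raw_ten_mem.simps(2))
next
  case (Suc n A B X Y X' Y' s t)
  note AB = Suc.prems(1,2) and X = Suc.prems(3-6) and s = Suc.prems(7) and t = Suc.prems(8)
  note D = wt_now[OF s] wt_now[OF t]
  let ?u = "Pr1 C A B \<odot> (\<lambda>n. Pr1 C (X n) (X' n))" and ?u' = "Pr2 C A B \<odot> (\<lambda>n. Pr2 C (X n) (X' n))"
  let ?W = "(A \<otimes> B) \<bullet> seq_ten0 C X X'" and ?r = "raw_ten_mem C A B X Y X' Y' s t"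
  let ?c = "now s \<Zsemi> Pr1 C (mem s) (Y 0)" and ?c' = "now t \<Zsemi> Pr1 C (mem t) (Y' 0)"
  have ls: "wt C (mem s \<bullet> shift X) (shift Y) (later s)" and lt: "wt C (mem t \<bullet> shift X') (shift Y') (later t)"
    using D by simp_all
  have sh: "shift X \<in> seq_obj C" "shift Y \<in> seq_obj C" "shift X' \<in> seq_obj C" "shift Y' \<in> seq_obj C"
    using X by simp_all
  note MN = D(1) wtD(1)[OF t]
  have o: "mem s \<bullet> shift X \<in> seq_obj C" "mem t \<bullet> shift X' \<in> seq_obj C" using MN sh by simp_all
  have k: "stream_fun C (mem s \<bullet> shift X) (shift Y) (later s) n \<in> Hom C (lst C (mem s \<bullet> shift (A \<bullet> X)) n) (shift Y n)"
    "stream_fun C (mem t \<bullet> shift X') (shift Y') (later t) n \<in> Hom C (lst C (mem t \<bullet> shift (B \<bullet> X')) n) (shift Y' n)"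
    unfolding shift_dot by (intro stream_fun_hom ls lt sh o)+
  have p: "now ?r \<Zsemi> Pr1 C (mem s \<otimes> mem t) (seq_ten0 C Y Y' 0) = tuple C (?u 0 \<Zsemi> ?c) (?u' 0 \<Zsemi> ?c')"
    unfolding now_raw_ten_mem[OF AB X s t] using D AB X by simp
  \<comment> \<open>Projections commute with \<open>shift\<close>; folding this into the induction
    hypothesis gives it the form expected by \<open>ten_step\<close>.\<close>
  have su: "shift ?u = (\<lambda>n. Pr1 C (shift X n) (shift X' n))" "shift ?u' = (\<lambda>n. Pr2 C (shift X n) (shift X' n))"
    by (simp_all add: fun_eq_iff)
  note ih = Suc.IH[OF MN sh ls lt, folded su]
  show ?case
    unfolding stream_fun.simps raw_ten_mem.simps(1,3) p shift_dot shift_seq_ten0 ih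
    using ten_step[OF Pr_dot_hom[OF AB X(1,3)] MN now_Pr_hom(1)[OF s X(2)] now_Pr_hom(1)[OF t X(4)] k]
    by (simp only: shift_dot shift_seq_ten0)
qed

lemma raw_ten_rest:
  "mem (raw_ten C X Y X' Y' s t) = mem s \<otimes> mem t"
  "later (raw_ten C X Y X' Y' s t) =
     raw_ten_mem C (mem s) (mem t) (shift X) (shift Y) (shift X') (shift Y') (later s) (later t)"
  by (simp_all add: raw_ten_def)

lemma wt_raw_ten:
  assumes X: "X \<in> seq_obj C" "Y \<in> seq_obj C" "X' \<in> seq_obj C" "Y' \<in> seq_obj C"
    and s: "wt C X Y s" and t: "wt C X' Y' t"
  shows "wt C (seq_ten0 C X X') (seq_ten0 C Y Y') (raw_ten C X Y X' Y' s t)"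
proof (rule wt.intros; unfold raw_ten_rest shift_seq_ten0)
  note D = wt_now[OF s] wt_now[OF t]
  show "now (raw_ten C X Y X' Y' s t) \<in> Hom C (seq_ten0 C X X' 0) ((mem s \<otimes> mem t) \<otimes> seq_ten0 C Y Y' 0)"
    unfolding now_raw_ten[OF assms] using D X by (simp add: Hom_iff)
  show "wt C ((mem s \<otimes> mem t) \<bullet> seq_ten0 C (shift X) (shift X')) (seq_ten0 C (shift Y) (shift Y'))
     (raw_ten_mem C (mem s) (mem t) (shift X) (shift Y) (shift X') (shift Y') (later s) (later t))"
    by (rule wt_raw_ten_mem) (intro wtD[OF s] wtD[OF t] seq_obj_intros X)+
  show "mem s \<otimes> mem t \<in> Obj C" using D by simp
qed

lemma stream_fun_raw_ten:
  assumes X: "X \<in> seq_obj C" "Y \<in> seq_obj C" "X' \<in> seq_obj C" "Y' \<in> seq_obj C"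
    and s: "wt C X Y s" and t: "wt C X' Y' t"
  shows "stream_fun C (seq_ten0 C X X') (seq_ten0 C Y Y') (raw_ten C X Y X' Y' s t) n =
    tuple C (lst_map C (\<lambda>n. Pr1 C (X n) (X' n)) n \<Zsemi> stream_fun C X Y s n)
      (lst_map C (\<lambda>n. Pr2 C (X n) (X' n)) n \<Zsemi> stream_fun C X' Y' t n)"
proof -
  note D = wt_now[OF s] wt_now[OF t]
  show ?thesis
  proof (cases n)
    case 0
    then show ?thesis
      unfolding 0 stream_fun.simps now_raw_ten[OF assms] raw_ten_rest using D X by simp
  next
    case (Suc m)
    let ?u = "\<lambda>n. Pr1 C (X n) (X' n)" and ?u' = "\<lambda>n. Pr2 C (X n) (X' n)"
    let ?c = "now s \<Zsemi> Pr1 C (mem s) (Y 0)" and ?c' = "now t \<Zsemi> Pr1 C (mem t) (Y' 0)"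
    have sh: "shift X \<in> seq_obj C" "shift Y \<in> seq_obj C" "shift X' \<in> seq_obj C" "shift Y' \<in> seq_obj C"
      using X by simp_all
    note MN = wtD(1)[OF s] wtD(1)[OF t] and ls = wtD(3)[OF s] and lt = wtD(3)[OF t]
    have o: "mem s \<bullet> shift X \<in> seq_obj C" "mem t \<bullet> shift X' \<in> seq_obj C" using MN sh by simp_all
    have p: "now (raw_ten C X Y X' Y' s t) \<Zsemi> Pr1 C (mem s \<otimes> mem t) (seq_ten0 C Y Y' 0) = tuple C (?u 0 \<Zsemi> ?c) (?u' 0 \<Zsemi> ?c')"
      unfolding now_raw_ten[OF assms] using D X by simp
    have su: "shift ?u = (\<lambda>n. Pr1 C (shift X n) (shift X' n))" "shift ?u' = (\<lambda>n. Pr2 C (shift X n) (shift X' n))"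
      by (simp_all add: fun_eq_iff)
    note mem = stream_fun_raw_ten_mem[OF MN sh ls lt, folded su]
    show ?thesis
      unfolding Suc stream_fun.simps raw_ten_rest p shift_seq_ten0 mem
      using ten_step[OF Pr_seq_hom[OF X(1,3)] MN now_Pr_hom(1)[OF s X(2)] now_Pr_hom(1)[OF t X(4)]
          stream_fun_hom[OF ls o(1) sh(2)] stream_fun_hom[OF lt o(2) sh(4)]]
      by (simp only: shift_seq_ten0)
  qed
qed

section \<open>The symmetric monoidal category of streams\<close>

lemma STREAM_simps:
  "SObj (STREAM C) = seq_obj C" "SHom (STREAM C) = streams C"
  "SId (STREAM C) X = stream_class C X X (raw_lift C (seq_id C X))"
  "SCmp (STREAM C) X Y Z c d = (\<Union>s\<in>c. class_map (streq_rel C X Z) (raw_cmp C X Y Z s) d)"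
  "Ten0 (STREAM C) = seq_ten0 C"
  "Ten (STREAM C) X Y X' Y' c d =
     (\<Union>s\<in>c. class_map (streq_rel C (seq_ten0 C X X') (seq_ten0 C Y Y')) (raw_ten C X Y X' Y' s) d)"
  "Unit (STREAM C) = (\<lambda>n. \<one>)"
  "Assoc (STREAM C) X Y Z = stream_class C (seq_ten0 C (seq_ten0 C X Y) Z) (seq_ten0 C X (seq_ten0 C Y Z))
     (raw_lift C (\<lambda>n. asc C (X n) (Y n) (Z n)))"
  "LUnit (STREAM C) X = stream_class C (seq_ten0 C (\<lambda>n. \<one>) X) X (raw_lift C (\<lambda>n. lun C (X n)))"
  "RUnit (STREAM C) X = stream_class C (seq_ten0 C X (\<lambda>n. \<one>)) X (raw_lift C (\<lambda>n. run C (X n)))"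
  "Sym (STREAM C) X Y = stream_class C (seq_ten0 C X Y) (seq_ten0 C Y X) (raw_lift C (\<lambda>n. swp C (X n) (Y n)))"
  by (simp_all add: STREAM_def)

text \<open>The nested unions in the operations of \<open>STREAM\<close> collapse because
  equivalence is equality of causal functions, so every choice of representatives of both arguments
  gives the same class.\<close>

lemma UN_class_map_stream_class:
  assumes X: "X \<in> seq_obj C" "Y \<in> seq_obj C" "X' \<in> seq_obj C" "Y' \<in> seq_obj C" "V \<in> seq_obj C" "W \<in> seq_obj C"
    and s: "wt C X Y s" and t: "wt C X' Y' t"
    and wt: "\<And>s t. \<lbrakk>wt C X Y s; wt C X' Y' t\<rbrakk> \<Longrightarrow> wt C V W (g s t)"
    and eq: "\<And>s t s' t'. \<lbrakk>wt C X Y s; wt C X' Y' t; wt C X Y s'; wt C X' Y' t';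
      stream_fun C X Y s = stream_fun C X Y s'; stream_fun C X' Y' t = stream_fun C X' Y' t'\<rbrakk> \<Longrightarrow>
      stream_fun C V W (g s t) = stream_fun C V W (g s' t')"
  shows "(\<Union>s\<in>stream_class C X Y s. class_map (streq_rel C V W) (g s) (stream_class C X' Y' t)) =
    stream_class C V W (g s t)"
proof -
  have "class_map (streq_rel C V W) (g s') (stream_class C X' Y' t) = stream_class C V W (g s t)"
    if "s' \<in> stream_class C X Y s" for s'
  proof -
    have s': "wt C X Y s'" and ss': "stream_fun C X Y s' = stream_fun C X Y s"
      using that by (simp_all add: mem_stream_class[OF X(1,2)])
    have "class_map (streq_rel C V W) (g s') (stream_class C X' Y' t) = stream_class C V W (g s' t)"
      by (rule class_map_stream_class[OF X(3-6) t]) (intro conjI wt[OF s'] eq[OF s' _ s' t refl]; assumption)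
    also have "\<dots> = stream_class C V W (g s t)"
      by (rule stream_class_eqI[OF X(5,6) wt[OF s' t] wt[OF s t] eq[OF s' t s t ss' refl]])
    finally show ?thesis .
  qed
  moreover have "s \<in> stream_class C X Y s"
    using s by (simp add: mem_stream_class[OF X(1,2)])
  ultimately show ?thesis by blast
qed

lemma SCmp_stream_class:
  assumes XYZ: "X \<in> seq_obj C" "Y \<in> seq_obj C" "Z \<in> seq_obj C"
    and s: "wt C X Y s" and t: "wt C Y Z t"
  shows "SCmp (STREAM C) X Y Z (stream_class C X Y s) (stream_class C Y Z t) =
    stream_class C X Z (raw_cmp C X Y Z s t)"
  unfolding STREAM_simps
proof (rule UN_class_map_stream_class[OF XYZ(1,2) XYZ(2,3) XYZ(1,3) s t])
  fix s t assume "wt C X Y s" "wt C Y Z t"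
  then show "wt C X Z (raw_cmp C X Y Z s t)" by (rule wt_raw_cmp[OF XYZ])
next
  fix s t s' t'
  assume s: "wt C X Y s" "wt C Y Z t" and s': "wt C X Y s'" "wt C Y Z t'"
    and eq: "stream_fun C X Y s = stream_fun C X Y s'" "stream_fun C Y Z t = stream_fun C Y Z t'"
  show "stream_fun C X Z (raw_cmp C X Y Z s t) = stream_fun C X Z (raw_cmp C X Y Z s' t')"
    by (rule ext) (simp only: stream_fun_raw_cmp[OF XYZ s] stream_fun_raw_cmp[OF XYZ s'] eq)
qed

lemma Ten_stream_class:
  assumes X: "X \<in> seq_obj C" "Y \<in> seq_obj C" "X' \<in> seq_obj C" "Y' \<in> seq_obj C"
    and s: "wt C X Y s" and t: "wt C X' Y' t"
  shows "Ten (STREAM C) X Y X' Y' (stream_class C X Y s) (stream_class C X' Y' t) =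
    stream_class C (seq_ten0 C X X') (seq_ten0 C Y Y') (raw_ten C X Y X' Y' s t)"
  unfolding STREAM_simps
proof (rule UN_class_map_stream_class[OF X seq_obj_intros(3)[OF X(1,3)] seq_obj_intros(3)[OF X(2,4)] s t])
  fix s t assume "wt C X Y s" "wt C X' Y' t"
  then show "wt C (seq_ten0 C X X') (seq_ten0 C Y Y') (raw_ten C X Y X' Y' s t)" by (rule wt_raw_ten[OF X])
next
  fix s t s' t'
  assume s: "wt C X Y s" "wt C X' Y' t" and s': "wt C X Y s'" "wt C X' Y' t'"
    and eq: "stream_fun C X Y s = stream_fun C X Y s'" "stream_fun C X' Y' t = stream_fun C X' Y' t'"
  show "stream_fun C (seq_ten0 C X X') (seq_ten0 C Y Y') (raw_ten C X Y X' Y' s t) =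
    stream_fun C (seq_ten0 C X X') (seq_ten0 C Y Y') (raw_ten C X Y X' Y' s' t')"
    by (rule ext) (simp only: stream_fun_raw_ten[OF X s] stream_fun_raw_ten[OF X s'] eq)
qed

lemma stream_class_fun_lift:
  assumes u: "u \<in> seq_hom C X Y"
  shows "stream_class_fun C X Y (stream_class C X Y (raw_lift C u)) = seq_cmp C (lst_counit C X) u"
  unfolding stream_class_fun_class[OF seq_homD(4,5)[OF u] wt_raw_lift[OF u]]
  by (rule ext) (simp only: stream_fun_raw_lift[OF u] seq_cmp_apply)

lemma smc_iso_stream_class_fun:
  "smc_identity_on_objects_iso (STREAM C) (cokleisli (SEQ C) (List_plus C)) (stream_class_fun C)"
proof (unfold_locales, unfold STREAM_simps(1,2,5,7) cokleisli_List_plus_simps(1,2,5,7))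
  fix X Y assume "X \<in> seq_obj C" "Y \<in> seq_obj C"
  then show "bij_betw (stream_class_fun C X Y) (streams C X Y) (seq_hom C (lst C X) Y)"
    using bij_stream_class_fun by (simp only: causal_eq)
next
  fix X assume X: "X \<in> seq_obj C"
  note c = seq_homD[OF lst_counit_hom[OF X]]
  show "stream_class_fun C X X (SId (STREAM C) X) = SId (cokleisli (SEQ C) (List_plus C)) X"
    unfolding STREAM_simps stream_class_fun_lift[OF seq_id_hom[OF X]]
    using c by (simp add: fun_eq_iff)
next
  fix X Y Z c d
  assume XYZ: "X \<in> seq_obj C" "Y \<in> seq_obj C" "Z \<in> seq_obj C"
    and "c \<in> streams C X Y" "d \<in> streams C Y Z"
  then obtain s t where s: "wt C X Y s" "c = stream_class C X Y s" and t: "wt C Y Z t" "d = stream_class C Y Z t"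
    by (elim streams_cases)
  note f = stream_fun_causal[OF s(1) XYZ(1,2)] and g = stream_fun_causal[OF t(1) XYZ(2,3)]
  have assoc: "lst_comult C X n \<Zsemi> lst_map C (stream_fun C X Y s) n \<Zsemi> stream_fun C Y Z t n =
      lst_comult C X n \<Zsemi> (lst_map C (stream_fun C X Y s) n \<Zsemi> stream_fun C Y Z t n)" for n
    by (rule cmp_assoc[OF lst_comult_hom'[OF XYZ(1)] lst_map_hom[OF f[unfolded causal_eq]]
          stream_fun_hom[OF t(1) XYZ(2,3)]])
  show "stream_class_fun C X Z (SCmp (STREAM C) X Y Z c d) =
    SCmp (cokleisli (SEQ C) (List_plus C)) X Y Z (stream_class_fun C X Y c) (stream_class_fun C Y Z d)"
    unfolding s(2) t(2) SCmp_stream_class[OF XYZ s(1) t(1)] stream_class_fun_class[OF XYZ(1,2) s(1)]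
      stream_class_fun_class[OF XYZ(2,3) t(1)] stream_class_fun_class[OF XYZ(1,3) wt_raw_cmp[OF XYZ s(1) t(1)]]
      cokleisli_List_plus_simps
    by (rule ext) (simp only: stream_fun_raw_cmp[OF XYZ s(1) t(1)] lst_extend_def seq_cmp_apply assoc)
next
  fix X Y X' Y' c d
  assume X: "X \<in> seq_obj C" "Y \<in> seq_obj C" "X' \<in> seq_obj C" "Y' \<in> seq_obj C"
    and "c \<in> streams C X Y" "d \<in> streams C X' Y'"
  then obtain s t where s: "wt C X Y s" "c = stream_class C X Y s" and t: "wt C X' Y' t" "d = stream_class C X' Y' t"
    by (elim streams_cases)
  note D = HomD[OF stream_fun_hom[OF s(1) X(1,2)]] HomD[OF stream_fun_hom[OF t(1) X(3,4)]]
    HomD[OF lst_map_hom[OF Pr_seq_hom(1)[OF X(1,3)]]] HomD[OF lst_map_hom[OF Pr_seq_hom(2)[OF X(1,3)]]]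
  \<comment> \<open>\<open>cm_split\<close> pairs the projections of a prefix of pairs onto the two
    prefixes; the product map after it is absorbed into the components of the pair.\<close>
  have "tuple C (lst_map C (\<lambda>n. Pr1 C (X n) (X' n)) n \<Zsemi> stream_fun C X Y s n)
      (lst_map C (\<lambda>n. Pr2 C (X n) (X' n)) n \<Zsemi> stream_fun C X' Y' t n) =
    cm_split (List_plus C) X X' n \<Zsemi> stream_fun C X Y s n \<boxtimes> stream_fun C X' Y' t n" for n
    using D by (simp del: stream_fun.simps)
  then show "stream_class_fun C (seq_ten0 C X X') (seq_ten0 C Y Y') (Ten (STREAM C) X Y X' Y' c d) =
    Ten (cokleisli (SEQ C) (List_plus C)) X Y X' Y' (stream_class_fun C X Y c) (stream_class_fun C X' Y' d)"
    unfolding s(2) t(2) Ten_stream_class[OF X s(1) t(1)] stream_class_fun_class[OF X(1,2) s(1)]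
      stream_class_fun_class[OF X(3,4) t(1)] cokleisli_List_plus_simps
      stream_class_fun_class[OF seq_obj_intros(3)[OF X(1,3)] seq_obj_intros(3)[OF X(2,4)] wt_raw_ten[OF X s(1) t(1)]]
    by (intro ext) (simp only: stream_fun_raw_ten[OF X s(1) t(1)] seq_cmp_apply)
qed (simp_all add: STREAM_simps stream_class_fun_lift coherence_seq_hom)

text \<open>The coherence laws are inherited from causal functions. What remains is that the
  operations yield classes of well-typed streams.\<close>

lemma symmetric_monoidal_STREAM: "symmetric_monoidal_category (STREAM C)"
proof (rule symmetric_monoidal_category_transfer[OF symmetric_monoidal_cokleisli smc_iso_stream_class_fun];
    unfold STREAM_simps(1,2,5,7))
  fix X Y Z c d
  assume XYZ: "X \<in> seq_obj C" "Y \<in> seq_obj C" "Z \<in> seq_obj C"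
    and "c \<in> streams C X Y" "d \<in> streams C Y Z"
  then obtain s t where s: "wt C X Y s" "c = stream_class C X Y s" and t: "wt C Y Z t" "d = stream_class C Y Z t"
    by (elim streams_cases)
  show "SCmp (STREAM C) X Y Z c d \<in> streams C X Z"
    unfolding s(2) t(2) SCmp_stream_class[OF XYZ s(1) t(1)]
    by (rule stream_class_in[OF wt_raw_cmp[OF XYZ s(1) t(1)]])
next
  fix X Y X' Y' c d
  assume X: "X \<in> seq_obj C" "Y \<in> seq_obj C" "X' \<in> seq_obj C" "Y' \<in> seq_obj C"
    and "c \<in> streams C X Y" "d \<in> streams C X' Y'"
  then obtain s t where s: "wt C X Y s" "c = stream_class C X Y s" and t: "wt C X' Y' t" "d = stream_class C X' Y' t"
    by (elim streams_cases)
  show "Ten (STREAM C) X Y X' Y' c d \<in> streams C (seq_ten0 C X X') (seq_ten0 C Y Y')"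
    unfolding s(2) t(2) Ten_stream_class[OF X s(1) t(1)]
    by (rule stream_class_in[OF wt_raw_ten[OF X s(1) t(1)]])
qed (simp_all add: STREAM_simps stream_class_in wt_raw_lift coherence_seq_hom)

end

theorem theorem8p9:
  fixes C :: "('o, 'm) cart_cat"
  assumes "cartesian_category C"
  shows "final_fixpoint TYPE('q) C (stream_prof C) (stream_coalg C) \<and>
    final_fixpoint TYPE('q) C (causal_prof C) (causal_coalg C) \<and>
    symmetric_monoidal_category (STREAM C) \<and>
    comonad (SEQ C) (List_plus C) \<and>
    symmetric_monoidal_category (cokleisli (SEQ C) (List_plus C)) \<and>
    (\<exists>F. coalgebra_hom C (stream_prof C) (stream_coalg C) (causal_prof C) (causal_coalg C) F \<and>
       (\<forall>X \<in> seq_obj C. \<forall>Y \<in> seq_obj C. bij_betw (F X Y) (streams C X Y) (causal C X Y)) \<and>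
       smc_identity_on_objects_iso (STREAM C) (cokleisli (SEQ C) (List_plus C)) F)"
proof -
  interpret cartesian_category C by fact
  \<comment> \<open>A single family, \<open>stream_class_fun\<close>, witnesses all clauses on
    \<open>F\<close>: the monoidal isomorphism is the comparison of the two final
    coalgebras.\<close>
  show ?thesis
    using final_fixpoint_stream final_fixpoint_causal symmetric_monoidal_STREAM comonad_List_plus
      symmetric_monoidal_cokleisli coalgebra_hom_stream bij_stream_class_fun smc_iso_stream_class_fun
    by blast
qed

end
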